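(* Let $m\geq 2$ and $n\geq 1$ be integers and let $q_1,q_2,\dots,q_n$ be integers relatively prime to $m$. Then $N\mathcal{E}(L(m;q_1,q_2,\dots,q_n)) = 2n+1$.
   Context: The (generalized) lens space is $L(m;q_1,\dots,q_n)=S^{2n+1}/\Gamma$, where $S^{2n+1}\subset\mathbb{C}^{n+1}$ is the unit sphere and $\Gamma$ is the cyclic group of order $m$ generated by the homeomorphism $\gamma(z_0,z_1,\dots,z_n)=(z_0e^{2\pi i/m}, z_1e^{2\pi i q_1/m},\dots,z_ne^{2\pi i q_n/m})$. Spaces, maps and homotopies are based; $[X,X]$ is the set of based homotopy classes of self-maps of $X$, and $\mathcal{E}(X)\subset [X,X]$ is the set of homotopy classes of self-homotopy equivalences. For a $0$-connected space $X$, $\mathcal{A}_\sharp^k(X)=\{f\in[X,X] : f_\sharp:\pi_i(X)\to\pi_i(X)\text{ is an isomorphism for all } i\le k\}$, and the self-closeness number is $N\mathcal{E}(X)=\min\{k : \mathcal{A}_\sharp^k(X)=\mathcal{E}(X)\}$, where $k$ ranges over $0,1,2,\dots,\infty$. *)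

theory Defs
  imports "HOL-Analysis.Analysis" "HOL-Algebra.Group" "HOL-Library.Extended_Nat"
begin

section \<open>Quotient topology\<close>

definition quotient_topology :: "'a topology \<Rightarrow> ('a \<Rightarrow> 'b) \<Rightarrow> 'b topology" where
  "quotient_topology X p =
     topology (\<lambda>U. U \<subseteq> p ` topspace X \<and> openin X {x \<in> topspace X. p x \<in> U})"

lemma openin_quotient_topology:
  "openin (quotient_topology X p) U \<longleftrightarrow>
     U \<subseteq> p ` topspace X \<and> openin X {x \<in> topspace X. p x \<in> U}"
proof -
  let ?P = "\<lambda>U. U \<subseteq> p ` topspace X \<and> openin X {x \<in> topspace X. p x \<in> U}"
  have "istopology ?P"
    unfolding istopology_def
  proof (intro conjI allI impI)
    fix S T assume S: "?P S" and T: "?P T"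
    have eq: "{x \<in> topspace X. p x \<in> S \<inter> T} = {x \<in> topspace X. p x \<in> S} \<inter> {x \<in> topspace X. p x \<in> T}"
      by blast
    show "S \<inter> T \<subseteq> p ` topspace X" using S by blast
    show "openin X {x \<in> topspace X. p x \<in> S \<inter> T}" unfolding eq using S T by blast
  next
    fix K assume K: "\<forall>S\<in>K. ?P S"
    have eq: "{x \<in> topspace X. p x \<in> \<Union>K} = (\<Union>S\<in>K. {x \<in> topspace X. p x \<in> S})"
      by blast
    show "\<Union>K \<subseteq> p ` topspace X" using K by blast
    show "openin X {x \<in> topspace X. p x \<in> \<Union>K}" unfolding eq using K by blast
  qed
  then show ?thesis
    by (simp add: quotient_topology_def)
qed

lemma topspace_quotient_topology [simp]: "topspace (quotient_topology X p) = p ` topspace X"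
proof
  show "topspace (quotient_topology X p) \<subseteq> p ` topspace X"
    using openin_quotient_topology [of X p "topspace (quotient_topology X p)"] by simp
  have "{x \<in> topspace X. p x \<in> p ` topspace X} = topspace X" by blast
  then have "openin (quotient_topology X p) (p ` topspace X)"
    by (simp add: openin_quotient_topology)
  then show "p ` topspace X \<subseteq> topspace (quotient_topology X p)"
    by (rule openin_subset)
qed

lemma quotient_map_quotient_topology: "quotient_map X (quotient_topology X p) p"
  by (auto simp: quotient_map_def openin_quotient_topology)


section \<open>Lens spaces\<close>

text \<open>
  The space \<open>\<complex>\<^sup>n\<^sup>+\<^sup>1\<close> is realised as the sequences of complex numbers that vanish beyond index \<open>n\<close>;
  the topology induced from the product topology on \<open>nat \<Rightarrow> complex\<close> is the usual one.
\<close>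

definition complex_sphere :: "nat \<Rightarrow> (nat \<Rightarrow> complex) set" where
  "complex_sphere n = {z. (\<Sum>j\<le>n. (cmod (z j))\<^sup>2) = 1 \<and> (\<forall>j>n. z j = 0)}"

text \<open>The coordinate \<open>z\<^sub>0\<close> is rotated by \<open>2\<pi>/m\<close>, so the value \<open>q 0\<close> is irrelevant.\<close>

definition lens_gen :: "nat \<Rightarrow> (nat \<Rightarrow> int) \<Rightarrow> (nat \<Rightarrow> complex) \<Rightarrow> (nat \<Rightarrow> complex)" where
  "lens_gen m q z =
     (\<lambda>j. z j * exp (2 * of_real pi * \<i> * of_int (if j = 0 then 1 else q j) / of_nat m))"

text \<open>
  Since the generator has finite order (\<open>lens_gen_order\<close>), its natural powers
  already form the cyclic group that it generates.
\<close>

definition lens_orbit :: "nat \<Rightarrow> (nat \<Rightarrow> int) \<Rightarrow> (nat \<Rightarrow> complex) \<Rightarrow> (nat \<Rightarrow> complex) set" where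
  "lens_orbit m q z = {(lens_gen m q ^^ k) z | k. True}"

definition lens_space :: "nat \<Rightarrow> nat \<Rightarrow> (nat \<Rightarrow> int) \<Rightarrow> (nat \<Rightarrow> complex) set topology" where
  "lens_space n m q = quotient_topology (top_of_set (complex_sphere n)) (lens_orbit m q)"

lemma lens_gen_funpow:
  "(lens_gen m q ^^ k) z =
     (\<lambda>j. z j * exp (2 * of_real pi * \<i> * of_int (if j = 0 then 1 else q j) / of_nat m) ^ k)"
  by (induction k) (simp_all add: lens_gen_def fun_eq_iff)

lemma lens_gen_order:
  assumes "m > 0"
  shows "lens_gen m q ^^ m = id"
proof -
  have "exp (2 * of_real pi * \<i> * of_int a / of_nat m) ^ m = (1::complex)" for a :: int
  proof -
    have "exp (2 * of_real pi * \<i> * of_int a / of_nat m) ^ m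
        = exp (of_nat m * (2 * of_real pi * \<i> * of_int a / of_nat m) :: complex)"
      by (rule exp_of_nat_mult [symmetric])
    also have "\<dots> = exp (2 * of_int a * of_real pi * \<i>)"
      using assms by (simp add: mult_ac)
    also have "\<dots> = 1"
      using exp_integer_2pi [of "of_int a"] by (simp add: mult_ac)
    finally show ?thesis .
  qed
  then show ?thesis
    unfolding fun_eq_iff lens_gen_funpow id_apply by (metis mult.right_neutral)
qed


section \<open>Homotopy classes of maps of pairs into a based space\<close>

definition pair_maps :: "'a topology \<Rightarrow> 'a set \<Rightarrow> 'b topology \<Rightarrow> 'b \<Rightarrow> ('a \<Rightarrow> 'b) set" where
  "pair_maps X A Y y0 = {f. continuous_map X Y f \<and> f ` A \<subseteq> {y0}}"

definition pair_htpy :: "'a topology \<Rightarrow> 'a set \<Rightarrow> 'b topology \<Rightarrow> 'b \<Rightarrow> (('a \<Rightarrow> 'b) \<times> ('a \<Rightarrow> 'b)) set" where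
  "pair_htpy X A Y y0 = {(f, g). homotopic_with (\<lambda>h. h ` A \<subseteq> {y0}) X Y f g}"

lemma equiv_pair_htpy: "equiv (pair_maps X A Y y0) (pair_htpy X A Y y0)"
proof (rule equivI)
  show "pair_htpy X A Y y0 \<subseteq> pair_maps X A Y y0 \<times> pair_maps X A Y y0"
  proof
    fix w assume "w \<in> pair_htpy X A Y y0"
    then obtain f g where w: "w = (f, g)" and h: "homotopic_with (\<lambda>h. h ` A \<subseteq> {y0}) X Y f g"
      unfolding pair_htpy_def by blast
    show "w \<in> pair_maps X A Y y0 \<times> pair_maps X A Y y0"
      unfolding w pair_maps_def
      using homotopic_with_imp_continuous_maps [OF h] homotopic_with_imp_property [OF h] by blast
  qed
  show "refl_on (pair_maps X A Y y0) (pair_htpy X A Y y0)"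
    unfolding refl_on_def pair_htpy_def pair_maps_def by simp
  show "sym (pair_htpy X A Y y0)"
    unfolding sym_def pair_htpy_def using homotopic_with_symD by blast
  show "trans (pair_htpy X A Y y0)"
    unfolding trans_def pair_htpy_def using homotopic_with_trans by blast
qed

definition based_self_maps :: "'a topology \<Rightarrow> 'a \<Rightarrow> ('a \<Rightarrow> 'a) set" where
  "based_self_maps X x0 = pair_maps X {x0} X x0"

definition based_self_htpy :: "'a topology \<Rightarrow> 'a \<Rightarrow> (('a \<Rightarrow> 'a) \<times> ('a \<Rightarrow> 'a)) set" where
  "based_self_htpy X x0 = pair_htpy X {x0} X x0"

definition self_map_classes :: "'a topology \<Rightarrow> 'a \<Rightarrow> ('a \<Rightarrow> 'a) set set" where
  "self_map_classes X x0 = based_self_maps X x0 // based_self_htpy X x0"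

definition based_self_equivalence :: "'a topology \<Rightarrow> 'a \<Rightarrow> ('a \<Rightarrow> 'a) \<Rightarrow> bool" where
  "based_self_equivalence X x0 f \<longleftrightarrow>
     f \<in> based_self_maps X x0 \<and>
     (\<exists>g \<in> based_self_maps X x0.
        (g \<circ> f, id) \<in> based_self_htpy X x0 \<and> (f \<circ> g, id) \<in> based_self_htpy X x0)"

definition self_equivalence_classes :: "'a topology \<Rightarrow> 'a \<Rightarrow> ('a \<Rightarrow> 'a) set set" where
  "self_equivalence_classes X x0 =
     {F \<in> self_map_classes X x0. \<exists>f\<in>F. based_self_equivalence X x0 f}"


section \<open>Homotopy groups\<close>

text \<open>
  The cube \<open>[0,1]\<^sup>i\<close>, again realised by sequences vanishing from index \<open>i\<close> on.
  For \<open>i = 0\<close> it is a single point with empty boundary.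
\<close>

definition unit_cube :: "nat \<Rightarrow> (nat \<Rightarrow> real) set" where
  "unit_cube i = {t. (\<forall>j<i. 0 \<le> t j \<and> t j \<le> 1) \<and> (\<forall>j\<ge>i. t j = 0)}"

definition cube_boundary :: "nat \<Rightarrow> (nat \<Rightarrow> real) set" where
  "cube_boundary i = {t \<in> unit_cube i. \<exists>j<i. t j = 0 \<or> t j = 1}"

definition cube_maps :: "nat \<Rightarrow> 'a topology \<Rightarrow> 'a \<Rightarrow> ((nat \<Rightarrow> real) \<Rightarrow> 'a) set" where
  "cube_maps i X x0 = pair_maps (top_of_set (unit_cube i)) (cube_boundary i) X x0"

definition cube_htpy ::
    "nat \<Rightarrow> 'a topology \<Rightarrow> 'a \<Rightarrow> (((nat \<Rightarrow> real) \<Rightarrow> 'a) \<times> ((nat \<Rightarrow> real) \<Rightarrow> 'a)) set" where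
  "cube_htpy i X x0 = pair_htpy (top_of_set (unit_cube i)) (cube_boundary i) X x0"

definition cube_concat ::
    "((nat \<Rightarrow> real) \<Rightarrow> 'a) \<Rightarrow> ((nat \<Rightarrow> real) \<Rightarrow> 'a) \<Rightarrow> (nat \<Rightarrow> real) \<Rightarrow> 'a" where
  "cube_concat f g t =
     (if t 0 \<le> 1/2 then f (t(0 := 2 * t 0)) else g (t(0 := 2 * t 0 - 1)))"

text \<open>
  The multiplication is meaningful only for \<open>i \<ge> 1\<close>; for \<open>i = 0\<close> only the carrier, the set of
  path components, is used.
\<close>

definition homotopy_group ::
    "nat \<Rightarrow> 'a topology \<Rightarrow> 'a \<Rightarrow> (((nat \<Rightarrow> real) \<Rightarrow> 'a) set) monoid" where
  "homotopy_group i X x0 =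
     \<lparr>carrier = cube_maps i X x0 // cube_htpy i X x0,
      mult = (\<lambda>A B. cube_htpy i X x0 `` {cube_concat f g | f g. f \<in> A \<and> g \<in> B}),
      one = cube_htpy i X x0 `` {\<lambda>_. x0}\<rparr>"

definition induced_map ::
    "nat \<Rightarrow> 'a topology \<Rightarrow> 'a \<Rightarrow> ('a \<Rightarrow> 'a) set \<Rightarrow> ((nat \<Rightarrow> real) \<Rightarrow> 'a) set \<Rightarrow> ((nat \<Rightarrow> real) \<Rightarrow> 'a) set" where
  "induced_map i X x0 F A = cube_htpy i X x0 `` {f \<circ> g | f g. f \<in> F \<and> g \<in> A}"

definition induces_iso :: "nat \<Rightarrow> 'a topology \<Rightarrow> 'a \<Rightarrow> ('a \<Rightarrow> 'a) set \<Rightarrow> bool" where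
  "induces_iso i X x0 F \<longleftrightarrow>
     (if i = 0
      then bij_betw (induced_map 0 X x0 F) (carrier (homotopy_group 0 X x0)) (carrier (homotopy_group 0 X x0))
      else induced_map i X x0 F \<in> iso (homotopy_group i X x0) (homotopy_group i X x0))"


section \<open>The self-closeness number\<close>

definition A_sharp :: "enat \<Rightarrow> 'a topology \<Rightarrow> 'a \<Rightarrow> ('a \<Rightarrow> 'a) set set" where
  "A_sharp k X x0 =
     {F \<in> self_map_classes X x0. \<forall>i::nat. enat i \<le> k \<longrightarrow> induces_iso i X x0 F}"

definition self_closeness_number :: "'a topology \<Rightarrow> 'a \<Rightarrow> enat" where
  "self_closeness_number X x0 = (LEAST k. A_sharp k X x0 = self_equivalence_classes X x0)"

end

theory Submission
  imports Defs "HOL-Homology.Homology"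
begin

text \<open>
  Self-maps of the lens space lift to self-maps of the sphere \<open>S\<close> that are equivariant up to an
  exponent \<open>r\<close>. By general position (a Lipschitz map from a space of dimension at most \<open>2n+1\<close>
  misses arbitrarily small vectors of \<open>\<complex>\<^sup>n\<^sup>+\<^sup>1\<close>) an equivariant map with values in \<open>S\<close> extends over every
  free space of that dimension.

  If a self-map is onto on \<open>\<pi>\<^sub>1\<close>, then \<open>r\<close> is invertible modulo \<open>m\<close>, so there is an equivariant map
  with the inverse exponent, and the composite can be deformed to the identity outside the
  fundamental cell of the action; the remaining difference is an element of \<open>\<pi>\<^bsub>2n+1\<^esub>\<close>, which is
  cancelled when the map is onto there. So a map inducing isomorphisms up to degree \<open>2n+1\<close> has a
  right inverse, which has the same property.

  Conversely, wrapping each ball of one orbit of \<open>m\<close> small balls once around \<open>S\<close> gives an equivariant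
  map of degree \<open>1 + m\<close>. By general position the map of the lens space that it covers acts
  identically on \<open>\<pi>\<^sub>i\<close> for \<open>i \<le> 2n\<close>, but it is not an equivalence since \<open>1 + m\<close> is not a unit.
\<close>

section \<open>General position for maps into spheres\<close>

text \<open>The proof works without cell complexes, degrees or obstruction classes. Dimension enters
  only through covering numbers: \<open>low_dim d\<close> asks for at most C M^d sets of diameter at
  most 1/M. Such a bound survives Lipschitz maps, grows by one under a product with an interval, and
  is exactly what a pigeonhole count needs. The obstacle is that the sphere times an interval has
  dimension 2n+2, one too many for the extension theorem, while the skeleton times an interval still
  has dimension 2n+1. All that cannot be extended freely is therefore pushed into the inner half of
  one cell, where it can be compared with a map of a cube. The constant 1 + m: one orbit of m bumps
  changes the degree by m up to sign, and 1 - m would be -1 for m = 2, which is a unit. In place of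
  a degree, the induced map on the top homology group of the sphere is used, where each inserted
  bump contributes one further factor.\<close>

definition low_dim :: "nat \<Rightarrow> 'a::metric_space set \<Rightarrow> bool" where
  "low_dim d K \<longleftrightarrow> (\<exists>C::nat. \<forall>M::nat\<ge>1. \<exists>\<U>. finite \<U> \<and> card \<U> \<le> C * M ^ d \<and> K \<subseteq> \<Union>\<U> \<and>
     (\<forall>U\<in>\<U>. \<forall>x\<in>U. \<forall>y\<in>U. dist x y \<le> 1 / real M))"

section \<open>Stability of the covering-number bound\<close>

lemma low_dim_subset: "low_dim d K \<Longrightarrow> K' \<subseteq> K \<Longrightarrow> low_dim d K'"
  unfolding low_dim_def by (meson order_trans)

lemma low_dim_mono:
  assumes "low_dim d K" "d \<le> e"
  shows "low_dim e K"
proof -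
  from assms(1) obtain C :: nat where C: "\<And>M::nat. M \<ge> 1 \<Longrightarrow> \<exists>\<U>. finite \<U> \<and> card \<U> \<le> C * M ^ d \<and> K \<subseteq> \<Union>\<U> \<and>
     (\<forall>U\<in>\<U>. \<forall>x\<in>U. \<forall>y\<in>U. dist x y \<le> 1 / real M)" unfolding low_dim_def by blast
  have "C * M ^ d \<le> C * M ^ e" if "M \<ge> 1" for M
    using that assms(2) by (simp add: power_increasing)
  then show ?thesis unfolding low_dim_def using C by (metis order_trans)
qed

lemma low_dim_Un:
  assumes "low_dim d K" "low_dim d K'"
  shows "low_dim d (K \<union> K')"
proof -
  from assms(1) obtain C :: nat where C: "\<And>M::nat. M \<ge> 1 \<Longrightarrow> \<exists>\<U>. finite \<U> \<and> card \<U> \<le> C * M ^ d \<and> K \<subseteq> \<Union>\<U> \<and>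
     (\<forall>U\<in>\<U>. \<forall>x\<in>U. \<forall>y\<in>U. dist x y \<le> 1 / real M)" unfolding low_dim_def by blast
  from assms(2) obtain C' :: nat where C': "\<And>M::nat. M \<ge> 1 \<Longrightarrow> \<exists>\<U>. finite \<U> \<and> card \<U> \<le> C' * M ^ d \<and> K' \<subseteq> \<Union>\<U> \<and>
     (\<forall>U\<in>\<U>. \<forall>x\<in>U. \<forall>y\<in>U. dist x y \<le> 1 / real M)" unfolding low_dim_def by blast
  show ?thesis unfolding low_dim_def
  proof (intro exI[of _ "C + C'"] allI impI)
    fix M :: nat assume M: "1 \<le> M"
    obtain U where U: "finite U \<and> card U \<le> C * M ^ d \<and> K \<subseteq> \<Union>U \<and>
     (\<forall>U\<in>U. \<forall>x\<in>U. \<forall>y\<in>U. dist x y \<le> 1 / real M)" using C[OF M] by blast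
    obtain U' where U': "finite U' \<and> card U' \<le> C' * M ^ d \<and> K' \<subseteq> \<Union>U' \<and>
     (\<forall>U\<in>U'. \<forall>x\<in>U. \<forall>y\<in>U. dist x y \<le> 1 / real M)" using C'[OF M] by blast
    have "card (U \<union> U') \<le> (C + C') * M ^ d"
      using card_Un_le[of U U'] U U' by (simp add: add_mult_distrib)
    with U U' show "\<exists>\<U>. finite \<U> \<and> card \<U> \<le> (C + C') * M ^ d \<and> K \<union> K' \<subseteq> \<Union>\<U> \<and>
     (\<forall>U\<in>\<U>. \<forall>x\<in>U. \<forall>y\<in>U. dist x y \<le> 1 / real M)"
      by (intro exI[of _ "U \<union> U'"]) auto
  qed
qed

lemma low_dim_singleton: "low_dim d {a}"
  unfolding low_dim_def
  by (intro exI[of _ 1] allI impI exI[of _ "{{a}}"]) auto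

lemma low_dim_empty: "low_dim d {}"
  using low_dim_subset[OF low_dim_singleton] by blast

lemma low_dim_UN:
  assumes "finite I" "\<And>i. i \<in> I \<Longrightarrow> low_dim d (K i)"
  shows "low_dim d (\<Union>i\<in>I. K i)"
  using assms by (induction I rule: finite_induct) (auto simp: low_dim_empty intro: low_dim_Un)

text \<open>A cover at scale 1/((L+1)M) is carried to scale 1/M, at the price of the factor (L+1)^d
  in the constant. Using \<open>Suc L\<close> keeps the finer scale meaningful for L = 0.\<close>

lemma low_dim_lipschitz_image:
  assumes "low_dim d K" and lip: "\<And>x y. x \<in> K \<Longrightarrow> y \<in> K \<Longrightarrow> dist (f x) (f y) \<le> real L * dist x y"
  shows "low_dim d (f ` K)"
proof -
  from assms(1) obtain C :: nat where C: "\<And>M::nat. M \<ge> 1 \<Longrightarrow> \<exists>\<U>. finite \<U> \<and> card \<U> \<le> C * M ^ d \<and> K \<subseteq> \<Union>\<U> \<and>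
     (\<forall>U\<in>\<U>. \<forall>x\<in>U. \<forall>y\<in>U. dist x y \<le> 1 / real M)" unfolding low_dim_def by blast
  show ?thesis unfolding low_dim_def
  proof (intro exI[of _ "C * Suc L ^ d"] allI impI)
    fix M :: nat assume M: "1 \<le> M"
    then have M': "1 \<le> Suc L * M" by simp
    obtain U where U: "finite U" "card U \<le> C * (Suc L * M) ^ d" "K \<subseteq> \<Union>U"
     "\<And>V x y. V \<in> U \<Longrightarrow> x\<in>V \<Longrightarrow> y\<in>V \<Longrightarrow> dist x y \<le> 1 / real (Suc L * M)" using C[OF M'] by blast
    show "\<exists>\<U>. finite \<U> \<and> card \<U> \<le> (C * Suc L ^ d) * M ^ d \<and> f ` K \<subseteq> \<Union>\<U> \<and>
     (\<forall>U\<in>\<U>. \<forall>x\<in>U. \<forall>y\<in>U. dist x y \<le> 1 / real M)"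
    proof (intro exI[of _ "(\<lambda>V. f ` (V \<inter> K)) ` U"] conjI ballI)
      show "card ((\<lambda>V. f ` (V \<inter> K)) ` U) \<le> (C * Suc L ^ d) * M ^ d"
        using card_image_le[OF U(1), of "\<lambda>V. f ` (V \<inter> K)"] U(2)
        by (simp only: power_mult_distrib mult.assoc)
    next
      fix W x y assume "W \<in> (\<lambda>V. f ` (V \<inter> K)) ` U" "x \<in> W" "y \<in> W"
      then obtain V a b where *: "V \<in> U" "a \<in> V" "a \<in> K" "b \<in> V" "b \<in> K" "x = f a" "y = f b" by auto
      have "dist x y \<le> real L * dist a b" using * lip by simp
      also have "\<dots> \<le> real (Suc L) * (1 / real (Suc L * M))"
        using U(4)[OF *(1,2,4)] by (intro mult_mono) auto
      also have "\<dots> = 1 / real M" unfolding of_nat_mult using M by (simp del: of_nat_Suc)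
      finally show "dist x y \<le> 1 / real M" .
    next
      show "f ` K \<subseteq> \<Union> ((\<lambda>V. f ` (V \<inter> K)) ` U)" using U(3) by blast
    qed (use U(1) in simp)
  qed
qed

text \<open>Both factors are covered at scale 1/(2M), since the product distance is at most the sum
  of the two component distances. The 2M intervals account for the extra power of M.\<close>

lemma low_dim_Times_interval:
  assumes "low_dim d K"
  shows "low_dim (Suc d) (K \<times> {0..1::real})"
proof -
  from assms(1) obtain C :: nat where C: "\<And>M::nat. M \<ge> 1 \<Longrightarrow> \<exists>\<U>. finite \<U> \<and> card \<U> \<le> C * M ^ d \<and> K \<subseteq> \<Union>\<U> \<and>
     (\<forall>U\<in>\<U>. \<forall>x\<in>U. \<forall>y\<in>U. dist x y \<le> 1 / real M)" unfolding low_dim_def by blast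
  show ?thesis unfolding low_dim_def
  proof (intro exI[of _ "C * 2 ^ Suc d"] allI impI)
    fix M :: nat assume M: "1 \<le> M"
    then have M': "1 \<le> 2 * M" by simp
    obtain U where U: "finite U" "card U \<le> C * (2 * M) ^ d" "K \<subseteq> \<Union>U"
     "\<And>V x y. V \<in> U \<Longrightarrow> x\<in>V \<Longrightarrow> y\<in>V \<Longrightarrow> dist x y \<le> 1 / real (2 * M)" using C[OF M'] by blast
    define J where "J = (\<lambda>i::nat. {real i / real (2*M) .. real (Suc i) / real (2*M)})"
    \<comment> \<open>The end point t = 1 is separate, since the floor of 2M t would be 2M, one
      beyond the last interval.\<close>
    have cov: "\<exists>i<2*M. t \<in> J i" if "t \<in> {0..1}" for t
    proof (cases "t = 1")
      case True
      have "t \<in> J (2*M - 1)" using M True by (auto simp: J_def field_simps of_nat_diff)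
      then show ?thesis using M by (intro exI[of _ "2*M-1"]) auto
    next
      case False
      define i where "i = nat \<lfloor>t * real (2*M)\<rfloor>"
      have i: "real i \<le> t * real (2*M)" "t * real (2*M) < real i + 1"
        using that unfolding i_def by (auto simp: of_nat_nat)
      have "t * real (2*M) < 1 * real (2*M)" using False that M by (intro mult_strict_right_mono) auto
      then have "real i < real (2*M)" using i by linarith
      then have "i < 2*M" by linarith
      moreover have "t \<in> J i" using i M by (auto simp: J_def field_simps)
      ultimately show ?thesis by blast
    qed
    have Jd: "dist s t \<le> 1 / real (2*M)" if "s \<in> J i" "t \<in> J i" for s t i
    proof -
      have "real (Suc i) / real (2*M) - real i / real (2*M) = 1 / real (2*M)"
        using M by (simp add: field_simps)
      then show ?thesis using that unfolding J_def dist_real_def by auto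
    qed
    show "\<exists>\<U>. finite \<U> \<and> card \<U> \<le> (C * 2 ^ Suc d) * M ^ Suc d \<and> K \<times> {0..1::real} \<subseteq> \<Union>\<U> \<and>
     (\<forall>U\<in>\<U>. \<forall>x\<in>U. \<forall>y\<in>U. dist x y \<le> 1 / real M)"
    proof (intro exI[of _ "(\<lambda>(V,i). V \<times> J i) ` (U \<times> {..<2*M})"] conjI ballI)
      show "finite ((\<lambda>(V,i). V \<times> J i) ` (U \<times> {..<2*M}))" using U(1) by simp
    next
      have "card ((\<lambda>(V,i). V \<times> J i) ` (U \<times> {..<2*M})) \<le> card (U \<times> {..<2*M})"
        using U(1) by (intro card_image_le) auto
      also have "\<dots> \<le> C * (2 * M) ^ d * (2*M)" using U(2) by (simp add: card_cartesian_product)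
      also have "\<dots> = (C * 2 ^ Suc d) * M ^ Suc d" by (simp add: power_mult_distrib)
      finally show "card ((\<lambda>(V,i). V \<times> J i) ` (U \<times> {..<2*M})) \<le> (C * 2 ^ Suc d) * M ^ Suc d" .
    next
      show "K \<times> {0..1} \<subseteq> \<Union> ((\<lambda>(V,i). V \<times> J i) ` (U \<times> {..<2*M}))"
      proof
        fix p assume "p \<in> K \<times> {0..1::real}"
        then obtain x t where p: "p = (x,t)" "x \<in> K" "t \<in> {0..1}" by auto
        obtain V where "V \<in> U" "x \<in> V" using U(3) p by blast
        moreover obtain i where "i < 2*M" "t \<in> J i" using cov p by blast
        ultimately show "p \<in> \<Union> ((\<lambda>(V,i). V \<times> J i) ` (U \<times> {..<2*M}))" using p by force
      qed
    next
      fix W p q assume "W \<in> (\<lambda>(V,i). V \<times> J i) ` (U \<times> {..<2*M})" "p \<in> W" "q \<in> W"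
      then obtain V i where *: "V \<in> U" "fst p \<in> V" "fst q \<in> V" "snd p \<in> J i" "snd q \<in> J i"
        by auto
      have "dist p q \<le> dist (fst p) (fst q) + dist (snd p) (snd q)"
        unfolding dist_prod_def by (rule sqrt_sum_squares_le_sum) auto
      also have "\<dots> \<le> 1 / real (2*M) + 1 / real (2*M)"
        using U(4)[OF *(1,2,3)] Jd[OF *(4,5)] by (rule add_mono)
      also have "\<dots> = 1 / real M" using M by (simp add: field_simps)
      finally show "dist p q \<le> 1 / real M" .
    qed
  qed
qed

text \<open>A Lipschitz image of a space of box dimension at most \<open>2n+1\<close> contains at most \<open>C M\<^sup>2\<^sup>n\<^sup>+\<^sup>1\<close>
  points of a grid of mesh about \<open>1/M\<close> in \<open>\<complex>\<^sup>n\<^sup>+\<^sup>1\<close>, but each ball contains about \<open>M\<^sup>2\<^sup>n\<^sup>+\<^sup>2\<close> of them.\<close>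

lemma lipschitz_image_misses_small_vector:
  fixes F :: "'a::metric_space \<Rightarrow> nat \<Rightarrow> complex"
  assumes K: "low_dim d K" and d: "d \<le> 2 * n + 1" and e: "e > 0"
    and lip: "\<And>j x y. j \<le> n \<Longrightarrow> x \<in> K \<Longrightarrow> y \<in> K \<Longrightarrow> cmod (F x j - F y j) \<le> B * dist x y"
  obtains v where "\<And>j. j \<le> n \<Longrightarrow> cmod (v j) \<le> e" "\<And>x. x \<in> K \<Longrightarrow> \<exists>j\<le>n. F x j \<noteq> v j"
proof -
  from low_dim_mono[OF K d] obtain C :: nat where C: "\<And>M::nat. M \<ge> 1 \<Longrightarrow> \<exists>\<U>. finite \<U> \<and> card \<U> \<le> C * M ^ (2*n+1) \<and> K \<subseteq> \<Union>\<U> \<and>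
     (\<forall>U\<in>\<U>. \<forall>x\<in>U. \<forall>y\<in>U. dist x y \<le> 1 / real M)" unfolding low_dim_def by blast
  \<comment> \<open>Half of e for each of the real and imaginary parts, so that the modulus is at
    most e.\<close>
  define e' where "e' = e / 2"
  have e': "e' > 0" using e by (simp add: e'_def)
  obtain a0 :: nat where a0: "real a0 > B / e'" using reals_Archimedean2 by blast
  define a where "a = Suc a0"
  have a: "real a > B / e'" "a \<ge> 1" using a0 by (auto simp: a_def)
  \<comment> \<open>With M = aL the cover has at most C a^(2n+1) L^(2n+1) members, fewer than the
    L^(2n+2) grid points because L exceeds C a^(2n+1). The factor a makes B/M smaller than the mesh
    e'/L.\<close>
  define L where "L = C * a ^ (2*n+1) + 1"
  define M where "M = a * L"
  have M: "M \<ge> 1" using a by (simp add: M_def L_def)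
  have Lpos: "L > 0" by (simp add: L_def)
  obtain U where U: "finite U" "card U \<le> C * M ^ (2*n+1)" "K \<subseteq> \<Union>U"
     "\<And>V x y. V \<in> U \<Longrightarrow> x\<in>V \<Longrightarrow> y\<in>V \<Longrightarrow> dist x y \<le> 1 / real M" using C[OF M] by blast
  define G where "G = PiE {..n} (\<lambda>_. {..<L} \<times> {..<L})"
  define v where "v = (\<lambda>(g::nat \<Rightarrow> nat \<times> nat) j. Complex (e' * real (fst (g j)) / real L) (e' * real (snd (g j)) / real L))"
  have cardG: "card G = L ^ (2*n+2)"
  proof -
    have "card G = (L * L) ^ Suc n" unfolding G_def by (simp add: card_PiE card_cartesian_product)
    also have "\<dots> = L ^ Suc n * L ^ Suc n" by (rule power_mult_distrib)
    also have "\<dots> = L ^ (Suc n + Suc n)" by (rule power_add[symmetric])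
    finally show ?thesis by (simp add: mult_2)
  qed
  have big: "card U < card G"
  proof -
    have "card U \<le> (C * a ^ (2*n+1)) * L ^ (2*n+1)" using U(2) by (simp add: M_def power_mult_distrib mult.assoc mult.left_commute)
    also have "\<dots> < L * L ^ (2*n+1)" using Lpos by (intro mult_strict_right_mono) (auto simp: L_def)
    finally show ?thesis using cardG by simp
  qed
  have "\<exists>g\<in>G. \<forall>x\<in>K. \<exists>j\<le>n. F x j \<noteq> v g j"
  proof (rule ccontr)
    assume "\<not> ?thesis"
    then have "\<forall>g\<in>G. \<exists>x\<in>K. \<forall>j\<le>n. F x j = v g j" by blast
    then obtain X where X: "\<And>g. g \<in> G \<Longrightarrow> X g \<in> K" "\<And>g j. g \<in> G \<Longrightarrow> j \<le> n \<Longrightarrow> F (X g) j = v g j" by metis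
    have "\<forall>g\<in>G. \<exists>V\<in>U. X g \<in> V" using X(1) U(3) by blast
    then obtain W where W: "\<And>g. g \<in> G \<Longrightarrow> W g \<in> U" "\<And>g. g \<in> G \<Longrightarrow> X g \<in> W g" by metis
    \<comment> \<open>Two grid points hit from the same set of the cover differ by less than one
      mesh in every coordinate, hence coincide. So W would inject the grid into the smaller
      cover.\<close>
    have "inj_on W G"
    proof (rule inj_onI)
      fix g h assume gh: "g \<in> G" "h \<in> G" "W g = W h"
      have dd: "dist (X g) (X h) \<le> 1 / real M" using U(4) W gh by metis
      have eq: "g j = h j" if j: "j \<le> n" for j
      proof -
        have "cmod (v g j - v h j) \<le> B * dist (X g) (X h)"
          using lip[OF j X(1)[OF gh(1)] X(1)[OF gh(2)]] X(2)[OF gh(1) j] X(2)[OF gh(2) j] by simp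
        also have "\<dots> < e' / real L"
        proof (cases "B \<le> 0")
          case True
          then have "B * dist (X g) (X h) \<le> 0" by (simp add: mult_nonpos_nonneg)
          also have "0 < e' / real L" using e' Lpos by simp
          finally show ?thesis .
        next
          case False
          then have "B * dist (X g) (X h) \<le> B * (1 / real M)" using dd by (intro mult_left_mono) auto
          also have "\<dots> < (e' * real a) * (1 / real M)"
            using a(1) e' M by (intro mult_strict_right_mono) (auto simp: field_simps)
          also have "\<dots> = e' / real L" using a(2) by (simp add: M_def)
          finally show ?thesis .
        qed
        finally have lt: "cmod (v g j - v h j) < e' / real L" .
        have re: "\<bar>e' * real (fst (g j)) / real L - e' * real (fst (h j)) / real L\<bar> < e' / real L"
          using abs_Re_le_cmod[of "v g j - v h j"] lt by (simp add: v_def)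
        have im: "\<bar>e' * real (snd (g j)) / real L - e' * real (snd (h j)) / real L\<bar> < e' / real L"
          using abs_Im_le_cmod[of "v g j - v h j"] lt by (simp add: v_def)
        have nn: "p = q" if "\<bar>e' * real p / real L - e' * real q / real L\<bar> < e' / real L" for p q :: nat
        proof -
          have "\<bar>e' * real p / real L - e' * real q / real L\<bar> = (e' / real L) * \<bar>real p - real q\<bar>"
          proof -
            have "e' * real p / real L - e' * real q / real L = (e' / real L) * (real p - real q)"
              by (simp add: right_diff_distrib)
            then show ?thesis using e' Lpos by (simp add: abs_mult)
          qed
          with that have "(e' / real L) * \<bar>real p - real q\<bar> < (e' / real L) * 1" by simp
          then have "\<bar>real p - real q\<bar> < 1" using e' Lpos by (subst (asm) mult_less_cancel_left_pos) auto
          then show ?thesis by linarith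
        qed
        show ?thesis using nn[OF re] nn[OF im] by (simp add: prod_eq_iff)
      qed
      show "g = h"
        using gh(1,2) eq unfolding G_def by (intro PiE_ext[of g "{..n}" _ h]) auto
    qed
    then have "card G \<le> card U" using W(1) U(1) by (intro card_inj_on_le) auto
    with big show False by simp
  qed
  then obtain g where g: "g \<in> G" "\<And>x. x \<in> K \<Longrightarrow> \<exists>j\<le>n. F x j \<noteq> v g j" by blast
  have "cmod (v g j) \<le> e" if "j \<le> n" for j
  proof -
    have "g j \<in> {..<L} \<times> {..<L}" using g(1) that by (auto simp: G_def)
    then have b: "fst (g j) \<le> L" "snd (g j) \<le> L" by (auto simp: mem_Times_iff)
    have *: "\<bar>e' * real p / real L\<bar> \<le> e'" if "p \<le> L" for p
      using that e' Lpos by (simp add: field_simps)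
    show ?thesis using cmod_le[of "v g j"] *[OF b(1)] *[OF b(2)] by (simp add: v_def e'_def)
  qed
  with g(2) show thesis using that by blast
qed

text \<open>Stone-Weierstrass: on a compact set the Lipschitz functions form an algebra, products
  being Lipschitz because both factors are bounded, and distance functions separate points.\<close>

lemma lipschitz_approximation:
  fixes h :: "'a::metric_space \<Rightarrow> real"
  assumes K: "compact K" and h: "continuous_on K h" and e: "e > 0"
  obtains g B where "continuous_on K g" "\<And>x y. x \<in> K \<Longrightarrow> y \<in> K \<Longrightarrow> \<bar>g x - g y\<bar> \<le> B * dist x y"
    "\<And>x. x \<in> K \<Longrightarrow> \<bar>h x - g x\<bar> < e"
proof -
  define R where "R = {g::'a \<Rightarrow> real. continuous_on K g \<and> (\<exists>B. \<forall>x\<in>K. \<forall>y\<in>K. \<bar>g x - g y\<bar> \<le> B * dist x y)}"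
  interpret function_ring_on R K
  proof
    show "compact K" by fact
    show "continuous_on K f" if "f \<in> R" for f using that by (simp add: R_def)
    show "(\<lambda>_. c) \<in> R" for c unfolding R_def by (auto intro!: exI[of _ 0])
    show "\<exists>f\<in>R. f x \<noteq> f y" if "x \<in> K" "y \<in> K" "x \<noteq> y" for x y
    proof (rule bexI[of _ "\<lambda>z. dist z x"])
      show "dist x x \<noteq> dist y x" using that by auto
      have "\<bar>dist a x - dist b x\<bar> \<le> 1 * dist a b" for a b
        using dist_triangle[of a x b] dist_triangle[of b x a] by (simp add: dist_commute)
      then show "(\<lambda>z. dist z x) \<in> R" unfolding R_def by (auto intro!: continuous_intros exI[of _ 1])
    qed
    fix f g assume f: "f \<in> R" and g: "g \<in> R"
    then obtain Bf Bg where Bf: "\<forall>x\<in>K. \<forall>y\<in>K. \<bar>f x - f y\<bar> \<le> Bf * dist x y"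
      and Bg: "\<forall>x\<in>K. \<forall>y\<in>K. \<bar>g x - g y\<bar> \<le> Bg * dist x y" unfolding R_def by auto
    have cf: "continuous_on K f" and cg: "continuous_on K g" using f g by (auto simp: R_def)
    have "\<bar>f x + g x - (f y + g y)\<bar> \<le> (Bf + Bg) * dist x y" if "x \<in> K" "y \<in> K" for x y
      using Bf Bg that abs_triangle_ineq[of "f x - f y" "g x - g y"]
      by (smt (verit) distrib_right)
    then show "(\<lambda>x. f x + g x) \<in> R" unfolding R_def using cf cg by (auto intro!: continuous_intros)
    obtain Cf where Cf: "\<And>x. x \<in> K \<Longrightarrow> \<bar>f x\<bar> \<le> Cf"
      using compact_imp_bounded[OF compact_continuous_image[OF cf K]] unfolding bounded_iff by auto
    obtain Cg where Cg: "\<And>x. x \<in> K \<Longrightarrow> \<bar>g x\<bar> \<le> Cg"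
      using compact_imp_bounded[OF compact_continuous_image[OF cg K]] unfolding bounded_iff by auto
    have "\<bar>f x * g x - f y * g y\<bar> \<le> (\<bar>Cf\<bar> * \<bar>Bg\<bar> + \<bar>Cg\<bar> * \<bar>Bf\<bar>) * dist x y" if "x \<in> K" "y \<in> K" for x y
    proof -
      have "f x * g x - f y * g y = f x * (g x - g y) + g y * (f x - f y)" by (simp add: algebra_simps)
      then have "\<bar>f x * g x - f y * g y\<bar> \<le> \<bar>f x\<bar> * \<bar>g x - g y\<bar> + \<bar>g y\<bar> * \<bar>f x - f y\<bar>"
        by (metis abs_mult abs_triangle_ineq)
      also have "\<dots> \<le> \<bar>Cf\<bar> * (\<bar>Bg\<bar> * dist x y) + \<bar>Cg\<bar> * (\<bar>Bf\<bar> * dist x y)"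
      proof (intro add_mono mult_mono)
        show "\<bar>f x\<bar> \<le> \<bar>Cf\<bar>" "\<bar>g y\<bar> \<le> \<bar>Cg\<bar>" using Cf Cg that by fastforce+
        show "\<bar>g x - g y\<bar> \<le> \<bar>Bg\<bar> * dist x y" using Bg that
          by (meson abs_ge_self mult_right_mono order_trans zero_le_dist)
        show "\<bar>f x - f y\<bar> \<le> \<bar>Bf\<bar> * dist x y" using Bf that
          by (meson abs_ge_self mult_right_mono order_trans zero_le_dist)
      qed auto
      finally show ?thesis by (simp add: algebra_simps)
    qed
    then show "(\<lambda>x. f x * g x) \<in> R" unfolding R_def using cf cg by (auto intro!: continuous_intros)
  qed
  obtain g where "g \<in> R" "\<forall>x\<in>K. \<bar>h x - g x\<bar> < e"
    using Stone_Weierstrass_basic[OF h e] by blast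
  then show thesis using that unfolding R_def by blast
qed

subsection \<open>Extension of maps into spheres\<close>

definition cnorm :: "nat \<Rightarrow> (nat \<Rightarrow> complex) \<Rightarrow> real" where
  "cnorm n z = sqrt (\<Sum>j\<le>n. (cmod (z j))\<^sup>2)"

definition normalise :: "nat \<Rightarrow> (nat \<Rightarrow> complex) \<Rightarrow> nat \<Rightarrow> complex" where
  "normalise n z = (\<lambda>j. if j \<le> n then z j / of_real (cnorm n z) else 0)"

lemma cnorm_pos_iff: "cnorm n z > 0 \<longleftrightarrow> (\<exists>j\<le>n. z j \<noteq> 0)"
proof -
  have "(\<Sum>j\<le>n. (cmod (z j))\<^sup>2) \<noteq> 0 \<longleftrightarrow> (\<exists>j\<le>n. z j \<noteq> 0)"
    by (subst sum_nonneg_eq_0_iff) auto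
  moreover have "(\<Sum>j\<le>n. (cmod (z j))\<^sup>2) \<ge> 0" by (simp add: sum_nonneg)
  ultimately show ?thesis unfolding cnorm_def by auto
qed

lemma cnorm_ge_0 [simp]: "cnorm n z \<ge> 0"
  unfolding cnorm_def by (simp add: sum_nonneg)

lemma cnorm_sphere: "z \<in> complex_sphere n \<Longrightarrow> cnorm n z = 1"
  by (simp add: cnorm_def complex_sphere_def)

lemma normalise_in_sphere:
  assumes "\<exists>j\<le>n. z j \<noteq> 0"
  shows "normalise n z \<in> complex_sphere n"
proof -
  have p: "cnorm n z > 0" using assms cnorm_pos_iff by blast
  have sq: "(\<Sum>j\<le>n. (cmod (z j))\<^sup>2) = (cnorm n z)\<^sup>2" by (simp add: cnorm_def sum_nonneg)
  have "(\<Sum>j\<le>n. (cmod (normalise n z j))\<^sup>2) = (\<Sum>j\<le>n. (cmod (z j))\<^sup>2 / (cnorm n z)\<^sup>2)"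
    by (intro sum.cong) (auto simp: normalise_def norm_divide power_divide)
  also have "\<dots> = 1" using p sq by (simp flip: sum_divide_distrib)
  finally show ?thesis by (auto simp: complex_sphere_def normalise_def)
qed

lemma normalise_sphere: "z \<in> complex_sphere n \<Longrightarrow> normalise n z = z"
  by (auto simp: normalise_def cnorm_sphere complex_sphere_def)

lemma sphere_nonzero: "z \<in> complex_sphere n \<Longrightarrow> \<exists>j\<le>n. z j \<noteq> 0"
  using cnorm_sphere[of z n] cnorm_pos_iff[of n z] by simp

lemma continuous_on_cnorm:
  assumes "\<And>j. j \<le> n \<Longrightarrow> continuous_on K (\<lambda>x. F x j)"
  shows "continuous_on K (\<lambda>x. cnorm n (F x))"
  unfolding cnorm_def by (intro continuous_intros) (use assms in auto)

lemma continuous_on_normalise: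
  assumes "\<And>j. j \<le> n \<Longrightarrow> continuous_on K (\<lambda>x. F x j)" "\<And>x. x \<in> K \<Longrightarrow> \<exists>j\<le>n. F x j \<noteq> 0"
  shows "continuous_on K (\<lambda>x. normalise n (F x))"
proof (rule continuous_on_coordinatewise_then_product)
  fix j
  have "cnorm n (F x) \<noteq> 0" if "x \<in> K" for x using assms(2)[OF that] cnorm_pos_iff[of n "F x"] by simp
  then show "continuous_on K (\<lambda>x. normalise n (F x) j)"
    unfolding normalise_def using assms(1)
    by (cases "j \<le> n") (auto intro!: continuous_intros continuous_on_cnorm)
qed

lemma continuous_on_coord:
  assumes "continuous_on K f"
  shows "continuous_on K (\<lambda>x. f x j)"
  by (rule continuous_on_product_then_coordinatewise[OF assms])

lemma lipschitz_approximation_complex: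
  fixes h :: "'a::metric_space \<Rightarrow> complex"
  assumes K: "compact K" and h: "continuous_on K h" and e: "e > 0"
  obtains g B where "continuous_on K g" "\<And>x y. x \<in> K \<Longrightarrow> y \<in> K \<Longrightarrow> cmod (g x - g y) \<le> B * dist x y"
    "\<And>x. x \<in> K \<Longrightarrow> cmod (h x - g x) < e"
proof -
  have cr: "continuous_on K (\<lambda>x. Re (h x))" "continuous_on K (\<lambda>x. Im (h x))" using h by (auto intro!: continuous_intros)
  have e2: "e / 2 > 0" using e by simp
  obtain u B where u: "continuous_on K u" "\<And>x y. x \<in> K \<Longrightarrow> y \<in> K \<Longrightarrow> \<bar>u x - u y\<bar> \<le> B * dist x y"
    "\<And>x. x \<in> K \<Longrightarrow> \<bar>Re (h x) - u x\<bar> < e / 2" using lipschitz_approximation[OF K cr(1) e2] by blast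
  obtain v C where v: "continuous_on K v" "\<And>x y. x \<in> K \<Longrightarrow> y \<in> K \<Longrightarrow> \<bar>v x - v y\<bar> \<le> C * dist x y"
    "\<And>x. x \<in> K \<Longrightarrow> \<bar>Im (h x) - v x\<bar> < e / 2" using lipschitz_approximation[OF K cr(2) e2] by blast
  show thesis
  proof
    show "continuous_on K (\<lambda>x. Complex (u x) (v x))" using u(1) v(1) by (simp add: Complex_eq continuous_intros)
    show "cmod (Complex (u x) (v x) - Complex (u y) (v y)) \<le> (B + C) * dist x y" if "x \<in> K" "y \<in> K" for x y
      using cmod_le[of "Complex (u x) (v x) - Complex (u y) (v y)"] u(2)[OF that] v(2)[OF that]
      by (simp add: distrib_right)
    show "cmod (h x - Complex (u x) (v x)) < e" if "x \<in> K" for x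
      using cmod_le[of "h x - Complex (u x) (v x)"] u(3)[OF that] v(3)[OF that] by simp
  qed
qed

text \<open>A Tietze extension F may vanish. Where F is small it is replaced by a Lipschitz
  approximation G, shifted by a small vector v that G misses; where F is large it is kept. In
  between the two are so close together that the blend cannot vanish. As |F| = 1 on A, nothing
  changes there.\<close>

proposition extend_map_into_sphere:
  fixes f :: "'a::{metric_space,second_countable_topology} \<Rightarrow> nat \<Rightarrow> complex"
  assumes K: "compact K" "low_dim d K" "d \<le> 2 * n + 1" and A: "closed A" "A \<subseteq> K"
    and f: "continuous_on A f" "f ` A \<subseteq> complex_sphere n"
  obtains g where "continuous_on K g" "g ` K \<subseteq> complex_sphere n" "\<And>x. x \<in> A \<Longrightarrow> g x = f x"
proof -
  have clo: "closedin (top_of_set K) A" using A by (simp add: closed_subset)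
  have "\<exists>F. continuous_on K F \<and> (\<forall>x\<in>A. F x = f x j)" for j
    using Tietze_unbounded[OF continuous_on_coord[OF f(1)] clo] by metis
  then obtain F where F: "\<And>j. continuous_on K (F j)" "\<And>j x. x \<in> A \<Longrightarrow> F j x = f x j" by metis
  \<comment> \<open>The blend moves each of the n+1 coordinates by at most 2e, hence F by at most
    1/2 in norm, because (n+1) 4e^2 = 1/(4(n+1)) <= 1/4. A zero of the blend therefore has |F| <=
    1/2.\<close>
  define e where "e = 1 / (4 * real (Suc n))"
  have e: "e > 0" by (simp add: e_def)
  have "\<exists>G B. continuous_on K G \<and> (\<forall>x\<in>K. \<forall>y\<in>K. cmod (G x - G y) \<le> B * dist x y) \<and> (\<forall>x\<in>K. cmod (F j x - G x) < e)" for j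
    using lipschitz_approximation_complex[OF K(1) F(1) e] by metis
  then obtain G B where G: "\<And>j. continuous_on K (G j)"
    "\<And>j x y. x \<in> K \<Longrightarrow> y \<in> K \<Longrightarrow> cmod (G j x - G j y) \<le> B j * dist x y" "\<And>j x. x \<in> K \<Longrightarrow> cmod (F j x - G j x) < e" by metis
  have B': "cmod (G j x - G j y) \<le> (\<Sum>j\<le>n. \<bar>B j\<bar>) * dist x y" if "j \<le> n" "x \<in> K" "y \<in> K" for j x y
  proof -
    have "B j \<le> (\<Sum>j\<le>n. \<bar>B j\<bar>)" using that member_le_sum[of j "{..n}" "\<lambda>j. \<bar>B j\<bar>"] by auto
    then show ?thesis using G(2)[OF that(2,3), of j] by (meson mult_right_mono order_trans zero_le_dist)
  qed
  obtain v where v: "\<And>j. j \<le> n \<Longrightarrow> cmod (v j) \<le> e" "\<And>x. x \<in> K \<Longrightarrow> \<exists>j\<le>n. G j x \<noteq> v j"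
    using lipschitz_image_misses_small_vector[OF K(2,3) e, of "\<lambda>x j. G j x"] B' by metis
  define \<nu> where "\<nu> = (\<lambda>x. cnorm n (\<lambda>j. F j x))"
  \<comment> \<open>Equal to 1 for |F| <= 1/2 and to 0 for |F| >= 3/4.\<close>
  define \<phi> where "\<phi> = (\<lambda>x. max 0 (min 1 (3 - 4 * \<nu> x)))"
  define P where "P = (\<lambda>x j. F j x + of_real (\<phi> x) * (G j x - v j - F j x))"
  have cnu: "continuous_on K \<nu>" unfolding \<nu>_def by (intro continuous_on_cnorm F(1))
  have cphi: "continuous_on K \<phi>" unfolding \<phi>_def by (intro continuous_intros cnu)
  have cP: "continuous_on K (\<lambda>x. P x j)" for j
    unfolding P_def by (intro continuous_intros F(1) G(1) cphi)
  have nz: "\<exists>j\<le>n. P x j \<noteq> 0" if x: "x \<in> K" for x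
  proof (cases "\<nu> x \<le> 1/2")
    case True
    then have "\<phi> x = 1" by (simp add: \<phi>_def)
    then have "P x j = G j x - v j" for j by (simp add: P_def)
    then show ?thesis using v(2)[OF x] by auto
  next
    case False
    show ?thesis
    proof (rule ccontr)
      assume "\<not> ?thesis"
      then have z: "P x j = 0" if "j \<le> n" for j using that by blast
      have b: "(cmod (F j x))\<^sup>2 \<le> (2 * e)\<^sup>2" if "j \<le> n" for j
      proof (rule power_mono)
        have phi: "0 \<le> \<phi> x" "\<phi> x \<le> 1" by (auto simp: \<phi>_def)
        have "F j x = - (of_real (\<phi> x) * (G j x - v j - F j x))" using z[OF that] by (simp add: P_def eq_neg_iff_add_eq_0)
        then have "cmod (F j x) = \<phi> x * cmod (G j x - v j - F j x)"
          by (metis norm_minus_cancel norm_mult norm_of_real abs_of_nonneg phi(1))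
        also have "\<dots> \<le> 1 * cmod (G j x - v j - F j x)" using phi by (intro mult_right_mono) auto
        also have "\<dots> \<le> cmod (F j x - G j x) + cmod (v j)"
          using norm_triangle_ineq4[of "G j x - F j x" "v j"] by (simp add: norm_minus_commute algebra_simps)
        also have "\<dots> \<le> 2 * e" using G(3)[OF x, of j] v(1)[OF that] by simp
        finally show "cmod (F j x) \<le> 2 * e" .
      qed auto
      have "(\<nu> x)\<^sup>2 = (\<Sum>j\<le>n. (cmod (F j x))\<^sup>2)" by (simp add: \<nu>_def cnorm_def sum_nonneg)
      also have "\<dots> \<le> (\<Sum>j\<le>n. (2*e)\<^sup>2)" using b by (intro sum_mono) auto
      also have "\<dots> = real (Suc n) * (4 * e\<^sup>2)" by (simp add: power_mult_distrib)
      also have "\<dots> \<le> 1/4"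
      proof -
        have "real (Suc n) * (4 * e\<^sup>2) = 1 / (4 * real (Suc n))"
          unfolding e_def by (simp add: power2_eq_square del: of_nat_Suc)
        also have "\<dots> \<le> 1/4" by (intro divide_left_mono) auto
        finally show ?thesis .
      qed
      finally have "(\<nu> x)\<^sup>2 \<le> (1/2)\<^sup>2" by (simp add: power2_eq_square)
      then have "\<nu> x \<le> 1/2" by (rule power2_le_imp_le) simp
      with False show False by simp
    qed
  qed
  show thesis
  proof
    show "continuous_on K (\<lambda>x. normalise n (P x))" using cP nz by (intro continuous_on_normalise) auto
    show "(\<lambda>x. normalise n (P x)) ` K \<subseteq> complex_sphere n" using nz normalise_in_sphere by blast
    fix x assume x: "x \<in> A"
    have eqf: "(\<lambda>j. F j x) = f x" using F(2)[OF x] by auto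
    have fs: "f x \<in> complex_sphere n" using f(2) x by blast
    have "\<nu> x = 1" using cnorm_sphere[OF fs] eqf by (simp add: \<nu>_def)
    then have "\<phi> x = 0" by (simp add: \<phi>_def)
    then have "P x = f x" using eqf by (auto simp: P_def fun_eq_iff)
    then show "normalise n (P x) = f x" using normalise_sphere[OF fs] by simp
  qed
qed

subsection \<open>Dimension of spheres and cubes\<close>

lemma dist_fun_summable:
  fixes x y :: "nat \<Rightarrow> 'b::metric_space"
  shows "summable (\<lambda>i. (1/2)^i * min (dist (x (from_nat i)) (y (from_nat i))) 1)"
  by (rule summable_comparison_test'[of "\<lambda>n. (1/2)^n"]) (auto simp: summable_geometric_iff)

lemma dist_fun_mono:
  fixes x y :: "nat \<Rightarrow> 'b::metric_space" and x' y' :: "nat \<Rightarrow> 'c::metric_space"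
  assumes "\<And>i. dist (x i) (y i) \<le> dist (x' i) (y' i)"
  shows "dist x y \<le> dist x' y'"
  unfolding dist_fun_def
  by (intro suminf_le dist_fun_summable mult_left_mono min.mono assms) auto

text \<open>The factor 2 is the total weight 1 + 1/2 + 1/4 + ... in the metric on sequences.\<close>

lemma dist_fun_le:
  fixes x y :: "nat \<Rightarrow> 'b::metric_space"
  assumes "\<And>i. dist (x i) (y i) \<le> c"
  shows "dist x y \<le> 2 * c"
proof -
  have "dist x y \<le> suminf (\<lambda>i::nat. c * (1/2)^i)"
    unfolding dist_fun_def
  proof (intro suminf_le dist_fun_summable)
    show "(1/2)^i * min (dist (x (from_nat i)) (y (from_nat i))) 1 \<le> c * (1/2)^i" for i
      using assms[of "from_nat i"] by (simp add: mult.commute min.coboundedI1)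
    show "summable (\<lambda>i. c * (1/2)^i)" by (intro summable_mult summable_geometric) auto
  qed
  also have "\<dots> = c * 2" by (subst suminf_mult) (auto simp: suminf_geometric)
  finally show ?thesis by simp
qed

lemma low_dim_unit_cube: "low_dim i (unit_cube i)"
proof (induction i)
  case 0
  have "unit_cube 0 = {\<lambda>_. 0}" by (auto simp: unit_cube_def)
  then show ?case using low_dim_singleton by metis
next
  case (Suc i)
  define f where "f = (\<lambda>(t::nat \<Rightarrow> real, s::real). t(i := s))"
  have "low_dim (Suc i) (f ` (unit_cube i \<times> {0..1}))"
  \<comment> \<open>3 = 2 + 1: the new coordinate contributes the factor 2 of
    \<open>dist_fun_le\<close>, the old ones contribute 1.\<close>
  proof (rule low_dim_lipschitz_image[OF low_dim_Times_interval[OF Suc], where L = 3])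
    fix p q assume "p \<in> unit_cube i \<times> {0..1::real}" "q \<in> unit_cube i \<times> {0..1::real}"
    then obtain t s t' s' where *: "p = (t,s)" "q = (t',s')" "t \<in> unit_cube i" "t' \<in> unit_cube i" by auto
    have "dist (t(i := s)) (t'(i := s')) \<le> dist (t(i := s)) (t(i := s')) + dist (t(i := s')) (t'(i:=s'))"
      by (rule dist_triangle)
    also have "dist (t(i := s)) (t(i := s')) \<le> 2 * dist s s'" by (rule dist_fun_le) auto
    also have "dist (t(i := s')) (t'(i:=s')) \<le> dist t t'" by (rule dist_fun_mono) auto
    also have "2 * dist s s' + dist t t' \<le> 3 * dist p q"
      using dist_fst_le[of p q] dist_snd_le[of p q] * by simp
    finally show "dist (f p) (f q) \<le> real 3 * dist p q" using * by (simp add: f_def)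
  qed
  moreover have "unit_cube (Suc i) \<subseteq> f ` (unit_cube i \<times> {0..1})"
  proof
    fix t assume t: "t \<in> unit_cube (Suc i)"
    then have "t = f (t(i := 0), t i)" "t(i:=0) \<in> unit_cube i" "t i \<in> {0..1}" by (auto simp: f_def unit_cube_def)
    then show "t \<in> f ` (unit_cube i \<times> {0..1})" by blast
  qed
  ultimately show ?case by (rule low_dim_subset)
qed

lemma lipschitz_sin_cos:
  fixes a b :: real
  shows "\<bar>sin a - sin b\<bar> \<le> \<bar>a - b\<bar>" and "\<bar>cos a - cos b\<bar> \<le> \<bar>a - b\<bar>"
  proof -
    have 1: "\<bar>sin ((a - b)/2)\<bar> \<le> \<bar>a - b\<bar>/2" using abs_sin_le_one abs_sin_x_le_abs_x[of "(a-b)/2"] by simp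
    have "\<bar>sin a - sin b\<bar> = 2 * \<bar>sin ((a - b)/2)\<bar> * \<bar>cos ((a+b)/2)\<bar>"
      by (simp add: sin_diff_sin abs_mult)
    also have "\<dots> \<le> 2 * (\<bar>a - b\<bar>/2) * 1" using 1 by (intro mult_mono) auto
    finally show "\<bar>sin a - sin b\<bar> \<le> \<bar>a - b\<bar>" by simp
    have 1: "\<bar>sin ((b - a)/2)\<bar> \<le> \<bar>a - b\<bar>/2" using abs_sin_x_le_abs_x[of "(b-a)/2"] by simp
    have "\<bar>cos a - cos b\<bar> = 2 * \<bar>sin ((a + b)/2)\<bar> * \<bar>sin ((b-a)/2)\<bar>"
      by (simp add: cos_diff_cos abs_mult)
    also have "\<dots> \<le> 2 * 1 * (\<bar>a - b\<bar>/2)" using 1 by (intro mult_mono) auto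
    finally show "\<bar>cos a - cos b\<bar> \<le> \<bar>a - b\<bar>" by simp
  qed

text \<open>Arbitrary coordinate sets are allowed because the dimension count adds one coordinate at
  a time, and because the skeleton is built from the sphere in coordinates 1 to n.\<close>

definition support_sphere :: "nat set \<Rightarrow> (nat \<Rightarrow> complex) set" where
  "support_sphere J = {z. (\<Sum>j\<in>J. (cmod (z j))\<^sup>2) = 1 \<and> (\<forall>j. j \<notin> J \<longrightarrow> z j = 0)}"

lemma complex_sphere_eq_support: "complex_sphere n = support_sphere {..n}"
  by (auto simp: complex_sphere_def support_sphere_def not_le)

lemma support_sphere_le_1:
  assumes "finite J" "z \<in> support_sphere J"
  shows "cmod (z j) \<le> 1"
proof (cases "j \<in> J")
  case True
  have "(cmod (z j))\<^sup>2 \<le> (\<Sum>j\<in>J. (cmod (z j))\<^sup>2)" using True assms(1) by (intro member_le_sum) auto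
  then have "(cmod (z j))\<^sup>2 \<le> 1\<^sup>2" using assms(2) by (simp add: support_sphere_def)
  then show ?thesis by (rule power2_le_imp_le) simp
qed (use assms in \<open>auto simp: support_sphere_def\<close>)

text \<open>The set is the join of W with one point of the circle in coordinate k; the angle a is
  the only new parameter.\<close>

lemma low_dim_join:
  fixes W :: "(nat \<Rightarrow> complex) set"
  assumes W: "low_dim d W" and bd: "\<And>w j. w \<in> W \<Longrightarrow> cmod (w j) \<le> 1" and z: "\<And>w. w \<in> W \<Longrightarrow> w k = 0"
    and u: "cmod u = 1"
  shows "low_dim (Suc d) {\<lambda>j. if j = k then of_real (sin a) * u else of_real (cos a) * w j | a w. a \<in> {0..pi/2} \<and> w \<in> W}"
proof -
  \<comment> \<open>The parameter is half the angle, which stays in {0..1} because pi/2 < 2. The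
    constant 5 below is 1 from w plus 2 * 2 from the angle.\<close>
  define f where "f = (\<lambda>(w::nat \<Rightarrow> complex, a::real) (j::nat). if j = k then of_real (sin (2*a)) * u else of_real (cos (2*a)) * w j)"
  note lipsin = lipschitz_sin_cos
  have "low_dim (Suc d) (f ` (W \<times> {0..1}))"
  proof (rule low_dim_lipschitz_image[OF low_dim_Times_interval[OF W], where L = 5])
    fix p q assume "p \<in> W \<times> {0..1::real}" "q \<in> W \<times> {0..1::real}"
    then obtain w a w' a' where *: "p = (w,a)" "q = (w',a')" "w \<in> W" "w' \<in> W" by auto
    have "dist (f (w,a)) (f (w',a')) \<le> dist (f (w,a)) (f (w',a)) + dist (f (w',a)) (f (w',a'))"
      by (rule dist_triangle)
    also have "dist (f (w,a)) (f (w',a)) \<le> dist w w'"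
    proof (rule dist_fun_mono)
      fix j
      have "cmod (of_real (cos (2*a)) * w j - of_real (cos (2*a)) * w' j) = \<bar>cos (2*a)\<bar> * cmod (w j - w' j)"
        by (simp add: norm_mult flip: right_diff_distrib)
      also have "\<dots> \<le> 1 * cmod (w j - w' j)" by (intro mult_right_mono) auto
      finally show "dist (f (w,a) j) (f (w',a) j) \<le> dist (w j) (w' j)" by (simp add: f_def dist_norm)
    qed
    also have "dist (f (w',a)) (f (w',a')) \<le> 2 * (2 * dist a a')"
    proof (rule dist_fun_le)
      fix j
      have s: "cmod (of_real (sin (2*a)) * u - of_real (sin (2*a')) * u) \<le> 2 * dist a a'"
        using lipsin(1)[of "2*a" "2*a'"] u by (simp add: norm_mult dist_real_def abs_if split: if_splits flip: left_diff_distrib of_real_diff)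
      have "cmod (of_real (cos (2*a)) * w' j - of_real (cos (2*a')) * w' j) = \<bar>cos (2*a) - cos (2*a')\<bar> * cmod (w' j)"
        by (simp add: norm_mult flip: left_diff_distrib of_real_diff)
      also have "\<dots> \<le> (2 * \<bar>a - a'\<bar>) * 1" using lipsin(2)[of "2*a" "2*a'"] bd[OF *(4)] by (intro mult_mono) (auto simp: abs_if split: if_splits)
      finally show "dist (f (w',a) j) (f (w',a') j) \<le> 2 * dist a a'" using s by (simp add: f_def dist_norm dist_real_def)
    qed
    also have "dist w w' + 2 * (2 * dist a a') \<le> 5 * dist p q"
      using dist_fst_le[of p q] dist_snd_le[of p q] * by simp
    finally show "dist (f p) (f q) \<le> real 5 * dist p q" using * by simp
  qed
  moreover have "{\<lambda>j. if j = k then of_real (sin a) * u else of_real (cos a) * w j | a w. a \<in> {0..pi/2} \<and> w \<in> W} \<subseteq> f ` (W \<times> {0..1})"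
  proof clarify
    fix a w assume a: "a \<in> {0..pi/2}" "w \<in> W"
    have "(w, a/2) \<in> W \<times> {0..1}" using a pi_less_4 by auto
    moreover have "(\<lambda>j. if j = k then of_real (sin a) * u else of_real (cos a) * w j) = f (w, a/2)" by (auto simp: f_def)
    ultimately show "(\<lambda>j. if j = k then of_real (sin a) * u else of_real (cos a) * w j) \<in> f ` (W \<times> {0..1})" by blast
  qed
  ultimately show ?thesis by (rule low_dim_subset)
qed

lemma low_dim_rotate:
  fixes W :: "(nat \<Rightarrow> complex) set"
  assumes W: "low_dim d W" and bd: "\<And>w. w \<in> W \<Longrightarrow> cmod (w k) \<le> 1"
  shows "low_dim (Suc d) {w(k := cis b * w k) | b w. b \<in> {0..2*pi} \<and> w \<in> W}"
proof -
  \<comment> \<open>A factor 8 is enough for a full turn because 2 pi < 8. The constant 33 below is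
    1 from w plus 2 * 16 from the angle, \<open>cis\<close> having Lipschitz constant at most
    2.\<close>
  define f where "f = (\<lambda>(w::nat \<Rightarrow> complex, a::real). w(k := cis (8*a) * w k))"
  have lip: "cmod (cis a - cis b) \<le> 2 * \<bar>a - b\<bar>" for a b
  proof -
    have "cmod (cis a - cis b) \<le> \<bar>cos a - cos b\<bar> + \<bar>sin a - sin b\<bar>"
      using cmod_le[of "cis a - cis b"] by simp
    also have "\<dots> \<le> \<bar>a - b\<bar> + \<bar>a - b\<bar>" by (intro add_mono lipschitz_sin_cos)
    finally show ?thesis by simp
  qed
  have "low_dim (Suc d) (f ` (W \<times> {0..1}))"
  proof (rule low_dim_lipschitz_image[OF low_dim_Times_interval[OF W], where L = 33])
    fix p q assume "p \<in> W \<times> {0..1::real}" "q \<in> W \<times> {0..1::real}"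
    then obtain w a w' a' where *: "p = (w,a)" "q = (w',a')" "w \<in> W" "w' \<in> W" by auto
    have "dist (f (w,a)) (f (w',a')) \<le> dist (f (w,a)) (f (w',a)) + dist (f (w',a)) (f (w',a'))"
      by (rule dist_triangle)
    also have "dist (f (w,a)) (f (w',a)) \<le> dist w w'"
      by (rule dist_fun_mono) (simp add: f_def dist_norm norm_mult flip: right_diff_distrib)
    also have "dist (f (w',a)) (f (w',a')) \<le> 2 * (16 * dist a a')"
    proof (rule dist_fun_le)
      fix j
      have "cmod (cis (8*a) * w' k - cis (8*a') * w' k) = cmod (cis (8*a) - cis (8*a')) * cmod (w' k)"
        by (simp add: norm_mult flip: left_diff_distrib)
      also have "\<dots> \<le> (2 * \<bar>8*a - 8*a'\<bar>) * 1" using lip bd[OF *(4)] by (intro mult_mono) auto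
      also have "\<dots> = 16 * dist a a'" by (simp add: dist_real_def abs_if)
      finally show "dist (f (w',a) j) (f (w',a') j) \<le> 16 * dist a a'" by (simp add: f_def dist_norm)
    qed
    also have "dist w w' + 2 * (16 * dist a a') \<le> 33 * dist p q"
      using dist_fst_le[of p q] dist_snd_le[of p q] * by simp
    finally show "dist (f p) (f q) \<le> real 33 * dist p q" using * by simp
  qed
  moreover have "{w(k := cis b * w k) | b w. b \<in> {0..2*pi} \<and> w \<in> W} \<subseteq> f ` (W \<times> {0..1})"
  proof clarify
    fix b :: real and w assume b: "b \<in> {0..2*pi}" "w \<in> W"
    have "(w, b/8) \<in> W \<times> {0..1}" using b pi_less_4 by auto
    moreover have "w(k := cis b * w k) = f (w, b/8)" by (simp add: f_def)
    ultimately show "w(k := cis b * w k) \<in> f ` (W \<times> {0..1})" by blast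
  qed
  ultimately show ?thesis by (rule low_dim_subset)
qed

text \<open>Polar coordinates that single out k: the angle a measures the modulus of coordinate k,
  and w is the direction of the rest.\<close>

lemma support_sphere_split:
  assumes J: "finite J" "J \<noteq> {}" "k \<notin> J" and z: "z \<in> support_sphere (insert k J)"
  obtains a w where "a \<in> {0..pi/2}" "w \<in> support_sphere J" "cmod (z k) = sin a"
    "\<And>j. j \<noteq> k \<Longrightarrow> z j = of_real (cos a) * w j"
proof -
  define r where "r = sqrt (\<Sum>j\<in>J. (cmod (z j))\<^sup>2)"
  have r0: "r \<ge> 0" by (simp add: r_def sum_nonneg)
  have r2: "r\<^sup>2 = (\<Sum>j\<in>J. (cmod (z j))\<^sup>2)" by (simp add: r_def sum_nonneg)
  have tot: "(cmod (z k))\<^sup>2 + r\<^sup>2 = 1" using z J by (simp add: support_sphere_def r2)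
  then obtain t where t: "0 \<le> t" "t \<le> 2*pi" "cmod (z k) = cos t" "r = sin t"
    using sincos_total_2pi_le[of "cmod (z k)" r] by blast
  have k1: "cmod (z k) \<le> 1" using support_sphere_le_1[OF _ z] J by simp
  define a where "a = arcsin (cmod (z k))"
  have sa: "sin a = cmod (z k)" unfolding a_def using k1 by (intro sin_arcsin) (auto intro: order_trans[OF _ norm_ge_zero])
  have a: "a \<in> {0..pi/2}"
  proof -
    have "0 \<le> a" unfolding a_def using k1 arcsin_le_arcsin[of 0 "cmod (z k)"] by simp
    moreover have "a \<le> pi/2" unfolding a_def using k1 by (intro arcsin_ubound) (auto intro: order_trans[OF _ norm_ge_zero])
    ultimately show ?thesis by simp
  qed
  have "(cos a)\<^sup>2 = r\<^sup>2" using tot sa sin_cos_squared_add[of a] by simp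
  moreover have "cos a \<ge> 0" using a by (intro cos_ge_zero) auto
  ultimately have ca: "cos a = r" using r0 by (simp add: power2_eq_iff_nonneg)
  obtain j0 where j0: "j0 \<in> J" using J by blast
  \<comment> \<open>For r = 0 the rest has no direction; any unit vector serves, and nonemptiness of
    J supplies one.\<close>
  define w where "w = (if r = 0 then (\<lambda>j. if j = j0 then 1 else 0) else (\<lambda>j. if j \<in> J then z j / of_real r else 0))"
  have w: "w \<in> support_sphere J"
  proof (cases "r = 0")
    case True
    have "(\<Sum>j\<in>J. (cmod (w j))\<^sup>2) = (\<Sum>j\<in>J. if j = j0 then 1 else 0)"
      using True by (intro sum.cong) (auto simp: w_def)
    also have "\<dots> = 1" using j0 J by simp
    finally show ?thesis using True j0 by (auto simp: support_sphere_def w_def)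
  next
    case False
    have "(\<Sum>j\<in>J. (cmod (w j))\<^sup>2) = (\<Sum>j\<in>J. (cmod (z j))\<^sup>2 / r\<^sup>2)"
      using False by (intro sum.cong) (auto simp: w_def norm_divide power_divide)
    also have "\<dots> = 1" using False r2[symmetric] by (simp flip: sum_divide_distrib)
    finally show ?thesis using False by (auto simp: support_sphere_def w_def)
  qed
  have "z j = of_real (cos a) * w j" if "j \<noteq> k" for j
  proof (cases "r = 0")
    case True
    then have "\<forall>j\<in>J. (cmod (z j))\<^sup>2 = 0" using r2 J by (simp add: sum_nonneg_eq_0_iff)
    then have "z j = 0" using that z by (cases "j \<in> J") (auto simp: support_sphere_def)
    then show ?thesis using True ca by simp
  next
    case False
    then show ?thesis using that z ca by (auto simp: support_sphere_def w_def)
  qed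
  with a w sa show thesis using that by metis
qed

text \<open>Every further complex coordinate adds two parameters, the angle of the join and the
  phase of the new coordinate.\<close>

lemma low_dim_support_sphere:
  assumes "finite J" "J \<noteq> {}"
  shows "low_dim (2 * card J - 1) (support_sphere J)"
  using assms
proof (induction J rule: finite_ne_induct)
  case (singleton k)
  have "low_dim 0 {(\<lambda>j. if j = k then 1 else 0) :: nat \<Rightarrow> complex}" by (rule low_dim_singleton)
  then have "low_dim 1 {w(k := cis b * w k) | b w. b \<in> {0..2*pi} \<and> w \<in> {(\<lambda>j. if j = k then 1 else 0) :: nat \<Rightarrow> complex}}"
    using low_dim_rotate[of 0 "{(\<lambda>j. if j = k then 1 else 0) :: nat \<Rightarrow> complex}" k] by simp
  moreover have "support_sphere {k} \<subseteq> {w(k := cis b * w k) | b w. b \<in> {0..2*pi} \<and> w \<in> {(\<lambda>j. if j = k then 1 else 0) :: nat \<Rightarrow> complex}}"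
  proof
    fix z assume z: "z \<in> support_sphere {k}"
    then have "(cmod (z k))\<^sup>2 = 1" by (simp add: support_sphere_def)
    then have "cmod (z k) = 1" by (metis norm_ge_zero one_power2 power2_eq_iff_nonneg zero_le_one)
    then obtain b where b: "0 \<le> b" "b < 2*pi" "z k = cis b"
      using complex_unit_circle by (metis complex_norm_eq_1_exp_eq Arg2pi_eq cis_conv_exp Arg2pi_ge_0 Arg2pi_lt_2pi mult_1 of_real_1)
    then have "z = (\<lambda>j. if j = k then 1 else 0)(k := cis b * (if k = k then 1 else 0))"
      using z by (auto simp: support_sphere_def)
    then show "z \<in> {w(k := cis b * w k) | b w. b \<in> {0..2*pi} \<and> w \<in> {(\<lambda>j. if j = k then 1 else 0) :: nat \<Rightarrow> complex}}"
      using b by fastforce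
  qed
  ultimately show ?case using low_dim_subset by simp
next
  case (insert k J)
  define X where "X = {\<lambda>j. if j = k then of_real (sin a) * 1 else of_real (cos a) * w j | a w. a \<in> {0..pi/2} \<and> w \<in> support_sphere J}"
  have X: "low_dim (Suc (2 * card J - 1)) X" unfolding X_def
    by (rule low_dim_join[OF insert.IH]) (use insert support_sphere_le_1 in \<open>auto simp: support_sphere_def\<close>)
  have "low_dim (Suc (Suc (2 * card J - 1))) {w(k := cis b * w k) | b w. b \<in> {0..2*pi} \<and> w \<in> X}"
    by (rule low_dim_rotate[OF X]) (auto simp: X_def)
  moreover have "support_sphere (insert k J) \<subseteq> {w(k := cis b * w k) | b w. b \<in> {0..2*pi} \<and> w \<in> X}"
  proof
    fix z assume z: "z \<in> support_sphere (insert k J)"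
    obtain a w where aw: "a \<in> {0..pi/2}" "w \<in> support_sphere J" "cmod (z k) = sin a"
      "\<And>j. j \<noteq> k \<Longrightarrow> z j = of_real (cos a) * w j"
      using support_sphere_split[OF insert.hyps(1,2,3) z] by metis
    define x where "x = (\<lambda>j. if j = k then of_real (sin a) * 1 else of_real (cos a) * w j)"
    have x: "x \<in> X" unfolding X_def x_def using aw by blast
    have "z k = of_real (cmod (z k)) * cis (Arg2pi (z k))" using Arg2pi_eq[of "z k"] by (simp add: cis_conv_exp)
    then have "z = x(k := cis (Arg2pi (z k)) * x k)" using aw by (auto simp: x_def fun_eq_iff mult.commute)
    moreover have "Arg2pi (z k) \<in> {0..2*pi}" using Arg2pi_ge_0[of "z k"] Arg2pi_lt_2pi[of "z k"] by simp
    ultimately show "z \<in> {w(k := cis b * w k) | b w. b \<in> {0..2*pi} \<and> w \<in> X}" using x by blast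
  qed
  ultimately have "low_dim (Suc (Suc (2 * card J - 1))) (support_sphere (insert k J))" by (rule low_dim_subset)
  moreover have "Suc (Suc (2 * card J - 1)) = 2 * card (insert k J) - 1"
    using insert.hyps by (cases "card J") auto
  ultimately show ?case by simp
qed

lemma low_dim_sphere: "low_dim (2 * n + 1) (complex_sphere n)"
  using low_dim_support_sphere[of "{..n}"] by (simp add: complex_sphere_eq_support)

section \<open>The cyclic action on the sphere\<close>

lemma compact_complex_sphere: "compact (complex_sphere n)"
proof -
  have "compactin (product_topology (\<lambda>i. euclidean) UNIV) (PiE UNIV (\<lambda>_::nat. cball (0::complex) 1))"
    by (subst compactin_PiE) (simp add: compactin_euclidean_iff)
  then have "compact (PiE UNIV (\<lambda>_::nat. cball (0::complex) 1))"
    by (simp only: euclidean_product_topology compactin_euclidean_iff)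
  moreover have "complex_sphere n = PiE UNIV (\<lambda>_. cball 0 1) \<inter> {z. (\<Sum>j\<le>n. (cmod (z j))\<^sup>2) = 1 \<and> (\<forall>j>n. z j = 0)}"
  proof -
    have "cmod (z j) \<le> 1" if "z \<in> complex_sphere n" for z j
      using support_sphere_le_1[of "{..n}" z j] that by (simp add: complex_sphere_eq_support)
    then show ?thesis by (auto simp: complex_sphere_def)
  qed
  moreover have "closed {z. (\<Sum>j\<le>n. (cmod (z j))\<^sup>2) = 1 \<and> (\<forall>j>n. (z j :: complex) = 0)}"
  proof -
    have coord: "continuous_on UNIV (\<lambda>z::nat \<Rightarrow> complex. z j)" for j
      by (rule continuous_on_coord[OF continuous_on_id])
    have "closed {z::nat \<Rightarrow> complex. (\<Sum>j\<le>n. (cmod (z j))\<^sup>2) = 1}"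
      by (intro closed_Collect_eq continuous_on_sum continuous_on_power continuous_on_norm coord continuous_on_const)
    moreover have "closed (\<Inter>j\<in>{n<..}. {z::nat \<Rightarrow> complex. z j = 0})"
      by (intro closed_INT ballI closed_Collect_eq coord continuous_on_const)
    moreover have "{z. (\<Sum>j\<le>n. (cmod (z j))\<^sup>2) = 1 \<and> (\<forall>j>n. (z j :: complex) = 0)}
        = {z. (\<Sum>j\<le>n. (cmod (z j))\<^sup>2) = 1} \<inter> (\<Inter>j\<in>{n<..}. {z. z j = 0})" by auto
    ultimately show ?thesis using closed_Int by simp
  qed
  ultimately show ?thesis using compact_Int_closed by simp
qed

lemma closed_complex_sphere: "closed (complex_sphere n)"
  by (intro compact_imp_closed compact_complex_sphere)

text \<open>If the segment meets 0, comparing norms gives t^2 = (1 - t)^2, so t = 1/2 and the end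
  points are antipodal.\<close>

lemma sphere_segment_nonzero:
  assumes x: "x \<in> complex_sphere n" and y: "y \<in> complex_sphere n" and t: "t \<in> {0..1}"
    and ne: "\<not> (\<forall>j. y j = - x j)"
  shows "\<exists>j\<le>n. of_real (1 - t) * x j + of_real t * y j \<noteq> (0::complex)"
proof (rule ccontr)
  assume "\<not> ?thesis"
  then have z: "of_real (1 - t) * x j + of_real t * y j = 0" if "j \<le> n" for j using that by blast
  then have e: "of_real t * y j = - (of_real (1 - t) * x j)" if "j \<le> n" for j
    using that by (simp add: eq_neg_iff_add_eq_0 add.commute)
  have "t\<^sup>2 * (cmod (y j))\<^sup>2 = (1-t)\<^sup>2 * (cmod (x j))\<^sup>2" if "j \<le> n" for j
  proof -
    have "cmod (of_real t * y j) = cmod (of_real (1 - t) * x j)" using e[OF that] by (metis norm_minus_cancel)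
    then have "(\<bar>t\<bar> * cmod (y j))\<^sup>2 = (\<bar>1 - t\<bar> * cmod (x j))\<^sup>2" by (simp add: norm_mult del: of_real_diff)
    then show ?thesis by (simp add: power_mult_distrib)
  qed
  then have "(\<Sum>j\<le>n. t\<^sup>2 * (cmod (y j))\<^sup>2) = (\<Sum>j\<le>n. (1-t)\<^sup>2 * (cmod (x j))\<^sup>2)" by (intro sum.cong) auto
  then have "t\<^sup>2 = (1-t)\<^sup>2" using x y by (simp add: complex_sphere_def flip: sum_distrib_left)
  then have t2: "t = 1/2" using t by (simp add: power2_eq_iff_nonneg)
  have "y j = - x j" for j
  proof (cases "j \<le> n")
    case True
    then show ?thesis using e[OF True] t2 by simp
  next
    case False
    then show ?thesis using x y by (simp add: complex_sphere_def)
  qed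
  with ne show False by blast
qed

definition sseg :: "nat \<Rightarrow> (nat \<Rightarrow> complex) \<Rightarrow> (nat \<Rightarrow> complex) \<Rightarrow> real \<Rightarrow> nat \<Rightarrow> complex" where
  "sseg n x y t = normalise n (\<lambda>j. of_real (1 - t) * x j + of_real t * y j)"

lemma sseg_in_sphere:
  "x \<in> complex_sphere n \<Longrightarrow> y \<in> complex_sphere n \<Longrightarrow> t \<in> {0..1} \<Longrightarrow> \<not> (\<forall>j. y j = - x j) \<Longrightarrow> sseg n x y t \<in> complex_sphere n"
  unfolding sseg_def by (intro normalise_in_sphere sphere_segment_nonzero)

lemma sseg_0 [simp]: "x \<in> complex_sphere n \<Longrightarrow> sseg n x y 0 = x"
  and sseg_1 [simp]: "y \<in> complex_sphere n \<Longrightarrow> sseg n x y 1 = y"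
  unfolding sseg_def by (simp_all add: normalise_sphere)

lemma continuous_on_sseg:
  assumes "continuous_on X f" "continuous_on X g" "continuous_on X \<tau>"
    and "\<And>x. x \<in> X \<Longrightarrow> f x \<in> complex_sphere n" "\<And>x. x \<in> X \<Longrightarrow> g x \<in> complex_sphere n"
    and "\<And>x. x \<in> X \<Longrightarrow> \<tau> x \<in> {0..1}" "\<And>x. x \<in> X \<Longrightarrow> \<not> (\<forall>j. g x j = - f x j)"
  shows "continuous_on X (\<lambda>x. sseg n (f x) (g x) (\<tau> x))"
  unfolding sseg_def
proof (rule continuous_on_normalise)
  show "continuous_on X (\<lambda>x. of_real (1 - \<tau> x) * f x j + of_real (\<tau> x) * g x j)" for j
    by (intro continuous_intros continuous_on_coord[OF assms(1)] continuous_on_coord[OF assms(2)] assms(3))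
  show "\<exists>j\<le>n. of_real (1 - \<tau> x) * f x j + of_real (\<tau> x) * g x j \<noteq> (0::complex)" if "x \<in> X" for x
    using that assms by (intro sphere_segment_nonzero) auto
qed

text \<open>Points that are not antipodal are joined by a normalised segment inside V; the antipode
  of c is reached by a detour through d. The set V is abstract because both the whole sphere and the
  equator are needed.\<close>

lemma connected_sphere_section:
  assumes c: "c \<in> complex_sphere n \<inter> V" and d: "d \<in> complex_sphere n \<inter> V" "d \<noteq> c" "\<not> (\<forall>j. d j = - c j)"
    and lin: "\<And>x y (s::real) t. x \<in> V \<Longrightarrow> y \<in> V \<Longrightarrow> normalise n (\<lambda>j. of_real s * x j + of_real t * y j) \<in> V"
  shows "connected (complex_sphere n \<inter> V)"
proof -
  have conn: "\<exists>C. connected C \<and> C \<subseteq> complex_sphere n \<inter> V \<and> x \<in> C \<and> y \<in> C"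
    if x: "x \<in> complex_sphere n \<inter> V" and y: "y \<in> complex_sphere n \<inter> V" and ne: "\<not> (\<forall>j. y j = - x j)" for x y
  proof (intro exI[of _ "sseg n x y ` {0..1}"] conjI)
    show "connected (sseg n x y ` {0..1})"
      by (intro connected_continuous_image continuous_on_sseg continuous_intros) (use x y ne in auto)
    show "sseg n x y ` {0..1} \<subseteq> complex_sphere n \<inter> V"
      using x y ne sseg_in_sphere[of x n y] lin[of x y] by (auto simp: sseg_def simp del: of_real_diff)
    show "x \<in> sseg n x y ` {0..1}" using x by (metis IntD1 atLeastAtMost_iff imageI order_refl sseg_0 zero_le_one)
    show "y \<in> sseg n x y ` {0..1}" using y by (metis IntD1 atLeastAtMost_iff imageI order_refl sseg_1 zero_le_one)
  qed
  have c0: "\<not> (\<forall>j. c j = - c j)"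
  proof
    assume "\<forall>j. c j = - c j"
    then have "c j = 0" for j using eq_neg_iff_add_eq_0[of "c j" "c j"] by (simp add: mult_2[symmetric])
    then show False using sphere_nonzero[of c n] c by auto
  qed
  have *: "\<exists>C. connected C \<and> C \<subseteq> complex_sphere n \<inter> V \<and> x \<in> C \<and> c \<in> C" if x: "x \<in> complex_sphere n \<inter> V" for x
  proof (cases "\<forall>j. c j = - x j")
    case False
    then show ?thesis using conn[OF x c] by blast
  next
    case True
    have "\<not> (\<forall>j. d j = - x j)"
    proof
      assume "\<forall>j. d j = - x j"
      with True have "d j = c j" for j by simp
      then show False using d(2) by auto
    qed
    then obtain C where C: "connected C" "C \<subseteq> complex_sphere n \<inter> V" "x \<in> C" "d \<in> C" using conn[OF x d(1)] by blast
    have "\<not> (\<forall>j. c j = - d j)" using d(3) by (metis minus_minus)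
    then obtain D where D: "connected D" "D \<subseteq> complex_sphere n \<inter> V" "d \<in> D" "c \<in> D" using conn[OF d(1) c] by blast
    have "connected (C \<union> D)" using C D by (intro connected_Un) auto
    then show ?thesis using C D by (intro exI[of _ "C \<union> D"]) auto
  qed
  then have "connected_component (complex_sphere n \<inter> V) x c" if "x \<in> complex_sphere n \<inter> V" for x
    unfolding connected_component_def using that by blast
  then show ?thesis
    unfolding connected_iff_connected_component by (metis connected_component_sym connected_component_trans)
qed

definition unit_vec :: "nat \<Rightarrow> complex \<Rightarrow> nat \<Rightarrow> complex" where
  "unit_vec k u = (\<lambda>j. if j = k then u else 0)"

lemma unit_vec_in_sphere: "k \<le> n \<Longrightarrow> cmod u = 1 \<Longrightarrow> unit_vec k u \<in> complex_sphere n"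
proof -
  assume k: "k \<le> n" "cmod u = 1"
  have "(\<Sum>j\<le>n. (cmod (unit_vec k u j))\<^sup>2) = (\<Sum>j\<le>n. if j = k then 1 else 0)"
    using k by (intro sum.cong) (auto simp: unit_vec_def)
  also have "\<dots> = 1" using k by simp
  finally show ?thesis using k by (auto simp: complex_sphere_def unit_vec_def)
qed

lemma connected_complex_sphere: "connected (complex_sphere n)"
proof -
  have "connected (complex_sphere n \<inter> UNIV)"
  proof (rule connected_sphere_section)
    show "unit_vec 0 1 \<in> complex_sphere n \<inter> UNIV" "unit_vec 0 \<i> \<in> complex_sphere n \<inter> UNIV" by (simp_all add: unit_vec_in_sphere)
    show "unit_vec 0 \<i> \<noteq> unit_vec 0 1" by (metis unit_vec_def complex_i_not_one)
    show "\<not> (\<forall>j. unit_vec 0 \<i> j = - unit_vec 0 1 j)" by (auto simp: unit_vec_def complex_eq_iff intro!: exI[of _ 0])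
  qed auto
  then show ?thesis by simp
qed

lemma connected_complex_equator:
  assumes "n \<ge> 1"
  shows "connected (complex_sphere n \<inter> {z. Re (z 0) = 0})"
proof (rule connected_sphere_section)
  show "unit_vec 0 \<i> \<in> complex_sphere n \<inter> {z. Re (z 0) = 0}" "unit_vec 1 1 \<in> complex_sphere n \<inter> {z. Re (z 0) = 0}"
    using assms by (simp_all add: unit_vec_in_sphere) (simp_all add: unit_vec_def)
  show "unit_vec 1 1 \<noteq> unit_vec 0 \<i>" by (metis unit_vec_def zero_neq_one)
  show "\<not> (\<forall>j. unit_vec 1 1 j = - unit_vec 0 \<i> j)" by (auto simp: unit_vec_def complex_eq_iff intro!: exI[of _ 1])
qed (auto simp: normalise_def)

locale lens =
  fixes m n :: nat and q :: "nat \<Rightarrow> int"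
  assumes m2: "m \<ge> 2" and n1: "n \<ge> 1" and cop: "\<And>j. j \<in> {1..n} \<Longrightarrow> coprime (q j) (int m)"
begin

abbreviation S :: "(nat \<Rightarrow> complex) set" where "S \<equiv> complex_sphere n"

definition wt :: "nat \<Rightarrow> int" where "wt j = (if j = 0 then 1 else q j)"

text \<open>All integers occur as exponents, so inverses need no reduction modulo m; by
  \<open>act_cong\<close> the action depends only on the residue.\<close>

definition act :: "int \<Rightarrow> (nat \<Rightarrow> complex) \<Rightarrow> nat \<Rightarrow> complex" where
  "act k z = (\<lambda>j. z j * cis (2 * pi * of_int (wt j * k) / real m))"

lemma m0: "real m > 0" using m2 by simp

lemma coprime_wt: "j \<le> n \<Longrightarrow> coprime (wt j) (int m)"
  using cop[of j] by (auto simp: wt_def)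

lemma act_act [simp]: "act k (act l z) = act (k + l) z"
  by (rule ext) (simp add: act_def cis_mult distrib_left add_divide_distrib mult.assoc add.commute)

lemma act_0 [simp]: "act 0 z = z" by (simp add: act_def)

lemma cis_int: "cis (2 * pi * of_int k) = 1"
  by (simp add: cis.ctr cos_int_2pin sin_int_2pin complex_eq_iff) 

lemma act_dvd: "int m dvd k \<Longrightarrow> act k z = z"
proof -
  assume "int m dvd k"
  then obtain l where "k = int m * l" by blast
  then have "2 * pi * of_int (wt j * k) / real m = 2 * pi * of_int (wt j * l)" for j using m0 by simp
  then show ?thesis by (simp add: act_def cis_int del: of_int_mult)
qed

lemma act_cong: "int m dvd k - l \<Longrightarrow> act k z = act l z"
  using act_dvd[of "k - l" "act l z"] by simp

lemma act_mod: "act (k mod int m) z = act k z"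
  by (rule act_cong) (simp add: mod_eq_dvd_iff[symmetric])

lemma cmod_act [simp]: "cmod (act k z j) = cmod (z j)"
  by (simp add: act_def norm_mult)

lemma act_sphere [simp]: "act k z \<in> S \<longleftrightarrow> z \<in> S"
proof -
  have "act k z \<in> S" if "z \<in> S" for k z
    using that by (simp add: complex_sphere_def) (simp add: act_def)
  from this[of z k] this[of "act k z" "-k"] show ?thesis by auto
qed

lemma dist_act [simp]: "dist (act k x) (act k y) = dist x y"
proof -
  have "dist (act k x i) (act k y i) = dist (x i) (y i)" for i
    by (simp add: act_def dist_norm norm_mult flip: left_diff_distrib)
  then show ?thesis by (simp add: dist_fun_def)
qed

lemma dist_act_shift: "dist (act k x) y = dist x (act (-k) y)"
  using dist_act[of "-k" "act k x" y] by simp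

lemma continuous_on_act [continuous_intros]:
  assumes "continuous_on X f"
  shows "continuous_on X (\<lambda>x. act k (f x))"
  by (rule continuous_on_coordinatewise_then_product)
    (use continuous_on_coord[OF assms] in \<open>auto simp: act_def intro!: continuous_intros\<close>)

text \<open>Some coordinate j is nonzero, and there the rotation is trivial only if m divides
  \<open>wt j * k\<close>; coprimality of the weights removes the factor
  \<open>wt j\<close>.\<close>

lemma act_free:
  assumes z: "z \<in> S" and fix': "act k z = z"
  shows "int m dvd k"
proof -
  obtain j where j: "j \<le> n" "z j \<noteq> 0" using sphere_nonzero[OF z] by blast
  have "z j * cis (2 * pi * of_int (wt j * k) / real m) = z j * 1" using fun_cong[OF fix', of j] by (simp add: act_def)
  then have c: "cis (2 * pi * of_int (wt j * k) / real m) = 1" using j(2) by simp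
  then have "cos (2 * pi * of_int (wt j * k) / real m) = 1" by (simp add: complex_eq_iff)
  then obtain l :: int where l: "2 * pi * of_int (wt j * k) / real m = of_int l * (2 * pi)"
    using cos_one_2pi_int by (metis mult.assoc)
  then have "of_int (wt j * k) = real_of_int (l * int m)" using m0 by (simp add: field_simps)
  then have "wt j * k = l * int m" by (simp only: of_int_eq_iff)
  then have "int m dvd wt j * k" by simp
  then show ?thesis using coprime_wt[OF j(1)] by (metis coprime_commute coprime_dvd_mult_right_iff)
qed

lemma act_inj:
  assumes z: "z \<in> S" and e: "act k z = act l z"
  shows "int m dvd k - l"
proof -
  have "act (k - l) z = act (-l) (act k z)" by (simp add: add.commute)
  also have "\<dots> = z" using e by simp
  finally show ?thesis using act_free[OF z] by simp
qed

text \<open>For each nonzero residue the displacement has a positive minimum on the compact sphere,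
  and there are finitely many residues. The resulting \<delta> is the uniform scale for evenly
  covered balls and for uniqueness of lifts.\<close>

lemma act_separated:
  obtains \<delta> where "\<delta> > 0" "\<And>z k. z \<in> S \<Longrightarrow> dist z (act k z) < \<delta> \<Longrightarrow> int m dvd k"
proof -
  have ex: "\<exists>\<delta>>0. \<forall>z\<in>S. \<delta> \<le> dist z (act k z)" if k: "\<not> int m dvd k" for k
  proof -
    have "continuous_on S (\<lambda>z. dist z (act k z))" by (intro continuous_intros)
    moreover have "S \<noteq> {}" using unit_vec_in_sphere[of 0 n 1] by auto
    ultimately obtain z0 where z0: "z0 \<in> S" "\<And>z. z \<in> S \<Longrightarrow> dist z0 (act k z0) \<le> dist z (act k z)"
      using continuous_attains_inf[OF compact_complex_sphere] by metis
    have "dist z0 (act k z0) > 0" using act_free[OF z0(1)] k by (metis zero_less_dist_iff)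
    with z0(2) show ?thesis by blast
  qed
  then obtain d where d: "\<And>k. \<not> int m dvd k \<Longrightarrow> d k > 0" "\<And>k z. \<not> int m dvd k \<Longrightarrow> z \<in> S \<Longrightarrow> d k \<le> dist z (act k z)"
    by metis
  define \<delta> where "\<delta> = Min (insert 1 (d ` {k\<in>{0..<int m}. \<not> int m dvd k}))"
  have "finite {k\<in>{0..<int m}. \<not> int m dvd k}" by (rule finite_subset[of _ "{0..<int m}"]) auto
  then have fin: "finite (insert 1 (d ` {k\<in>{0..<int m}. \<not> int m dvd k}))" by blast
  show thesis
  proof
    show "\<delta> > 0" unfolding \<delta>_def using d(1) by (subst Min_gr_iff[OF fin]) auto
    fix z k assume z: "z \<in> S" and lt: "dist z (act k z) < \<delta>"
    show "int m dvd k"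
    proof (rule ccontr)
      assume k: "\<not> int m dvd k"
      define k' where "k' = k mod int m"
      have k': "k' \<in> {0..<int m}" "\<not> int m dvd k'" using k m0 by (auto simp: k'_def dvd_mod_iff)
      then have "\<delta> \<le> d k'" unfolding \<delta>_def using fin by (intro Min_le) auto
      also have "\<dots> \<le> dist z (act k z)" using d(2)[OF k'(2) z] by (simp add: k'_def act_mod)
      finally show False using lt by simp
    qed
  qed
qed

section \<open>Equivariant extension over free spaces of low dimension\<close>

definition act1 :: "int \<Rightarrow> (nat \<Rightarrow> complex) \<times> real \<Rightarrow> (nat \<Rightarrow> complex) \<times> real" where
  "act1 k p = (act k (fst p), snd p)"

lemma act1_simps [simp]: "act1 k (act1 l p) = act1 (k + l) p" "act1 0 p = p"
  "fst (act1 k p) = act k (fst p)" "snd (act1 k p) = snd p"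
  by (simp_all add: act1_def)

lemma continuous_on_act1 [continuous_intros]:
  assumes "continuous_on X f"
  shows "continuous_on X (\<lambda>x. act1 k (f x))"
  unfolding act1_def by (intro continuous_intros assms)

text \<open>Distinct translates of a ball of radius \<delta>/4 are disjoint, so on the piece P over
  one ball the only constraint is agreement with f on B. There \<open>extend_map_into_sphere\<close>
  applies, and the twisted equivariance dictates the values on the translates. The real component is
  0 for maps and the time for homotopies, so that one statement serves both.\<close>

lemma equivariant_extension_step:
  fixes f :: "(nat \<Rightarrow> complex) \<times> real \<Rightarrow> nat \<Rightarrow> complex"
  assumes sep: "\<delta> > 0" "\<And>z k. z \<in> S \<Longrightarrow> dist z (act k z) < \<delta> \<Longrightarrow> int m dvd k"
    and X: "compact X" "low_dim d X" "d \<le> 2 * n + 1" "fst ` X \<subseteq> S" "\<And>k p. p \<in> X \<Longrightarrow> act1 k p \<in> X"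
    and B: "closed B" "B \<subseteq> X" "\<And>k p. p \<in> B \<Longrightarrow> act1 k p \<in> B"
    and f: "continuous_on B f" "f ` B \<subseteq> S" "\<And>k p. p \<in> B \<Longrightarrow> f (act1 k p) = act (r * k) (f p)"
    and T: "T = {p\<in>X. \<exists>k. dist (fst p) (act k c) \<le> \<delta> / 4}"
  shows "\<exists>g. closed (B \<union> T) \<and> (\<forall>k. \<forall>p \<in> B \<union> T. act1 k p \<in> B \<union> T) \<and>
    continuous_on (B \<union> T) g \<and> g ` (B \<union> T) \<subseteq> S \<and>
    (\<forall>k. \<forall>p \<in> B \<union> T. g (act1 k p) = act (r * k) (g p)) \<and> (\<forall>p\<in>B. g p = f p)"
proof -
  define P where "P = {p\<in>X. dist (fst p) c \<le> \<delta>/4}"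
  have Pc: "closed P"
  proof -
    have "P = X \<inter> {p. dist (fst p) c \<le> \<delta>/4}" by (auto simp: P_def)
    moreover have "closed (X \<inter> {p. dist (fst p) c \<le> \<delta>/4})" using compact_imp_closed[OF X(1)]
      by (intro closed_Int closed_Collect_le continuous_on_dist continuous_on_fst continuous_on_id continuous_on_const)
    ultimately show ?thesis by simp
  qed
  have PX: "P \<subseteq> X" by (auto simp: P_def)
  have Pcomp: "compact P" using Pc PX X(1) by (metis compact_Int_closed inf.absorb2)
  obtain g' where g': "continuous_on P g'" "g' ` P \<subseteq> S" "\<And>p. p \<in> B \<inter> P \<Longrightarrow> g' p = f p"
    using extend_map_into_sphere[OF Pcomp low_dim_subset[OF X(2) PX] X(3), of "B \<inter> P" f]
      closed_Int[OF B(1) Pc] continuous_on_subset[OF f(1), of "B \<inter> P"] f(2) by blast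
  define g where "g = (\<lambda>p. if p \<in> B then f p else (let k = SOME k. act1 (-k) p \<in> P in act (r * k) (g' (act1 (-k) p))))"
  \<comment> \<open>Independence of the chosen translate: two exponents that move p into P differ by
    a multiple of m, and so do their multiples by r.\<close>
  have key: "g p = act (r * k) (g' (act1 (-k) p))" if p: "act1 (-k) p \<in> P" for p k
  proof (cases "p \<in> B")
    case True
    then have "act1 (-k) p \<in> B" by (rule B(3))
    then have "g' (act1 (-k) p) = act (r * (-k)) (f p)" using g'(3) p f(3)[OF True, of "-k"] by auto
    then show ?thesis using True by (simp add: g_def)
  next
    case False
    define l where "l = (SOME k. act1 (-k) p \<in> P)"
    have l: "act1 (-l) p \<in> P" unfolding l_def using p by (rule someI)
    have pS: "act (-k) (fst p) \<in> S" using p PX X(4) by force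
    have "dist (act (-k) (fst p)) (act (k - l) (act (-k) (fst p))) \<le> dist (act (-k) (fst p)) c + dist (act (-l) (fst p)) c"
      using dist_triangle2[of "act (-k) (fst p)" "act (-l) (fst p)" c] by simp
    also have "\<dots> \<le> \<delta>/4 + \<delta>/4" using p l unfolding P_def by (intro add_mono) auto
    also have "\<dots> < \<delta>" using sep(1) by simp
    finally have dv: "int m dvd k - l" using sep(2)[OF pS] by blast
    then have e1: "act1 (-k) p = act1 (-l) p" unfolding act1_def
      using act_cong[of "-k" "-l" "fst p"] by (simp add: dvd_diff_commute)
    have "int m dvd r * k - r * l" using dv by (simp flip: right_diff_distrib)
    then have e2: "act (r * k) z = act (r * l) z" for z by (rule act_cong)
    show ?thesis using False e1 e2 by (simp add: g_def flip: l_def)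
  qed
  have gB: "g p = f p" if "p \<in> B" for p using that by (simp add: g_def)
  \<comment> \<open>Reducing exponents modulo m leaves finitely many closed translates, so
    closedness and continuity can be checked piecewise.\<close>
  have Tk: "T = (\<Union>k\<in>{0..<int m}. {p. act1 (-k) p \<in> P})"
  proof
    show "T \<subseteq> (\<Union>k\<in>{0..<int m}. {p. act1 (-k) p \<in> P})"
    proof
      fix p assume "p \<in> T"
      then obtain k where k: "p \<in> X" "dist (fst p) (act k c) \<le> \<delta>/4" unfolding T by blast
      define k' where "k' = k mod int m"
      have "dist (act (-k') (fst p)) c \<le> \<delta>/4" using k(2) by (simp add: dist_act_shift k'_def act_mod)
      then have "act1 (-k') p \<in> P" using X(5)[OF k(1)] by (simp add: P_def)
      moreover have "k' \<in> {0..<int m}" using m0 by (simp add: k'_def)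
      ultimately show "p \<in> (\<Union>k\<in>{0..<int m}. {p. act1 (-k) p \<in> P})" by blast
    qed
    show "(\<Union>k\<in>{0..<int m}. {p. act1 (-k) p \<in> P}) \<subseteq> T"
    proof clarify
      fix p1 p2 k assume "act1 (-k) (p1,p2) \<in> P"
      then have "(p1,p2) \<in> X" "dist p1 (act k c) \<le> \<delta>/4"
        using X(5)[of "act1 (-k) (p1,p2)" k] by (auto simp: P_def dist_act_shift)
      then show "(p1,p2) \<in> T" unfolding T by force
    qed
  qed
  have pieces: "closed {p. act1 (-k) p \<in> P}" "continuous_on {p. act1 (-k) p \<in> P} g" for k
  proof -
    show "closed {p. act1 (-k) p \<in> P}"
      using closed_vimage[OF Pc, of "act1 (-k)"] continuous_on_act1[OF continuous_on_id, of UNIV "-k"]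
      by (simp add: vimage_def)
    have "continuous_on {p. act1 (-k) p \<in> P} (\<lambda>p. act (r * k) (g' (act1 (-k) p)))"
      by (intro continuous_intros continuous_on_compose2[OF g'(1)]) auto
    then show "continuous_on {p. act1 (-k) p \<in> P} g"
      by (rule continuous_on_eq) (use key in auto)
  qed
  have Tcl: "closed T" unfolding Tk using pieces(1) by (intro closed_UN) auto
  have Tinv: "act1 k p \<in> T" if pT: "p \<in> T" for k p
  proof -
    obtain l where l: "p \<in> X" "dist (fst p) (act l c) \<le> \<delta>/4" using pT unfolding T by blast
    then have "dist (fst (act1 k p)) (act (k + l) c) \<le> \<delta>/4" by (simp flip: act_act)
    then show ?thesis using X(5)[OF l(1)] unfolding T by blast
  qed
  show ?thesis
  proof (intro exI[of _ g] conjI allI ballI)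
    show "closed (B \<union> T)" using B(1) Tcl by blast
    show "act1 k p \<in> B \<union> T" if "p \<in> B \<union> T" for k p using that B(3) Tinv by blast
    have "continuous_on T g" unfolding Tk by (intro continuous_on_closed_Union pieces) auto
    moreover have "continuous_on B g" using f(1) by (rule continuous_on_eq) (simp add: gB)
    ultimately show "continuous_on (B \<union> T) g" using B(1) Tcl by (intro continuous_on_closed_Un)
    show "g ` (B \<union> T) \<subseteq> S"
    proof clarify
      fix p1 p2 assume "(p1,p2) \<in> B \<union> T"
      then show "g (p1,p2) \<in> S"
      proof
        assume "(p1,p2) \<in> B" then show ?thesis using gB f(2) by auto
      next
        assume "(p1,p2) \<in> T"
        then obtain k where k: "act1 (-k) (p1,p2) \<in> P" unfolding Tk by blast
        show ?thesis unfolding key[OF k] using g'(2) k by auto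
      qed
    qed
    show "g (act1 k p) = act (r * k) (g p)" if pBT: "p \<in> B \<union> T" for k p
    proof (cases "p \<in> B")
      case True
      then show ?thesis using gB B(3) f(3) by simp
    next
      case False
      then obtain l where l: "act1 (-l) p \<in> P" using pBT unfolding Tk by blast
      then have "act1 (-(k+l)) (act1 k p) \<in> P" by simp
      from key[OF this] key[OF l] show ?thesis by (simp add: distrib_left)
    qed
  qed (use gB in auto)
qed

text \<open>Cover \<open>X\<close> by finitely many pieces that are disjoint from their translates and extend
  over one orbit of pieces after the other.\<close>

proposition equivariant_extension:
  fixes f :: "(nat \<Rightarrow> complex) \<times> real \<Rightarrow> nat \<Rightarrow> complex"
  assumes X: "compact X" "low_dim d X" "d \<le> 2 * n + 1" "fst ` X \<subseteq> S" "\<And>k p. p \<in> X \<Longrightarrow> act1 k p \<in> X"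
    and B: "closed B" "B \<subseteq> X" "\<And>k p. p \<in> B \<Longrightarrow> act1 k p \<in> B"
    and f: "continuous_on B f" "f ` B \<subseteq> S" "\<And>k p. p \<in> B \<Longrightarrow> f (act1 k p) = act (r * k) (f p)"
  obtains g where "continuous_on X g" "g ` X \<subseteq> S" "\<And>k p. p \<in> X \<Longrightarrow> g (act1 k p) = act (r * k) (g p)"
    "\<And>p. p \<in> B \<Longrightarrow> g p = f p"
proof -
  obtain \<delta> where sep: "\<delta> > 0" "\<And>z k. z \<in> S \<Longrightarrow> dist z (act k z) < \<delta> \<Longrightarrow> int m dvd k"
    using act_separated by metis
  define T where "T = (\<lambda>c. {p\<in>X. \<exists>k. dist (fst p) (act k c) \<le> \<delta> / 4})"
  define Q where "Q = (\<lambda>B' g. closed B' \<and> (\<forall>k. \<forall>p \<in> B'. act1 k p \<in> B') \<and>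
    continuous_on B' g \<and> g ` B' \<subseteq> S \<and> (\<forall>k. \<forall>p \<in> B'. g (act1 k p) = act (r * k) (g p)) \<and> (\<forall>p\<in>B. g p = f p))"
  have main: "\<exists>g. Q (B \<union> (\<Union>c\<in>C. T c)) g" if "finite C" for C
    using that
  proof (induction C rule: finite_induct)
    case empty
    show ?case using B f unfolding Q_def by (intro exI[of _ f]) auto
  next
    case (insert c C)
    define B' where "B' = B \<union> (\<Union>c\<in>C. T c)"
    obtain g where "Q B' g" using insert.IH unfolding B'_def by blast
    then have g: "closed B'" "\<And>k p. p \<in> B' \<Longrightarrow> act1 k p \<in> B'"
      "continuous_on B' g" "g ` B' \<subseteq> S" "\<And>k p. p \<in> B' \<Longrightarrow> g (act1 k p) = act (r * k) (g p)" "\<And>p. p \<in> B \<Longrightarrow> g p = f p"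
      unfolding Q_def by simp_all
    have B'X: "B' \<subseteq> X" using B(2) by (auto simp: B'_def T_def)
    have Tc: "T c = {p\<in>X. \<exists>k. dist (fst p) (act k c) \<le> \<delta> / 4}" by (simp add: T_def)
    have "\<exists>h. closed (B' \<union> T c) \<and> (\<forall>k. \<forall>p \<in> B' \<union> T c. act1 k p \<in> B' \<union> T c) \<and>
      continuous_on (B' \<union> T c) h \<and> h ` (B' \<union> T c) \<subseteq> S \<and>
      (\<forall>k. \<forall>p \<in> B' \<union> T c. h (act1 k p) = act (r * k) (h p)) \<and> (\<forall>p\<in>B'. h p = g p)"
      by (rule equivariant_extension_step[where \<delta> = \<delta> and X = X and d = d and c = c]) (fact sep X B'X g Tc)+
    then obtain h where h: "closed (B' \<union> T c)" "\<forall>k. \<forall>p \<in> B' \<union> T c. act1 k p \<in> B' \<union> T c"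
    "continuous_on (B' \<union> T c) h" "h ` (B' \<union> T c) \<subseteq> S" "\<forall>k. \<forall>p \<in> B' \<union> T c. h (act1 k p) = act (r * k) (h p)"
    "\<forall>p \<in> B'. h p = g p" by (elim exE conjE) (rule that)
    have eq: "B \<union> (\<Union>c\<in>insert c C. T c) = B' \<union> T c" by (auto simp: B'_def)
    have "\<forall>p\<in>B. h p = f p" using h(6) g(6) by (auto simp: B'_def)
    with h have "Q (B' \<union> T c) h" unfolding Q_def by simp
    then show ?case unfolding eq by blast
  qed
  have "S \<subseteq> (\<Union>c\<in>S. ball c (\<delta>/4))" using sep(1) by force
  then obtain C where C: "C \<subseteq> S" "finite C" "S \<subseteq> (\<Union>c\<in>C. ball c (\<delta>/4))"
    using compactE_image[OF compact_complex_sphere, of S "\<lambda>c. ball c (\<delta>/4)"] by (metis open_ball)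
  have "X \<subseteq> (\<Union>c\<in>C. T c)"
  proof
    fix p assume p: "p \<in> X"
    then obtain c where "c \<in> C" "dist c (fst p) < \<delta>/4" using C(3) X(4) by force
    then have "dist (fst p) (act 0 c) \<le> \<delta>/4" by (simp add: dist_commute)
    then show "p \<in> (\<Union>c\<in>C. T c)" using p \<open>c \<in> C\<close> unfolding T_def by blast
  qed
  then have "B \<union> (\<Union>c\<in>C. T c) = X" using B(2) by (auto simp: T_def)
  then obtain g where "Q X g" using main[OF C(2)] by metis
  then show thesis using that[of g] unfolding Q_def by blast
qed

end

section \<open>The covering of the lens space by the sphere\<close>

context lens
begin

abbreviation L :: "(nat \<Rightarrow> complex) set topology" where "L \<equiv> lens_space n m q"
abbreviation \<pi> :: "(nat \<Rightarrow> complex) \<Rightarrow> (nat \<Rightarrow> complex) set" where "\<pi> \<equiv> lens_orbit m q"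

lemma lens_gen_pow: "(lens_gen m q ^^ k) z = act (int k) z"
proof -
  have "exp (2 * of_real pi * \<i> * of_int a / of_nat m) ^ k = cis (2 * pi * of_int (a * int k) / real m)" for a
  proof -
    have "exp (2 * of_real pi * \<i> * of_int a / of_nat m) = cis (2 * pi * of_int a / real m)"
      unfolding cis_conv_exp by (rule arg_cong[where f = exp]) simp
    then have "exp (2 * of_real pi * \<i> * of_int a / of_nat m) ^ k = cis (real k * (2 * pi * of_int a / real m))"
      by (simp only: Complex.DeMoivre)
    also have "real k * (2 * pi * of_int a / real m) = 2 * pi * of_int (a * int k) / real m" by simp
    finally show ?thesis .
  qed
  then show ?thesis unfolding lens_gen_funpow act_def wt_def by (intro ext) simp
qed

lemma orbit_eq: "\<pi> z = range (\<lambda>k. act k z)"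
proof
  show "\<pi> z \<subseteq> range (\<lambda>k. act k z)" unfolding lens_orbit_def lens_gen_pow by blast
  show "range (\<lambda>k. act k z) \<subseteq> \<pi> z"
  proof clarify
    fix k
    have "act k z = act (int (nat (k mod int m))) z" using m0 by (simp add: act_mod)
    then show "act k z \<in> \<pi> z" unfolding lens_orbit_def lens_gen_pow by blast
  qed
qed

lemma orbit_eq_iff: "\<pi> z = \<pi> w \<longleftrightarrow> (\<exists>k. w = act k z)"
proof
  assume "\<pi> z = \<pi> w"
  moreover have "w \<in> \<pi> w" unfolding orbit_eq by (metis act_0 rangeI)
  ultimately show "\<exists>k. w = act k z" unfolding orbit_eq by blast
next
  assume "\<exists>k. w = act k z"
  then obtain k where k: "w = act k z" by blast
  have "range (\<lambda>l. act l w) = range (\<lambda>l. act l z)"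
  proof
    show "range (\<lambda>l. act l w) \<subseteq> range (\<lambda>l. act l z)" using k by auto
    show "range (\<lambda>l. act l z) \<subseteq> range (\<lambda>l. act l w)"
    proof clarify
      fix l
      have "act l z = act (l - k) w" using k by simp
      then show "act l z \<in> range (\<lambda>l. act l w)" by blast
    qed
  qed
  then show "\<pi> z = \<pi> w" by (simp add: orbit_eq)
qed

lemma orbit_act [simp]: "\<pi> (act k z) = \<pi> z"
  using orbit_eq_iff by metis

lemma topspace_L [simp]: "topspace L = \<pi> ` S"
  by (simp add: lens_space_def)

lemma quotient_map_orbit: "quotient_map (top_of_set S) L \<pi>"
  unfolding lens_space_def by (rule quotient_map_quotient_topology)

lemma continuous_map_orbit: "continuous_map (top_of_set S) L \<pi>"
  by (rule quotient_imp_continuous_map[OF quotient_map_orbit])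

lemma continuous_map_orbit_compose:
  "continuous_on K f \<Longrightarrow> f ` K \<subseteq> S \<Longrightarrow> continuous_map (top_of_set K) L (\<lambda>x. \<pi> (f x))"
  using continuous_map_compose[OF _ continuous_map_orbit, of "top_of_set K" f]
  by (simp add: o_def image_subset_iff_funcset)

section \<open>Openness of the projection and lifting of homotopies\<close>

lemma openin_orbit_image:
  assumes "openin (top_of_set S) U"
  shows "openin L (\<pi> ` U)"
proof -
  have US: "U \<subseteq> S" using openin_subset[OF assms] by simp
  have "{x \<in> topspace (top_of_set S). \<pi> x \<in> \<pi> ` U} = (\<Union>k. {x \<in> S. act k x \<in> U})"
  proof safe
    fix x u assume "x \<in> topspace (top_of_set S)" "\<pi> x = \<pi> u" "u \<in> U"
    then show "x \<in> (\<Union>k. {x \<in> S. act k x \<in> U})" by (auto simp: orbit_eq_iff)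
  next
    fix x k assume "x \<in> S" "act k x \<in> U"
    then show "\<pi> x \<in> \<pi> ` U" by (metis imageI orbit_act)
  qed simp
  moreover have "openin (top_of_set S) {x \<in> S. act k x \<in> U}" for k
  proof -
    have "openin (top_of_set S) (S \<inter> act k -` U)"
      by (rule continuous_openin_preimage[OF continuous_on_act[OF continuous_on_id] _ assms]) auto
    then show ?thesis by (simp add: vimage_def Int_def)
  qed
  ultimately have "openin (top_of_set S) {x \<in> topspace (top_of_set S). \<pi> x \<in> \<pi> ` U}" by auto
  then show ?thesis unfolding lens_space_def openin_quotient_topology using US by auto
qed

text \<open>The value G x is the only lift of F x within \<delta>/2 of G0 x, because two such lifts
  are less than \<delta> apart. Openness of the projection turns this uniqueness into
  continuity.\<close>

lemma near_lift:
  fixes K :: "'k::metric_space set"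
  assumes sep: "\<And>z k. z \<in> S \<Longrightarrow> dist z (act k z) < \<delta> \<Longrightarrow> int m dvd k"
    and F: "continuous_map (top_of_set K) L F" and G0: "continuous_on K G0"
    and near: "\<And>x. x \<in> K \<Longrightarrow> \<exists>w\<in>S. \<pi> w = F x \<and> dist (G0 x) w < \<delta> / 2"
  shows "\<exists>G. continuous_on K G \<and> (\<forall>x\<in>K. G x \<in> S \<and> \<pi> (G x) = F x \<and> dist (G0 x) (G x) < \<delta> / 2)"
proof -
  obtain G where G: "\<And>x. x \<in> K \<Longrightarrow> G x \<in> S \<and> \<pi> (G x) = F x \<and> dist (G0 x) (G x) < \<delta> / 2"
    using near by metis
  have uniq: "w = G x" if x: "x \<in> K" and w: "w \<in> S" "\<pi> w = F x" "dist (G0 x) w < \<delta> / 2" for x w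
  proof -
    have "\<pi> (G x) = \<pi> w" using G[OF x] w by simp
    then obtain k where k: "w = act k (G x)" using orbit_eq_iff by blast
    have "dist (G x) w < \<delta>" using dist_triangle2[of "G x" w "G0 x"] G[OF x] w(3) by (simp add: dist_commute)
    then have "int m dvd k" using sep[of "G x" k] G[OF x] k by simp
    then show ?thesis using k act_dvd by simp
  qed
  have "continuous_on K G"
    unfolding continuous_on_iff
  proof (intro ballI allI impI)
    fix x0 and e :: real assume x0: "x0 \<in> K" and e: "e > 0"
    \<comment> \<open>Half of the slack at x0: an error \<rho> in G0 and another \<rho> in w still
      leave w within \<delta>/2 of G0 x.\<close>
    define \<rho> where "\<rho> = (\<delta>/2 - dist (G0 x0) (G x0)) / 2"
    have rho: "\<rho> > 0" using G[OF x0] by (simp add: \<rho>_def)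
    define V where "V = S \<inter> ball (G x0) (min e \<rho>)"
    have "openin (top_of_set S) V" unfolding V_def by (simp add: openin_open_Int)
    then have "openin L (\<pi> ` V)" by (rule openin_orbit_image)
    then have "openin (top_of_set K) {x \<in> K. F x \<in> \<pi> ` V}"
      using openin_continuous_map_preimage[OF F] by simp
    moreover have "x0 \<in> {x \<in> K. F x \<in> \<pi> ` V}"
    proof -
      have "G x0 \<in> V" using G[OF x0] e rho by (simp add: V_def)
      then show ?thesis using G[OF x0] x0 by (metis (mono_tags, lifting) imageI mem_Collect_eq)
    qed
    ultimately obtain d1 where d1: "d1 > 0" "\<And>x. x \<in> K \<Longrightarrow> dist x x0 < d1 \<Longrightarrow> F x \<in> \<pi> ` V"
      unfolding openin_euclidean_subtopology_iff by blast
    obtain d2 where d2: "d2 > 0" "\<And>x. x \<in> K \<Longrightarrow> dist x x0 < d2 \<Longrightarrow> dist (G0 x) (G0 x0) < \<rho>"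
      using G0 x0 rho unfolding continuous_on_iff by blast
    show "\<exists>d>0. \<forall>x\<in>K. dist x x0 < d \<longrightarrow> dist (G x) (G x0) < e"
    proof (intro exI[of _ "min d1 d2"] conjI ballI impI)
      show "min d1 d2 > 0" using d1 d2 by simp
      fix x assume x: "x \<in> K" "dist x x0 < min d1 d2"
      then obtain w where w: "w \<in> V" "F x = \<pi> w" using d1(2)[of x] by auto
      have "dist (G0 x) w \<le> dist (G0 x) (G0 x0) + (dist (G0 x0) (G x0) + dist (G x0) w)"
        by (meson add_left_mono dist_triangle order_trans)
      also have "\<dots> < \<rho> + (dist (G0 x0) (G x0) + \<rho>)"
        using d2(2)[of x] x w(1) by (intro add_strict_mono add_strict_left_mono) (auto simp: V_def)
      also have "\<dots> = \<delta> / 2" by (simp add: \<rho>_def field_simps)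
      finally have "w = G x" using uniq[OF x(1)] w by (simp add: V_def)
      then show "dist (G x) (G x0) < e" using w(1) by (simp add: V_def dist_commute)
    qed
  qed
  with G show ?thesis by blast
qed

lemma continuous_map_from_subset:
  "continuous_map (top_of_set K) Y F \<Longrightarrow> K' \<subseteq> K \<Longrightarrow> continuous_map (top_of_set K') Y F"
  by (rule continuous_map_from_subtopology_mono)

text \<open>Only the interval is subdivided. At each step the lift at the last time is an
  approximate lift over the whole of K, so K may be any compact metric space.\<close>

proposition lift_homotopy:
  fixes K :: "'k::metric_space set"
  assumes K: "compact K" and F: "continuous_map (top_of_set (K \<times> {0..1::real})) L F"
    and G0: "continuous_on K G0" "\<And>x. x \<in> K \<Longrightarrow> G0 x \<in> S" "\<And>x. x \<in> K \<Longrightarrow> \<pi> (G0 x) = F (x, 0)"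
  shows "\<exists>G. continuous_on (K \<times> {0..1}) G \<and> (\<forall>x\<in>K. G (x, 0) = G0 x) \<and>
    (\<forall>p\<in>K \<times> {0..1}. G p \<in> S \<and> \<pi> (G p) = F p)"
proof -
  obtain \<delta> where sep: "\<delta> > 0" "\<And>z k. z \<in> S \<Longrightarrow> dist z (act k z) < \<delta> \<Longrightarrow> int m dvd k"
    using act_separated by metis
  have FL: "F p \<in> \<pi> ` S" if "p \<in> K \<times> {0..1}" for p
    using continuous_map_image_subset_topspace[OF F] that by auto
  \<comment> \<open>A Lebesgue number of this cover bounds the time step: within it F stays in the
    image of one ball of radius \<delta>/4, so some lift of the new value lies within \<delta>/2 of
    the old one.\<close>
  define \<G> where "\<G> = {T. open T \<and> (\<exists>z\<in>S. \<forall>p \<in> T \<inter> (K \<times> {0..1}). F p \<in> \<pi> ` (S \<inter> ball z (\<delta>/4)))}"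
  have "K \<times> {0..1} \<subseteq> \<Union>\<G>"
  proof
    fix p assume p: "p \<in> K \<times> {0..1::real}"
    obtain z where z: "z \<in> S" "F p = \<pi> z" using FL[OF p] by blast
    have "openin L (\<pi> ` (S \<inter> ball z (\<delta>/4)))" by (intro openin_orbit_image openin_open_Int) simp
    then have "openin (top_of_set (K \<times> {0..1})) {p \<in> K \<times> {0..1}. F p \<in> \<pi> ` (S \<inter> ball z (\<delta>/4))}"
      using openin_continuous_map_preimage[OF F] by simp
    then obtain T where T: "open T" "{p \<in> K \<times> {0..1}. F p \<in> \<pi> ` (S \<inter> ball z (\<delta>/4))} = K \<times> {0..1} \<inter> T"
      unfolding openin_open by blast
    have "F p \<in> \<pi> ` (S \<inter> ball z (\<delta>/4))" using z sep(1) by auto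
    then have "p \<in> T" using T(2) p by blast
    moreover have "T \<in> \<G>" unfolding \<G>_def using T z(1) by blast
    ultimately show "p \<in> \<Union>\<G>" by blast
  qed
  moreover have "\<And>T. T \<in> \<G> \<Longrightarrow> open T" by (simp add: \<G>_def)
  ultimately obtain e where e: "e > 0" "\<forall>p\<in>K \<times> {0..1}. \<exists>T\<in>\<G>. ball p e \<subseteq> T"
    using Heine_Borel_lemma[OF compact_Times[OF K compact_Icc]] by metis
  have step: "\<exists>w\<in>S. \<pi> w = F (x, t') \<and> dist z w < \<delta> / 2"
    if x: "x \<in> K" and t: "t \<in> {0..1}" "t' \<in> {0..1}" "\<bar>t - t'\<bar> < e" and z: "z \<in> S" "\<pi> z = F (x, t)" for x t t' z
  proof -
    have "(x,t) \<in> K \<times> {0..1}" using x t by simp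
    then obtain T where T: "T \<in> \<G>" "ball (x,t) e \<subseteq> T" using e(2) by blast
    then obtain c where c: "c \<in> S" "\<And>p. p \<in> T \<inter> (K \<times> {0..1}) \<Longrightarrow> F p \<in> \<pi> ` (S \<inter> ball c (\<delta>/4))"
      unfolding \<G>_def by blast
    have "(x,t) \<in> T" "(x,t') \<in> T" using T(2) e(1) t by (auto simp: dist_Pair_Pair dist_real_def)
    then obtain v v' where v: "v \<in> S" "dist c v < \<delta>/4" "F (x,t) = \<pi> v" "v' \<in> S" "dist c v' < \<delta>/4" "F (x,t') = \<pi> v'"
      using c(2)[of "(x,t)"] c(2)[of "(x,t')"] x t by auto
    obtain k where k: "z = act k v" using z v orbit_eq_iff by metis
    have "dist z (act k v') < \<delta> / 2" using v(2,5) dist_triangle3[of v v' c] by (simp add: k)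
    then show ?thesis using v by (intro bexI[of _ "act k v'"]) auto
  qed
  obtain M :: nat where M: "M > 0" "1 / real M < e"
    using e(1) by (metis nat_approx_posE of_nat_0_less_iff zero_less_Suc)
  have "\<exists>G. continuous_on (K \<times> {0..real j / real M}) G \<and> (\<forall>x\<in>K. G (x, 0) = G0 x) \<and>
    (\<forall>p\<in>K \<times> {0..real j / real M}. G p \<in> S \<and> \<pi> (G p) = F p)" if "j \<le> M" for j
    using that
  proof (induction j)
    case 0
    show ?case
    proof (intro exI[of _ "\<lambda>p. G0 (fst p)"] conjI)
      show "continuous_on (K \<times> {0..real 0 / real M}) (\<lambda>p. G0 (fst p))"
        by (rule continuous_on_compose2[OF G0(1) continuous_on_fst[OF continuous_on_id]]) auto
    qed (use G0 in auto)
  next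
    case (Suc j)
    define a b where "a = real j / real M" and "b = real (Suc j) / real M"
    have ab: "0 \<le> a" "a \<le> b" "b \<le> 1" "b - a = 1 / real M"
      using Suc.prems M(1) by (auto simp: a_def b_def field_simps)
    obtain G where G: "continuous_on (K \<times> {0..a}) G" "\<forall>x\<in>K. G (x, 0) = G0 x" "\<forall>p\<in>K \<times> {0..a}. G p \<in> S \<and> \<pi> (G p) = F p"
      using Suc unfolding a_def by auto
    have cG: "continuous_on (K \<times> {a..b}) (\<lambda>p. G (fst p, a))"
      by (rule continuous_on_compose2[OF G(1)]) (use ab in \<open>auto intro!: continuous_intros\<close>)
    have Fab: "continuous_map (top_of_set (K \<times> {a..b})) L F"
      by (rule continuous_map_from_subset[OF F]) (use ab in auto)
    have nr: "\<And>p. p \<in> K \<times> {a..b} \<Longrightarrow> \<exists>w\<in>S. \<pi> w = F p \<and> dist (G (fst p, a)) w < \<delta> / 2"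
    proof -
      fix p assume p: "p \<in> K \<times> {a..b}"
      then show "\<exists>w\<in>S. \<pi> w = F p \<and> dist (G (fst p, a)) w < \<delta> / 2"
        using step[of "fst p" a "snd p" "G (fst p, a)"] ab G(3) M(2) by auto
    qed
    have "\<exists>H. continuous_on (K \<times> {a..b}) H \<and>
      (\<forall>p\<in>K \<times> {a..b}. H p \<in> S \<and> \<pi> (H p) = F p \<and> dist (G (fst p, a)) (H p) < \<delta> / 2)"
      by (rule near_lift) (fact sep Fab cG nr)+
    then obtain H where H: "continuous_on (K \<times> {a..b}) H"
      "\<forall>p\<in>K \<times> {a..b}. H p \<in> S \<and> \<pi> (H p) = F p \<and> dist (G (fst p, a)) (H p) < \<delta> / 2"
      by blast
    \<comment> \<open>On the common time slice both lifts lie in one orbit and are closer than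
      \<delta>, hence are equal.\<close>
    have agree: "H (x, a) = G (x, a)" if x: "x \<in> K" for x
    proof -
      have "\<pi> (G (x,a)) = \<pi> (H (x,a))" using H(2) G(3) x ab by simp
      then obtain k where k: "H (x,a) = act k (G (x,a))" using orbit_eq_iff by blast
      have "(x,a) \<in> K \<times> {a..b}" using x ab by simp
      then have "dist (G (x,a)) (H (x,a)) < \<delta> / 2" using H(2) by force
      then have "dist (G (x,a)) (act k (G (x,a))) < \<delta>" using k sep(1) by simp
      moreover have "G (x,a) \<in> S" using G(3) x ab by simp
      ultimately have "int m dvd k" by (rule sep(2)[rotated])
      then show ?thesis using k act_dvd by simp
    qed
    define H' where "H' = (\<lambda>p. if snd p \<le> a then G p else H p)"
    have "continuous_on (K \<times> {0..a}) H'" by (rule continuous_on_eq[OF G(1)]) (auto simp: H'_def)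
    moreover have "continuous_on (K \<times> {a..b}) H'" by (rule continuous_on_eq[OF H(1)]) (use agree in \<open>auto simp: H'_def\<close>)
    moreover have "closed (K \<times> {0..a})" "closed (K \<times> {a..b})"
      using compact_imp_closed[OF K] by (auto intro!: closed_Times)
    ultimately have "continuous_on (K \<times> {0..a} \<union> K \<times> {a..b}) H'" by (intro continuous_on_closed_Un)
    moreover have "K \<times> {0..a} \<union> K \<times> {a..b} = K \<times> {0..b}" using ab by auto
    ultimately have "continuous_on (K \<times> {0..b}) H'" by simp
    then show ?case unfolding b_def[symmetric]
      using G(2,3) H(2) ab by (intro exI[of _ H']) (auto simp: H'_def)
  qed
  from this[of M] M(1) show ?thesis by simp
qed

text \<open>The set where G' equals the translate of G by k is open and closed in K: a distance
  below \<delta> within one orbit forces equality.\<close>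

lemma lifts_differ_by_deck:
  fixes K :: "'k::topological_space set"
  assumes K: "connected K" and G: "continuous_on K G" "continuous_on K G'" "\<And>x. x \<in> K \<Longrightarrow> G x \<in> S"
    and eq: "\<And>x. x \<in> K \<Longrightarrow> \<pi> (G x) = \<pi> (G' x)" and x0: "x0 \<in> K" "G' x0 = act k (G x0)"
    and x: "x \<in> K"
  shows "G' x = act k (G x)"
proof -
  obtain \<delta> where sep: "\<delta> > 0" "\<And>z k. z \<in> S \<Longrightarrow> dist z (act k z) < \<delta> \<Longrightarrow> int m dvd k"
    using act_separated by metis
  define f where "f = (\<lambda>x. dist (act k (G x)) (G' x))"
  have cf: "continuous_on K f" unfolding f_def by (intro continuous_intros G)
  have zero: "f x = 0" if x: "x \<in> K" and lt: "f x < \<delta>" for x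
  proof -
    obtain l where l: "G' x = act l (G x)" using eq[OF x] orbit_eq_iff by blast
    have "dist (act k (G x)) (act (l - k) (act k (G x))) < \<delta>" using lt by (simp add: f_def l)
    then have "int m dvd l - k" using sep(2)[of "act k (G x)"] G(3)[OF x] by simp
    then show ?thesis using act_cong[of l k "G x"] by (simp add: f_def l)
  qed
  have "K \<inter> f -` {0} = K \<inter> f -` {..<\<delta>}" using zero sep(1) by auto
  moreover have "openin (top_of_set K) (K \<inter> f -` {..<\<delta>})" by (rule continuous_openin_preimage_gen[OF cf]) simp
  moreover have "closedin (top_of_set K) (K \<inter> f -` {0})" by (rule continuous_closedin_preimage[OF cf]) simp
  ultimately have "K \<inter> f -` {0} = {} \<or> K \<inter> f -` {0} = K" using K unfolding connected_clopen by auto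
  moreover have "x0 \<in> K \<inter> f -` {0}" using x0 by (simp add: f_def)
  ultimately have "x \<in> f -` {0}" using x by blast
  then show ?thesis by (simp add: f_def)
qed

text \<open>The contraction followed by F is a homotopy that starts at a constant map, so it lifts.
  Its end is a lift of F, and a deck transformation corrects the value at a.\<close>

lemma lift_from_contractible:
  fixes K :: "'k::metric_space set"
  assumes K: "compact K" and R: "continuous_on (K \<times> {0..1::real}) R" "R ` (K \<times> {0..1}) \<subseteq> K"
      "\<And>x. x \<in> K \<Longrightarrow> R (x, 0) = c" "\<And>x. x \<in> K \<Longrightarrow> R (x, 1) = x"
    and F: "continuous_map (top_of_set K) L F" and a: "a \<in> K" "b \<in> S" "\<pi> b = F a"
  shows "\<exists>G. continuous_on K G \<and> G a = b \<and> (\<forall>x\<in>K. G x \<in> S \<and> \<pi> (G x) = F x)"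
proof -
  have cK: "c \<in> K" using R(2,3) a by force
  have "F c \<in> \<pi> ` S" using continuous_map_image_subset_topspace[OF F] cK by auto
  then obtain b0 where b0: "b0 \<in> S" "\<pi> b0 = F c" by (metis imageE)
  have FR: "continuous_map (top_of_set (K \<times> {0..1})) L (F \<circ> R)"
    by (rule continuous_map_compose[OF _ F]) (use R in \<open>simp add: image_subset_iff_funcset\<close>)
  obtain G where G: "continuous_on (K \<times> {0..1}) G" "\<forall>p\<in>K \<times> {0..1}. G p \<in> S \<and> \<pi> (G p) = (F \<circ> R) p"
    using lift_homotopy[OF K FR, of "\<lambda>_. b0"] b0 R(3) by auto
  define G1 where "G1 = (\<lambda>x. G (x, 1))"
  have cG1: "continuous_on K G1" unfolding G1_def
    by (rule continuous_on_compose2[OF G(1)]) (auto intro!: continuous_intros)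
  have G1: "G1 x \<in> S" "\<pi> (G1 x) = F x" if "x \<in> K" for x using G(2) R(4) that by (auto simp: G1_def)
  obtain k where k: "b = act k (G1 a)" using a G1(2)[OF a(1)] orbit_eq_iff by metis
  show ?thesis
    by (intro exI[of _ "\<lambda>x. act k (G1 x)"] conjI continuous_on_act cG1) (use k G1 in auto)
qed

text \<open>The sphere is the union of two contractible hemispheres. Since n >= 1, the equator Re
  z_0 = 0 is connected, so the two lifts differ on it by a single deck transformation and can be
  matched.\<close>

lemma lift_from_sphere:
  assumes F: "continuous_map (top_of_set S) L F" and a: "a \<in> S" "b \<in> S" "\<pi> b = F a"
  shows "\<exists>G. continuous_on S G \<and> G a = b \<and> (\<forall>x\<in>S. G x \<in> S \<and> \<pi> (G x) = F x)"
proof -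
  have hemi: "\<exists>G. continuous_on (S \<inter> {z. s * Re (z 0) \<ge> 0}) G \<and> (\<forall>x\<in>S \<inter> {z. s * Re (z 0) \<ge> 0}. G x \<in> S \<and> \<pi> (G x) = F x)"
    if s: "s = 1 \<or> s = -1" for s :: real
  proof -
    define H where "H = S \<inter> {z. s * Re (z 0) \<ge> 0}"
    define e where "e = unit_vec 0 (of_real s)"
    have eS: "e \<in> S" unfolding e_def by (rule unit_vec_in_sphere) (use s in auto)
    have e0: "e 0 = of_real s" by (simp add: e_def unit_vec_def)
    have ss: "s * s = 1" using s by auto
    have HS: "H \<subseteq> S" by (simp add: H_def)
    have "closed {z::nat \<Rightarrow> complex. s * Re (z 0) \<ge> 0}"
      by (intro closed_Collect_le continuous_on_const continuous_on_mult continuous_on_Re continuous_on_coord[OF continuous_on_id])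
    then have Hc: "compact H" unfolding H_def by (intro compact_Int_closed compact_complex_sphere)
    have ne: "\<not> (\<forall>j. z j = - e j)" if "z \<in> H" for z
    proof
      assume "\<forall>j. z j = - e j"
      then have "s * Re (z 0) = -1" using e0 ss by simp
      with that show False by (simp add: H_def)
    qed
    define R where "R = (\<lambda>(z,t). sseg n e z t)"
    have "\<exists>G. continuous_on H G \<and> G e = (SOME b. b \<in> S \<and> \<pi> b = F e) \<and> (\<forall>x\<in>H. G x \<in> S \<and> \<pi> (G x) = F x)"
    proof (rule lift_from_contractible[where R = R and c = e])
      show "compact H" by fact
      show "continuous_on (H \<times> {0..1}) R" unfolding R_def case_prod_unfold
        by (intro continuous_on_sseg continuous_intros) (use eS HS ne in auto)
      show "R ` (H \<times> {0..1}) \<subseteq> H"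
      proof clarify
        fix z and t :: real assume z: "z \<in> H" and t: "t \<in> {0..1}"
        have "sseg n e z t \<in> S" using z t eS HS ne by (intro sseg_in_sphere) auto
        moreover have "s * Re (sseg n e z t 0) \<ge> 0"
        proof -
          have "s * Re (sseg n e z t 0) = ((1-t) * (s * s) + t * (s * Re (z 0))) / cnorm n (\<lambda>j. of_real (1 - t) * e j + of_real t * z j)"
            by (simp add: sseg_def normalise_def e0 algebra_simps add_divide_distrib diff_divide_distrib)
          also have "\<dots> \<ge> 0" using t z ss by (intro divide_nonneg_nonneg) (auto simp: H_def)
          finally show ?thesis .
        qed
        ultimately show "R (z, t) \<in> H" by (simp add: R_def H_def)
      qed
      show "R (x, 0) = e" if "x \<in> H" for x using eS by (simp add: R_def)
      show "R (x, 1) = x" if "x \<in> H" for x using HS that by (auto simp: R_def)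
      show "continuous_map (top_of_set H) L F" by (rule continuous_map_from_subset[OF F HS])
      show "e \<in> H" using eS e0 ss by (simp add: H_def)
      have "F e \<in> \<pi> ` S" using continuous_map_image_subset_topspace[OF F] eS by auto
      then have "\<exists>b. b \<in> S \<and> \<pi> b = F e" by force
      from someI_ex[OF this] show "(SOME b. b \<in> S \<and> \<pi> b = F e) \<in> S" "\<pi> (SOME b. b \<in> S \<and> \<pi> b = F e) = F e" by blast+
    qed
    then show ?thesis unfolding H_def by blast
  qed
  define P where "P = S \<inter> {z. 1 * Re (z 0) \<ge> 0}"
  define N where "N = S \<inter> {z. (-1) * Re (z 0) \<ge> 0}"
  obtain G1 where G1: "continuous_on P G1" "\<And>x. x \<in> P \<Longrightarrow> G1 x \<in> S" "\<And>x. x \<in> P \<Longrightarrow> \<pi> (G1 x) = F x"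
    using hemi[of 1] unfolding P_def by blast
  obtain G2 where G2: "continuous_on N G2" "\<And>x. x \<in> N \<Longrightarrow> G2 x \<in> S" "\<And>x. x \<in> N \<Longrightarrow> \<pi> (G2 x) = F x"
    using hemi[of "-1"] unfolding N_def by blast
  have cl: "closed P" "closed N" unfolding P_def N_def
    by (intro closed_Int closed_complex_sphere closed_Collect_le continuous_on_const continuous_on_mult continuous_on_Re continuous_on_coord[OF continuous_on_id])+
  have E: "S \<inter> {z. Re (z 0) = 0} = P \<inter> N" by (auto simp: P_def N_def)
  have conE: "connected (P \<inter> N)" using connected_complex_equator[OF n1] E by simp
  have eE: "unit_vec 0 \<i> \<in> P \<inter> N" unfolding E[symmetric] by (simp add: unit_vec_in_sphere) (simp add: unit_vec_def)
  obtain k where k: "G1 (unit_vec 0 \<i>) = act k (G2 (unit_vec 0 \<i>))" using G1(3) G2(3) eE orbit_eq_iff by (metis IntD1 IntD2)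
  have agree: "G1 x = act k (G2 x)" if "x \<in> P \<inter> N" for x
    by (rule lifts_differ_by_deck[OF conE continuous_on_subset[OF G2(1)] continuous_on_subset[OF G1(1)] _ _ eE k that])
      (use G1 G2 in auto)
  define G where "G = (\<lambda>x. if x \<in> P then G1 x else act k (G2 x))"
  have "continuous_on P G" by (rule continuous_on_eq[OF G1(1)]) (simp add: G_def)
  moreover have "continuous_on N G" by (rule continuous_on_eq[OF continuous_on_act[OF G2(1)]]) (use agree in \<open>auto simp: G_def\<close>)
  ultimately have "continuous_on (P \<union> N) G" using cl by (intro continuous_on_closed_Un)
  moreover have PN: "P \<union> N = S" by (auto simp: P_def N_def)
  ultimately have cG: "continuous_on S G" by simp
  have G: "G x \<in> S" "\<pi> (G x) = F x" if "x \<in> S" for x using that G1(2,3) G2(2,3) PN by (auto simp: G_def)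
  obtain l where l: "b = act l (G a)" using a G(2)[OF a(1)] orbit_eq_iff by metis
  show ?thesis
    by (intro exI[of _ "\<lambda>x. act l (G x)"] conjI continuous_on_act cG) (use l G in auto)
qed

text \<open>G and its composite with the generator lift the same map, hence differ by one deck
  exponent r everywhere. This r records the effect of f on the fundamental group.\<close>

lemma lift_self_map:
  assumes f: "continuous_map L L f" and a: "a \<in> S" "b \<in> S" "f (\<pi> a) = \<pi> b"
  shows "\<exists>G r. continuous_on S G \<and> G ` S \<subseteq> S \<and> G a = b \<and> (\<forall>x\<in>S. \<pi> (G x) = f (\<pi> x)) \<and>
    (\<forall>k. \<forall>x\<in>S. G (act k x) = act (r * k) (G x))"
proof -
  have "continuous_map (top_of_set S) L (f \<circ> \<pi>)" by (rule continuous_map_compose[OF continuous_map_orbit f])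
  then obtain G where G: "continuous_on S G" "G a = b" "\<And>x. x \<in> S \<Longrightarrow> G x \<in> S" "\<And>x. x \<in> S \<Longrightarrow> \<pi> (G x) = f (\<pi> x)"
    using lift_from_sphere[of "f \<circ> \<pi>" a b] a by auto
  have "\<pi> (G a) = \<pi> (G (act 1 a))" using G(4) a by simp
  then obtain r where r: "G (act 1 a) = act r (G a)" using orbit_eq_iff by blast
  have r1: "G (act 1 x) = act r (G x)" if x: "x \<in> S" for x
  proof (rule lifts_differ_by_deck[where G = G and G' = "\<lambda>x. G (act 1 x)", OF connected_complex_sphere G(1) _ G(3) _ a(1) r x])
    show "continuous_on S (\<lambda>x. G (act 1 x))"
      by (rule continuous_on_compose2[OF G(1)]) (auto intro!: continuous_intros)
    show "\<pi> (G x) = \<pi> (G (act 1 x))" if "x \<in> S" for x using G(4) that by simp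
  qed
  have rn: "G (act (int k) x) = act (r * int k) (G x)" if "x \<in> S" for k :: nat and x
  proof (induction k)
    case (Suc k)
    have "G (act (int (Suc k)) x) = G (act 1 (act (int k) x))" by (simp add: add.commute)
    also have "\<dots> = act r (act (r * int k) (G x))" using r1[of "act (int k) x"] that Suc by simp
    also have "\<dots> = act (r * int (Suc k)) (G x)" by (simp add: algebra_simps)
    finally show ?case .
  qed simp
  have "G (act k x) = act (r * k) (G x)" if x: "x \<in> S" for k x
  proof -
    have "act k x = act (int (nat (k mod int m))) x" using m0 by (simp add: act_mod)
    then have "G (act k x) = act (r * (k mod int m)) (G x)" using rn[OF x, of "nat (k mod int m)"] m2 by simp
    also have "\<dots> = act (r * k) (G x)"
      by (rule act_cong) (simp add: mod_eq_dvd_iff[symmetric] mod_mult_right_eq)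
    finally show ?thesis .
  qed
  with G show ?thesis by blast
qed

section \<open>Passage of equivariant maps and homotopies to the lens space\<close>

definition desc :: "((nat \<Rightarrow> complex) \<Rightarrow> nat \<Rightarrow> complex) \<Rightarrow> (nat \<Rightarrow> complex) set \<Rightarrow> (nat \<Rightarrow> complex) set" where
  "desc G y = \<pi> (G (SOME z. z \<in> S \<and> \<pi> z = y))"

text \<open>Another choice of representative, moved by \<open>act k\<close>, changes the value of G
  by \<open>act (r * k)\<close>, which the projection forgets.\<close>

lemma desc_orbit:
  assumes eqv: "\<And>k z. z \<in> S \<Longrightarrow> G (act k z) = act (r * k) (G z)" and z: "z \<in> S"
  shows "desc G (\<pi> z) = \<pi> (G z)"
proof -
  define w where "w = (SOME w. w \<in> S \<and> \<pi> w = \<pi> z)"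
  have "w \<in> S \<and> \<pi> w = \<pi> z" unfolding w_def by (rule someI[of _ z]) (use z in simp)
  then obtain k where k: "w = act k z" using orbit_eq_iff[of z w] by metis
  have "desc G (\<pi> z) = \<pi> (G (act k z))" by (simp add: desc_def flip: w_def k)
  then show ?thesis using eqv[OF z, of k] by simp
qed

lemma continuous_map_desc:
  assumes eqv: "\<And>k z. z \<in> S \<Longrightarrow> G (act k z) = act (r * k) (G z)" and G: "continuous_on S G" "G ` S \<subseteq> S"
  shows "continuous_map L L (desc G)"
proof (rule continuous_compose_quotient_map[OF quotient_map_orbit])
  have "continuous_map (top_of_set S) L (\<lambda>z. \<pi> (G z))" by (rule continuous_map_orbit_compose[OF G])
  then show "continuous_map (top_of_set S) L (desc G \<circ> \<pi>)"
    by (rule continuous_map_eq) (use desc_orbit[of G r] eqv in auto)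
qed

text \<open>The interval is locally compact, so its product with the projection is again a quotient
  map and continuity can be tested upstairs. The base point has to be kept only modulo the
  action.\<close>

lemma homotopic_desc:
  assumes H: "continuous_on (S \<times> {0..1::real}) H" "H ` (S \<times> {0..1}) \<subseteq> S"
    and eqv: "\<And>k z t. z \<in> S \<Longrightarrow> t \<in> {0..1} \<Longrightarrow> H (act k z, t) = act (r * k) (H (z, t))"
    and f: "\<And>z. z \<in> S \<Longrightarrow> f (\<pi> z) = \<pi> (H (z, 0))" and g: "\<And>z. z \<in> S \<Longrightarrow> g (\<pi> z) = \<pi> (H (z, 1))"
    and x0: "a \<in> S" "\<And>t. t \<in> {0..1} \<Longrightarrow> \<pi> (H (a, t)) = \<pi> a"
  shows "homotopic_with (\<lambda>h. h ` {\<pi> a} \<subseteq> {\<pi> a}) L L f g"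
proof -
  define h where "h = (\<lambda>(t::real, y). \<pi> (H (SOME z. z \<in> S \<and> \<pi> z = y, t)))"
  have h: "h (t, \<pi> z) = \<pi> (H (z, t))" if z: "z \<in> S" and t: "t \<in> {0..1}" for z t
  proof -
    define w where "w = (SOME w. w \<in> S \<and> \<pi> w = \<pi> z)"
    have "w \<in> S \<and> \<pi> w = \<pi> z" unfolding w_def by (rule someI[of _ z]) (use z in simp)
    then obtain k where k: "w = act k z" using orbit_eq_iff[of z w] by metis
    have "h (t, \<pi> z) = \<pi> (H (act k z, t))" by (simp add: h_def flip: w_def k)
    then show ?thesis using eqv[OF z t, of k] by simp
  qed
  have qm: "quotient_map (prod_topology (top_of_set {0..1::real}) (top_of_set S)) (prod_topology (top_of_set {0..1}) L) (\<lambda>(t,z). (t, \<pi> z))"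
    by (rule quotient_map_prod_right[OF _ _ quotient_map_orbit])
      (auto simp: Hausdorff_space_subtopology compact_imp_locally_compact_space compact_space_subtopology)
  have ch: "continuous_map (prod_topology (top_of_set {0..1}) L) L h"
  proof (rule continuous_compose_quotient_map[OF qm])
    have "continuous_on ({0..1} \<times> S) (\<lambda>p. H (snd p, fst p))"
      by (rule continuous_on_compose2[OF H(1) continuous_on_Pair[OF continuous_on_snd[OF continuous_on_id] continuous_on_fst[OF continuous_on_id]]]) auto
    then have "continuous_map (top_of_set ({0..1} \<times> S)) L (\<lambda>p. \<pi> (H (snd p, fst p)))"
      by (rule continuous_map_orbit_compose) (use H(2) in auto)
    then show "continuous_map (prod_topology (top_of_set {0..1}) (top_of_set S)) L (h \<circ> (\<lambda>(t,z). (t, \<pi> z)))"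
      unfolding prod_topology_subtopology_eu by (rule continuous_map_eq) (use h in auto)
  qed
  show ?thesis
  proof (subst homotopic_with)
    show "\<exists>h. continuous_map (prod_topology (top_of_set {0..1::real}) L) L h \<and> (\<forall>x \<in> topspace L. h (0,x) = f x) \<and>
      (\<forall>x \<in> topspace L. h (1,x) = g x) \<and> (\<forall>t \<in> {0..1}. (\<lambda>x. h (t,x)) ` {\<pi> a} \<subseteq> {\<pi> a})"
      using ch h f g x0 by (intro exI[of _ h]) auto
  qed (use x0 in auto)
qed

end

section \<open>Cubes\<close>

fun smax :: "nat \<Rightarrow> (nat \<Rightarrow> real) \<Rightarrow> real" where
  "smax 0 x = 0"
| "smax (Suc i) x = max (smax i x) \<bar>x i\<bar>"

lemma smax_nonneg [simp]: "smax i x \<ge> 0"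
  by (induction i) auto

lemma smax_ge: "j < i \<Longrightarrow> \<bar>x j\<bar> \<le> smax i x"
  by (induction i) (auto simp: less_Suc_eq)

lemma smax_le_iff: "smax i x \<le> B \<longleftrightarrow> 0 \<le> B \<and> (\<forall>j<i. \<bar>x j\<bar> \<le> B)"
  by (induction i) (auto simp: less_Suc_eq)

lemma smax_attained: "smax i x > 0 \<Longrightarrow> \<exists>j<i. \<bar>x j\<bar> = smax i x"
  by (induction i) (force simp: max_def less_Suc_eq split: if_splits)+

lemma smax_scale: "c \<ge> 0 \<Longrightarrow> smax i (\<lambda>j. c * x j) = c * smax i x"
  by (induction i) (auto simp: max_mult_distrib_left abs_mult)

lemma smax_cong: "(\<And>j. j < i \<Longrightarrow> x j = y j) \<Longrightarrow> smax i x = smax i y"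
  by (induction i) auto

lemma continuous_on_smax:
  "(\<And>j. j < i \<Longrightarrow> continuous_on X (\<lambda>p. f p j)) \<Longrightarrow> continuous_on X (\<lambda>p. smax i (f p))"
  by (induction i) (auto intro!: continuous_intros)

text \<open>Twice the distance from the centre in the maximum norm, so that the boundary of the cube
  is the level 1 and the concentric cube of half the side is the sublevel 1/2.\<close>

definition cmax :: "nat \<Rightarrow> (nat \<Rightarrow> real) \<Rightarrow> real" where
  "cmax i t = smax i (\<lambda>j. 2 * t j - 1)"

lemma continuous_on_cmax [continuous_intros]:
  assumes "continuous_on X f"
  shows "continuous_on X (\<lambda>p. cmax i (f p))"
  unfolding cmax_def
  by (intro continuous_on_smax continuous_on_diff continuous_on_mult continuous_on_const continuous_on_coord[OF assms])

lemma cmax_nonneg [simp]: "cmax i t \<ge> 0" by (simp add: cmax_def)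

lemma unit_cube_iff: "t \<in> unit_cube i \<longleftrightarrow> cmax i t \<le> 1 \<and> (\<forall>j\<ge>i. t j = 0)"
proof -
  have "\<bar>2 * x - 1\<bar> \<le> 1 \<longleftrightarrow> 0 \<le> x \<and> x \<le> (1::real)" for x by auto
  then show ?thesis unfolding cmax_def smax_le_iff unit_cube_def by simp
qed

lemma cube_boundary_iff: "t \<in> cube_boundary i \<longleftrightarrow> cmax i t = 1 \<and> (\<forall>j\<ge>i. t j = 0)"
proof -
  have e: "\<bar>2 * x - 1\<bar> = 1 \<longleftrightarrow> x = 0 \<or> x = (1::real)" for x by auto
  have "(\<exists>j<i. t j = 0 \<or> t j = 1) \<longleftrightarrow> cmax i t \<ge> 1" if t: "t \<in> unit_cube i"
  proof
    assume "\<exists>j<i. t j = 0 \<or> t j = 1"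
    then obtain j where "j < i" "\<bar>2 * t j - 1\<bar> = 1" using e by auto
    then show "cmax i t \<ge> 1" using smax_ge[of j i "\<lambda>j. 2 * t j - 1"] by (simp add: cmax_def)
  next
    assume "cmax i t \<ge> 1"
    then have "cmax i t = 1" using t by (simp add: unit_cube_iff)
    then obtain j where "j < i" "\<bar>2 * t j - 1\<bar> = 1" using smax_attained[of i "\<lambda>j. 2 * t j - 1"] by (auto simp: cmax_def)
    then show "\<exists>j<i. t j = 0 \<or> t j = 1" using e by auto
  qed
  then show ?thesis unfolding cube_boundary_def using unit_cube_iff[of t i] by auto
qed

lemma cube_boundary_subset: "cube_boundary i \<subseteq> unit_cube i"
  by (auto simp: cube_boundary_def)

lemma compact_unit_cube: "compact (unit_cube i)"
proof -
  have "compactin (product_topology (\<lambda>i. euclidean) UNIV) (PiE UNIV (\<lambda>j::nat. if j < i then {0..1::real} else {0}))"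
    by (subst compactin_PiE) (simp add: compactin_euclidean_iff)
  then have "compact (PiE UNIV (\<lambda>j::nat. if j < i then {0..1::real} else {0}))"
    by (simp only: euclidean_product_topology compactin_euclidean_iff)
  moreover have "unit_cube i = PiE UNIV (\<lambda>j. if j < i then {0..1} else {0})"
  proof
    show "unit_cube i \<subseteq> PiE UNIV (\<lambda>j. if j < i then {0..1} else {0})" by (auto simp: unit_cube_def)
    show "PiE UNIV (\<lambda>j. if j < i then {0..1} else {0}) \<subseteq> unit_cube i"
    proof
      fix t assume t: "t \<in> PiE UNIV (\<lambda>j. if j < i then {0..1::real} else {0})"
      have "t j \<in> (if j < i then {0..1} else {0})" for j using PiE_mem[OF t UNIV_I] .
      then have "(j < i \<longrightarrow> 0 \<le> t j \<and> t j \<le> 1) \<and> (j \<ge> i \<longrightarrow> t j = 0)" for j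
        by (metis atLeastAtMost_iff not_le singletonD)
      then show "t \<in> unit_cube i" by (simp add: unit_cube_def)
    qed
  qed
  ultimately show ?thesis by simp
qed

lemma compact_cube_boundary: "compact (cube_boundary i)"
proof -
  have "cube_boundary i = unit_cube i \<inter> {t. cmax i t = 1}"
    by (auto simp: cube_boundary_iff unit_cube_iff)
  moreover have "closed {t. cmax i t = 1}"
    by (intro closed_Collect_eq continuous_on_cmax continuous_on_id continuous_on_const)
  ultimately show ?thesis using compact_Int_closed[OF compact_unit_cube] by simp
qed

lemma unit_cube_scale:
  assumes "t \<in> unit_cube i" "s \<in> {0..1}"
  shows "(\<lambda>j. s * t j) \<in> unit_cube i"
  using assms by (auto simp: unit_cube_def mult_le_one)

lemma continuous_on_scale: "continuous_on X (\<lambda>(t::nat \<Rightarrow> real, s::real) j. s * t j)"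
proof (rule continuous_on_coordinatewise_then_product)
  fix j
  have "continuous_on X (\<lambda>p::(nat \<Rightarrow> real) \<times> real. fst p j)"
    by (rule continuous_on_coord[OF continuous_on_fst[OF continuous_on_id]])
  then show "continuous_on X (\<lambda>x::(nat \<Rightarrow> real) \<times> real. (case x of (t, s) \<Rightarrow> \<lambda>j. s * t j) j)"
    unfolding case_prod_unfold by (intro continuous_on_mult continuous_on_snd continuous_on_id)
qed

lemma connected_unit_cube: "connected (unit_cube i)"
proof -
  have "connected_component (unit_cube i) t (\<lambda>_. 0)" if t: "t \<in> unit_cube i" for t
  proof -
    have "continuous_on {0..1::real} (\<lambda>s j. s * t j)"
      using continuous_on_compose2[OF continuous_on_scale[of UNIV], of "{0..1}" "\<lambda>s. (t,s)"]
        continuous_on_Pair[OF continuous_on_const[of _ t] continuous_on_id, of "{0..1}"] by simp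
    then have "connected ((\<lambda>s j. s * t j) ` {0..1::real})" by (intro connected_continuous_image) auto
    moreover have "(\<lambda>s j. s * t j) ` {0..1::real} \<subseteq> unit_cube i" using unit_cube_scale[OF t] by auto
    moreover have "t \<in> (\<lambda>s j. s * t j) ` {0..1::real}" by (rule image_eqI[of _ _ 1]) auto
    moreover have "(\<lambda>_. 0) \<in> (\<lambda>s j. s * t j) ` {0..1::real}" by (rule image_eqI[of _ _ 0]) auto
    ultimately show ?thesis unfolding connected_component_def by blast
  qed
  then show ?thesis
    unfolding connected_iff_connected_component by (metis connected_component_sym connected_component_trans)
qed

text \<open>A continuous map from a compact set into a Hausdorff space is closed, hence a quotient
  map onto its image.\<close>

lemma continuous_on_compact_quotient:
  fixes p :: "'a::t2_space \<Rightarrow> 'b::t2_space" and f :: "'b \<Rightarrow> 'c::topological_space"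
  assumes K: "compact K" and p: "continuous_on K p" and fp: "continuous_on K (\<lambda>x. f (p x))"
  shows "continuous_on (p ` K) f"
proof -
  have "closed (p ` K)" by (intro compact_imp_closed compact_continuous_image p K)
  then show ?thesis
  proof (subst continuous_on_closed_vimage, assumption, intro allI impI)
    fix B :: "'c set" assume B: "closed B"
    have "closed ((\<lambda>x. f (p x)) -` B \<inter> K)"
      using fp B compact_imp_closed[OF K] continuous_on_closed_vimage by blast
    then have "compact (K \<inter> ((\<lambda>x. f (p x)) -` B \<inter> K))" using K by (intro compact_Int_closed)
    then have "compact (p ` (K \<inter> ((\<lambda>x. f (p x)) -` B \<inter> K)))"
      by (intro compact_continuous_image continuous_on_subset[OF p]) auto
    moreover have "p ` (K \<inter> ((\<lambda>x. f (p x)) -` B \<inter> K)) = f -` B \<inter> p ` K" by auto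
    ultimately show "closed (f -` B \<inter> p ` K)" using compact_imp_closed by metis
  qed
qed

text \<open>The retraction moves points radially in the cube; in the coordinates \<open>(\<rho>, s)\<close>, with \<open>\<rho>\<close> the
  distance to the centre, its target is an arc, and \<open>\<tau>\<close> is the position on that arc.\<close>

lemma cube_retraction:
  fixes i :: nat
  defines "T \<equiv> {p \<in> unit_cube i \<times> {0..1::real}. cmax i (fst p) = 1 \<or> snd p = 1 \<or> (snd p = 0 \<and> cmax i (fst p) \<ge> 1/2)}"
  shows "\<exists>R. continuous_on (unit_cube i \<times> {0..1}) R \<and> R ` (unit_cube i \<times> {0..1}) \<subseteq> T \<and> (\<forall>p\<in>T. R p = p)"
proof -
  define \<rho> where "\<rho> = (\<lambda>p::(nat \<Rightarrow> real) \<times> real. cmax i (fst p))"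
  \<comment> \<open>The arc runs from (1/2, 0) to (1, 0), up to (1, 1) and back to (0, 1), with
    lengths 1/2, 1 and 1. On it the first terms give the arc length and the last term vanishes. That
    last term makes \<tau> = 5/2 on the whole centre line \<rho> = 0, where there is no radial
    direction.\<close>
  define \<tau> where "\<tau> = (\<lambda>p. \<rho> p - 1/2 + snd p * (3 - 2 * \<rho> p) + 3 * (1 - snd p) * max 0 (1 - 2 * \<rho> p))"
  \<comment> \<open>The quotient (5/2 - \<tau>)/\<rho> for positive \<rho>, in a form that stays
    continuous at \<rho> = 0.\<close>
  define e where "e = (\<lambda>p. 3 * (1 - snd p) / max (\<rho> p) (1/2) - 1 + 2 * snd p)"
  \<comment> \<open>The ratio of the new radius to the old one; at position \<tau> the arc has
    radius equal to the least of 1, 1/2 + \<tau> and 5/2 - \<tau>. Below the cutoff 1/10 one has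
    \<tau> >= 2, so the image lies on the face s = 1 whatever its radius.\<close>
  define l where "l = (\<lambda>p. min (min 1 (1/2 + \<tau> p) / max (\<rho> p) (1/10)) (e p))"
  define R where "R = (\<lambda>p::(nat \<Rightarrow> real) \<times> real. ((\<lambda>j. if j < i then 1/2 + l p * (fst p j - 1/2) else 0), max 0 (min 1 (\<tau> p - 1/2))))"
  have c\<rho>: "continuous_on X \<rho>" for X unfolding \<rho>_def by (intro continuous_on_cmax continuous_on_fst continuous_on_id)
  have c\<tau>: "continuous_on X \<tau>" for X unfolding \<tau>_def
    by (intro continuous_on_add continuous_on_diff continuous_on_mult continuous_on_max continuous_on_const c\<rho> continuous_on_snd continuous_on_id)
  have ce: "continuous_on X e" for X unfolding e_def
    by (intro continuous_on_add continuous_on_diff continuous_on_mult continuous_on_divide continuous_on_max continuous_on_const c\<rho> continuous_on_snd continuous_on_id) auto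
  have cl: "continuous_on X l" for X unfolding l_def
    by (intro continuous_on_add continuous_on_min continuous_on_divide continuous_on_max continuous_on_const c\<rho> c\<tau> ce) auto
  have cR: "continuous_on X R" for X unfolding R_def
  proof (intro continuous_on_Pair continuous_on_coordinatewise_then_product)
    show "continuous_on X (\<lambda>x. max 0 (min 1 (\<tau> x - 1/2)))"
      by (intro continuous_on_max continuous_on_min continuous_on_diff continuous_on_const c\<tau>)
    have "continuous_on X (\<lambda>p::(nat \<Rightarrow> real) \<times> real. fst p j)" for j
      by (rule continuous_on_coord[OF continuous_on_fst[OF continuous_on_id]])
    then show "continuous_on X (\<lambda>x. if j < i then 1/2 + l x * (fst x j - 1/2) else 0)" for j
      by (cases "j < i") (auto intro!: continuous_on_add continuous_on_mult continuous_on_diff continuous_on_const cl)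
  qed
  have img: "R p \<in> T" if p: "p \<in> unit_cube i \<times> {0..1}" for p
  proof -
    obtain t s where ts: "p = (t,s)" "t \<in> unit_cube i" "0 \<le> s" "s \<le> 1" using p by auto
    define r where "r = cmax i t"
    have r: "0 \<le> r" "r \<le> 1" using ts by (auto simp: r_def unit_cube_iff)
    have rp: "\<rho> p = r" by (simp add: \<rho>_def r_def ts)
    have tau0: "0 \<le> \<tau> p" "\<tau> p \<le> 5/2"
    proof -
      have b: "r * s \<le> s" "0 \<le> r * s" "r * s \<le> r" using r ts by (auto simp: mult_left_le_one_le mult_left_le)
      have b': "r * s \<ge> r + s - 1"
        using mult_nonneg_nonneg[of "1 - r" "1 - s"] r ts by (simp add: algebra_simps)
      show "0 \<le> \<tau> p" "\<tau> p \<le> 5/2"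
      proof (atomize (full), cases "r \<le> 1/2")
        case True
        then have "\<tau> p = 5/2 - 5 * r + 4 * (r * s)"
          unfolding \<tau>_def rp by (simp add: ts max_def algebra_simps)
        then show "0 \<le> \<tau> p \<and> \<tau> p \<le> 5/2" using True b r by auto
      next
        case False
        then have "\<tau> p = r - 1/2 + 3 * s - 2 * (r * s)"
          unfolding \<tau>_def rp by (simp add: ts max_def algebra_simps)
        then show "0 \<le> \<tau> p \<and> \<tau> p \<le> 5/2" using False b b' ts by auto
      qed
    qed
    have e\<tau>: "e p * r = 5/2 - \<tau> p"
    proof (cases "r \<le> 1/2")
      case True
      then show ?thesis unfolding e_def \<tau>_def rp by (simp add: ts max_def algebra_simps)
    next
      case False
      then show ?thesis using r unfolding e_def \<tau>_def rp by (simp add: ts max_def field_simps)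
    qed
    have e1: "e p \<ge> 1"
    proof -
      have "3 * (1 - s) * max r (1/2) \<le> 3 * (1 - s) * 1" using ts r by (intro mult_left_mono) auto
      then have "3 * (1 - s) \<le> 3 * (1 - s) / max r (1/2)" by (subst pos_le_divide_eq) auto
      then show ?thesis using ts unfolding e_def rp by simp
    qed
    have l0: "l p \<ge> 0" using e1 tau0 by (simp add: l_def)
    have cm: "cmax i (fst (R p)) = l p * r"
    proof -
      have "cmax i (fst (R p)) = smax i (\<lambda>j. l p * (2 * t j - 1))"
        unfolding cmax_def by (rule smax_cong) (simp add: R_def ts algebra_simps)
      then show ?thesis using smax_scale[OF l0, of i "\<lambda>j. 2 * t j - 1"] by (simp add: r_def cmax_def)
    qed
    have lr: "l p * r = min (min 1 (1/2 + \<tau> p) * (r / max r (1/10))) (5/2 - \<tau> p)"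
    proof -
      have "l p * r = min (min 1 (1/2 + \<tau> p) / max r (1/10) * r) (e p * r)"
        unfolding l_def rp using r by (simp add: min_mult_distrib_right)
      then show ?thesis unfolding e\<tau> by simp
    qed
    have le1: "l p * r \<le> 1"
    proof -
      have "min 1 (1/2 + \<tau> p) * (r / max r (1/10)) \<le> 1 * 1"
        using tau0 r by (intro mult_mono) auto
      then show ?thesis unfolding lr by (metis min.coboundedI1 mult_1)
    qed
    have cub: "R p \<in> unit_cube i \<times> {0..1}"
      using le1 cm by (auto simp: mem_Times_iff unit_cube_iff) (auto simp: R_def)
    have "cmax i (fst (R p)) = 1 \<or> snd (R p) = 1 \<or> (snd (R p) = 0 \<and> cmax i (fst (R p)) \<ge> 1/2)"
    proof (cases "r < 1/10")
      case True
      have "5/2 - \<tau> p \<le> 1/2"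
      proof -
        have "r * s \<ge> 0" using r ts by simp
        have "5/2 - \<tau> p = 5 * r - 4 * (r * s)" using True unfolding \<tau>_def rp by (simp add: ts max_def algebra_simps)
        then show ?thesis using True \<open>r * s \<ge> 0\<close> by simp
      qed
      then show ?thesis by (simp add: R_def)
    next
      case False
      then have lr': "l p * r = min (min 1 (1/2 + \<tau> p)) (5/2 - \<tau> p)"
      proof -
        have "r / max r (1/10) = 1" using False by (simp add: max_def)
        then show ?thesis using lr by simp
      qed
      consider "\<tau> p \<le> 1/2" | "1/2 \<le> \<tau> p" "\<tau> p \<le> 3/2" | "3/2 \<le> \<tau> p" by linarith
      then show ?thesis
      proof cases
        case 1
        then have "snd (R p) = 0" by (simp add: R_def)
        moreover have "l p * r \<ge> 1/2" unfolding lr' using 1 tau0 by simp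
        ultimately show ?thesis using cm by simp
      next
        case 2
        then have "l p * r = 1" unfolding lr' by simp
        then show ?thesis using cm by simp
      next
        case 3
        then show ?thesis by (simp add: R_def)
      qed
    qed
    then show ?thesis using cub by (simp add: T_def)
  qed
  have fixT: "R p = p" if p: "p \<in> T" for p
  proof -
    obtain t s where ts: "p = (t,s)" "t \<in> unit_cube i" "0 \<le> s" "s \<le> 1" using p by (auto simp: T_def)
    define r where "r = cmax i t"
    have r: "0 \<le> r" "r \<le> 1" using ts by (auto simp: r_def unit_cube_iff)
    have rp: "\<rho> p = r" by (simp add: \<rho>_def r_def ts)
    have "l p = 1 \<and> max 0 (min 1 (\<tau> p - 1/2)) = s"
    proof -
      consider "s = 1" | "r = 1" | "s = 0" "r \<ge> 1/2" using p by (auto simp: T_def ts r_def)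
      then show ?thesis
      proof cases
        case 1
        have "1 / max r (1/10) \<ge> 1" using r by simp
        then show ?thesis using 1 r unfolding l_def e_def \<tau>_def rp by (simp add: ts)
      next
        case 2
        then show ?thesis using ts unfolding l_def e_def \<tau>_def rp by (simp add: ts)
      next
        case 3
        have "max r (1/2) = r" "max r (1/10) = r" "max 0 (1 - 2 * r) = 0" using 3 by auto
        moreover have "3 / r - 1 \<ge> 1" using 3 r by (simp add: field_simps)
        ultimately show ?thesis using 3 r unfolding l_def e_def \<tau>_def rp by (simp add: ts)
      qed
    qed
    moreover have "t j = 0" if "\<not> j < i" for j using ts(2) that by (simp add: unit_cube_def)
    ultimately show ?thesis by (auto simp: R_def ts)
  qed
  show ?thesis using cR img fixT by (intro exI[of _ R]) auto
qed


section \<open>The top-dimensional cell\<close>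

text \<open>Real coordinates of the complex coordinates from 1 on; coordinate 0 is left out because
  it is described by modulus and phase.\<close>

definition rcoord :: "(nat \<Rightarrow> complex) \<Rightarrow> nat \<Rightarrow> real" where
  "rcoord w k = (if even k then Re (w (k div 2 + 1)) else Im (w (k div 2 + 1)))"

lemma cis_2pi_eq_1_iff: "cis (2 * pi * x) = 1 \<longleftrightarrow> x \<in> \<int>"
proof
  assume "cis (2 * pi * x) = 1"
  then have "cos (2 * pi * x) = 1" by (simp add: complex_eq_iff)
  then obtain l :: int where "2 * pi * x = of_int l * (2 * pi)" using cos_one_2pi_int by (metis mult.assoc)
  then have "x = of_int l" by simp
  then show "x \<in> \<int>" by simp
next
  assume "x \<in> \<int>"
  then obtain l :: int where "x = of_int l" by (auto elim: Ints_cases)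
  then show "cis (2 * pi * x) = 1" by (simp add: cis.ctr cos_int_2pin sin_int_2pin complex_eq_iff)
qed

context lens
begin

context
  fixes \<zeta> :: complex
  assumes zeta: "cmod \<zeta> = 1"
begin

text \<open>The points where z_0 is 0 or has phase \<zeta> times an m-th root of unity: m balls of
  dimension 2n glued along their common boundary sphere. The complement consists of m open cells
  permuted by the action. The phase \<zeta> is a parameter so that the base point can be placed on
  the skeleton.\<close>

definition skel :: "(nat \<Rightarrow> complex) set" where
  "skel = {z \<in> S. z 0 ^ m = (\<zeta> * of_real (cmod (z 0))) ^ m}"

text \<open>The last cube coordinate is the phase inside a sector of angle 2 pi/m, and the first 2n
  give coordinates 1 to n. The factor in front of \<zeta> makes coordinate 0 vanish, and so
  collapses the phase, where those 2n lie on the boundary of their cube. Only a radial projection to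
  the sphere is then missing.\<close>

definition cellv :: "(nat \<Rightarrow> real) \<Rightarrow> nat \<Rightarrow> complex" where
  "cellv t = (\<lambda>j. if j = 0 then of_real (1 - cmax (2 * n) t) * (\<zeta> * cis (2 * pi * (t (2 * n) / real m)))
     else Complex (2 * t (2 * (j - 1)) - 1) (2 * t (2 * (j - 1) + 1) - 1))"

definition cell :: "(nat \<Rightarrow> real) \<Rightarrow> nat \<Rightarrow> complex" where
  "cell t = normalise n (cellv t)"

lemma zeta0: "\<zeta> \<noteq> 0" using zeta by auto

lemma rcoord_cellv: "rcoord (cellv t) k = 2 * t k - 1"
  by (auto simp: rcoord_def cellv_def elim!: evenE oddE)

lemma cellv_nonzero: "t \<in> unit_cube (2 * n + 1) \<Longrightarrow> \<exists>j\<le>n. cellv t j \<noteq> 0"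
proof (cases "cmax (2 * n) t = 1")
  case False
  then show ?thesis using zeta0 by (intro exI[of _ 0]) (simp add: cellv_def cis_neq_zero)
next
  case True
  then obtain k where k: "k < 2 * n" "\<bar>2 * t k - 1\<bar> = 1" using smax_attained[of "2*n" "\<lambda>j. 2 * t j - 1"] by (auto simp: cmax_def)
  have "cellv t (k div 2 + 1) \<noteq> 0"
  proof
    assume "cellv t (k div 2 + 1) = 0"
    then have "rcoord (cellv t) k = 0" by (simp add: rcoord_def)
    then show False using k rcoord_cellv by simp
  qed
  moreover have "k div 2 + 1 \<le> n" using k by linarith
  ultimately show ?thesis by blast
qed

lemma cell_in_sphere: "t \<in> unit_cube (2 * n + 1) \<Longrightarrow> cell t \<in> S"
  unfolding cell_def by (intro normalise_in_sphere cellv_nonzero)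

lemma continuous_on_cell: "continuous_on (unit_cube (2 * n + 1)) cell"
  unfolding cell_def
proof (rule continuous_on_normalise)
  have co: "continuous_on X (\<lambda>t::nat \<Rightarrow> real. t k)" for X k by (rule continuous_on_coord[OF continuous_on_id])
  show "continuous_on (unit_cube (2*n+1)) (\<lambda>t. cellv t j)" for j
  proof (cases "j = 0")
    case True
    have "continuous_on (unit_cube (2*n+1)) (\<lambda>t. of_real (1 - cmax (2 * n) t) * (\<zeta> * cis (2 * pi * (t (2 * n) / real m))))"
      using m0 by (intro continuous_on_mult continuous_on_of_real continuous_on_diff continuous_on_const continuous_on_cmax
        continuous_on_id continuous_on_cis continuous_on_divide co) auto
    then show ?thesis using True by (simp add: cellv_def)
  next
    case False
    then show ?thesis unfolding cellv_def Complex_eq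
      by (simp del: of_real_diff of_real_mult) (intro continuous_on_mult continuous_on_add continuous_on_of_real continuous_on_diff continuous_on_const co)
  qed
qed (use cellv_nonzero in auto)

lemma cmax_cell: "cmax (2 * n + 1) t = max (cmax (2 * n) t) \<bar>2 * t (2 * n) - 1\<bar>"
  by (simp add: cmax_def)

lemma cell_0: "t \<in> unit_cube (2 * n + 1) \<Longrightarrow>
  cell t 0 = of_real ((1 - cmax (2 * n) t) / cnorm n (cellv t)) * (\<zeta> * cis (2 * pi * (t (2 * n) / real m)))"
  by (simp add: cell_def normalise_def cellv_def)

text \<open>The m-th power turns the phase 2 pi t/m into 2 pi t, which is trivial only at the two
  ends t = 0 and t = 1; the remaining boundary points are those where coordinate 0 vanishes.\<close>

lemma cell_in_skel_iff:
  assumes t: "t \<in> unit_cube (2 * n + 1)"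
  shows "cell t \<in> skel \<longleftrightarrow> t \<in> cube_boundary (2 * n + 1)"
proof -
  define \<rho> where "\<rho> = cmax (2 * n) t"
  define c where "c = (1 - \<rho>) / cnorm n (cellv t)"
  have rho: "0 \<le> \<rho>" "\<rho> \<le> 1" "0 \<le> t (2*n)" "t (2*n) \<le> 1"
    using t cmax_cell[of t] by (auto simp: unit_cube_iff \<rho>_def abs_le_iff)
  have a: "cnorm n (cellv t) > 0" using cellv_nonzero[OF t] cnorm_pos_iff by blast
  have c0: "c \<ge> 0" "c = 0 \<longleftrightarrow> \<rho> = 1" using rho a by (auto simp: c_def)
  have z0: "cell t 0 = of_real c * (\<zeta> * cis (2 * pi * (t (2 * n) / real m)))"
    using cell_0[OF t] by (simp add: c_def \<rho>_def)
  have nz: "cmod (cell t 0) = c" using c0 zeta by (simp add: z0 norm_mult)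
  have cm: "cis (2 * pi * (t (2 * n) / real m)) ^ m = cis (2 * pi * t (2*n))"
    using m0 by (simp add: Complex.DeMoivre)
  have "cell t \<in> skel \<longleftrightarrow> (of_real c * \<zeta>) ^ m * cis (2 * pi * t (2*n)) = (of_real c * \<zeta>) ^ m"
    unfolding skel_def using cell_in_sphere[OF t] nz z0 cm by (simp add: power_mult_distrib mult_ac)
  also have "\<dots> \<longleftrightarrow> c = 0 \<or> cis (2 * pi * t (2*n)) = 1" using zeta0 m2 by simp
  also have "\<dots> \<longleftrightarrow> \<rho> = 1 \<or> t (2*n) = 0 \<or> t (2*n) = 1"
  proof -
    have "t (2*n) \<in> \<int> \<longleftrightarrow> t (2*n) = 0 \<or> t (2*n) = 1"
    proof
      assume "t (2*n) \<in> \<int>"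
      then obtain l :: int where l: "t (2*n) = of_int l" by (auto elim: Ints_cases)
      then have "l = 0 \<or> l = 1" using rho by auto
      then show "t (2*n) = 0 \<or> t (2*n) = 1" using l by auto
    qed auto
    then show ?thesis unfolding cis_2pi_eq_1_iff c0 by simp
  qed
  also have "\<dots> \<longleftrightarrow> t \<in> cube_boundary (2 * n + 1)"
    using t rho unfolding cube_boundary_iff unit_cube_iff cmax_cell \<rho>_def by (auto simp: max_def abs_if split: if_splits)
  finally show ?thesis .
qed

lemma act_skel: "act k z \<in> skel \<longleftrightarrow> z \<in> skel"
proof -
  have "act k z 0 ^ m = z 0 ^ m"
  proof -
    have "cis (2 * pi * of_int (wt 0 * k) / real m) ^ m = cis (2 * pi * of_int k)"
      using m0 by (simp add: Complex.DeMoivre wt_def)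
    then show ?thesis by (simp add: act_def power_mult_distrib cis_int)
  qed
  then show ?thesis by (simp add: skel_def)
qed

lemma skel_subset: "skel \<subseteq> S" by (auto simp: skel_def)

lemma closed_skel: "closed skel"
proof -
  have co: "continuous_on X (\<lambda>z::nat \<Rightarrow> complex. z k)" for X k by (rule continuous_on_coord[OF continuous_on_id])
  have "skel = S \<inter> {z. z 0 ^ m = (\<zeta> * of_real (cmod (z 0))) ^ m}" by (auto simp: skel_def)
  moreover have "closed {z::nat \<Rightarrow> complex. z 0 ^ m = (\<zeta> * of_real (cmod (z 0))) ^ m}"
    by (intro closed_Collect_eq continuous_on_power continuous_on_mult continuous_on_of_real continuous_on_norm continuous_on_const co)
  ultimately show ?thesis using closed_Int[OF closed_complex_sphere] by simp
qed

lemma compact_skel: "compact skel"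
  using compact_Int_closed[OF compact_complex_sphere closed_skel] skel_subset by (metis inf.absorb2)

text \<open>The skeleton is covered by m joins of a point with the sphere in coordinates 1 to n,
  which has dimension 2n - 1.\<close>

lemma low_dim_skel: "low_dim (2 * n) skel"
proof -
  define J where "J = (\<lambda>u. {\<lambda>j::nat. if j = 0 then of_real (sin a) * u else of_real (cos a) * w j | a w. a \<in> {0..pi/2} \<and> w \<in> support_sphere {1..n}})"
  have J: "low_dim (2 * n) (J u)" if "cmod u = 1" for u
  proof -
    have "low_dim (2 * card {1..n} - 1) (support_sphere {1..n})" using n1 by (intro low_dim_support_sphere) auto
    then have "low_dim (Suc (2 * card {1..n} - 1)) (J u)" unfolding J_def
    proof (rule low_dim_join)
      show "cmod (w j) \<le> 1" if "w \<in> support_sphere {1..n}" for w j using support_sphere_le_1[OF _ that] by simp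
      show "w 0 = 0" if "w \<in> support_sphere {1..n}" for w using that by (simp add: support_sphere_def)
    qed (fact that)
    then show ?thesis using n1 by simp
  qed
  have cover: "skel \<subseteq> (\<Union>k\<in>{..<m}. J (\<zeta> * exp (2 * of_real pi * \<i> * of_nat k / of_nat m)))"
  proof
    fix z assume z: "z \<in> skel"
    then have zS: "z \<in> support_sphere (insert 0 {1..n})"
      using skel_subset by (auto simp: complex_sphere_eq_support atMost_atLeast0 simp flip: atLeastAtMost_insertL)
    obtain a w where aw: "a \<in> {0..pi/2}" "w \<in> support_sphere {1..n}" "cmod (z 0) = sin a"
      "\<And>j. j \<noteq> 0 \<Longrightarrow> z j = of_real (cos a) * w j"
      using support_sphere_split[OF _ _ _ zS] n1 by auto
    obtain k where k: "k < m" "z 0 = of_real (cmod (z 0)) * (\<zeta> * exp (2 * of_real pi * \<i> * of_nat k / of_nat m))"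
    proof (cases "z 0 = 0")
      case True
      then show ?thesis using that[of 0] m2 by simp
    next
      case False
      define u where "u = z 0 / (\<zeta> * of_real (cmod (z 0)))"
      have "u ^ m = 1" unfolding u_def power_divide using z False zeta0 by (simp add: skel_def)
      then obtain k where "k < m" "u = exp (2 * of_real pi * \<i> * of_nat k / of_nat m)"
        using complex_roots_unity[of m] m2 by auto
      then show ?thesis using that[of k] False zeta0 by (simp add: u_def field_simps)
    qed
    have "z = (\<lambda>j. if j = 0 then of_real (sin a) * (\<zeta> * exp (2 * of_real pi * \<i> * of_nat k / of_nat m)) else of_real (cos a) * w j)"
      using aw k(2) by auto
    then have "z \<in> J (\<zeta> * exp (2 * of_real pi * \<i> * of_nat k / of_nat m))" unfolding J_def using aw by blast
    then show "z \<in> (\<Union>k\<in>{..<m}. J (\<zeta> * exp (2 * of_real pi * \<i> * of_nat k / of_nat m)))" using k(1) by blast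
  qed
  have "low_dim (2 * n) (\<Union>k\<in>{..<m}. J (\<zeta> * exp (2 * of_real pi * \<i> * of_nat k / of_nat m)))"
    by (intro low_dim_UN J) (auto simp: norm_mult zeta norm_exp_eq_Re)
  then show ?thesis using cover by (rule low_dim_subset)
qed

text \<open>The phase relative to \<zeta> is measured in units of 2 pi/m; rotating back by its
  integer part brings z into the closed fundamental sector, where the cell map is inverted
  explicitly.\<close>

lemma cell_cover:
  assumes z: "z \<in> S" "z \<notin> skel"
  obtains k t where "t \<in> unit_cube (2 * n + 1)" "z = act k (cell t)"
proof -
  have z0: "z 0 \<noteq> 0" using z m2 by (auto simp: skel_def)
  define u where "u = z 0 / (of_real (cmod (z 0)) * \<zeta>)"
  have "cmod u = 1" using z0 zeta by (simp add: u_def norm_divide norm_mult)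
  define s where "s = Arg2pi u / (2 * pi) * real m"
  have us: "u = cis (2 * pi * (s / real m))"
    using Arg2pi_eq[of u] \<open>cmod u = 1\<close> m0 by (simp add: s_def cis_conv_exp)
  define k where "k = \<lfloor>s\<rfloor>"
  define \<theta> where "\<theta> = s - of_int k"
  have th: "0 \<le> \<theta>" "\<theta> \<le> 1" unfolding \<theta>_def k_def by linarith+
  define z' where "z' = act (-k) z"
  have z'S: "z' \<in> S" using z by (simp add: z'_def)
  have z'0: "z' 0 = of_real (cmod (z 0)) * (\<zeta> * cis (2 * pi * (\<theta> / real m)))"
  proof -
    have "z 0 = of_real (cmod (z 0)) * \<zeta> * cis (2 * pi * (s / real m))"
    proof -
      have "z 0 = u * (of_real (cmod (z 0)) * \<zeta>)" using z0 zeta0 by (simp add: u_def)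
      then show ?thesis unfolding us by (metis mult.commute)
    qed
    then have "z' 0 = of_real (cmod (z 0)) * \<zeta> * (cis (2 * pi * (s / real m)) * cis (2 * pi * of_int (wt 0 * (-k)) / real m))"
      unfolding z'_def act_def by (metis mult.assoc)
    also have "cis (2 * pi * (s / real m)) * cis (2 * pi * of_int (wt 0 * (-k)) / real m) = cis (2 * pi * (\<theta> / real m))"
      unfolding cis_mult by (rule arg_cong[where f = cis]) (simp add: \<theta>_def wt_def diff_divide_distrib algebra_simps)
    finally show ?thesis by (simp add: mult_ac)
  qed
  define y where "y = rcoord z'"
  \<comment> \<open>The scale for which z'/\<sigma> is a value of \<open>cellv\<close>: it has to
    satisfy |z_0|/\<sigma> = 1 - \<open>smax (2 * n) y\<close>/\<sigma>.\<close>
  define \<sigma> where "\<sigma> = cmod (z 0) + smax (2 * n) y"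
  have sig: "\<sigma> > 0" using z0 by (simp add: \<sigma>_def add_pos_nonneg)
  define t where "t = (\<lambda>j. if j < 2 * n then (y j / \<sigma> + 1) / 2 else if j = 2 * n then \<theta> else 0)"
  have rho: "cmax (2 * n) t = smax (2 * n) y / \<sigma>"
  proof -
    have "cmax (2*n) t = smax (2*n) (\<lambda>j. (1/\<sigma>) * y j)"
      unfolding cmax_def by (rule smax_cong) (simp add: t_def add_divide_distrib)
    also have "\<dots> = (1/\<sigma>) * smax (2*n) y" by (rule smax_scale) (use sig in simp)
    finally show ?thesis by simp
  qed
  have rho1: "1 - cmax (2*n) t = cmod (z 0) / \<sigma>" unfolding rho using sig by (simp add: \<sigma>_def field_simps)
  have tc: "t \<in> unit_cube (2 * n + 1)"
  proof -
    have "cmax (2*n) t \<le> 1" using rho1 sig by (metis diff_ge_0_iff_ge divide_nonneg_pos norm_ge_zero)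
    moreover have "\<bar>2 * t (2*n) - 1\<bar> \<le> 1" using th by (simp add: t_def)
    ultimately show ?thesis unfolding unit_cube_iff cmax_cell by (simp add: t_def)
  qed
  have v: "cellv t j = z' j / of_real \<sigma>" if j: "j \<le> n" for j
  proof (cases "j = 0")
    case True
    then show ?thesis using rho1 z'0 by (simp add: cellv_def t_def)
  next
    case False
    have "2 * (j - 1) < 2 * n" "2 * (j - 1) + 1 < 2 * n" using False j by linarith+
    then have "cellv t j = Complex (y (2 * (j-1)) / \<sigma>) (y (2 * (j - 1) + 1) / \<sigma>)"
      using False by (simp add: cellv_def t_def add_divide_distrib)
    also have "\<dots> = z' j / of_real \<sigma>" using False by (simp add: y_def rcoord_def complex_eq_iff)
    finally show ?thesis .
  qed
  have "cnorm n (cellv t) = 1 / \<sigma>"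
  proof -
    have "(\<Sum>j\<le>n. (cmod (cellv t j))\<^sup>2) = (\<Sum>j\<le>n. (cmod (z' j))\<^sup>2 / \<sigma>\<^sup>2)"
      by (intro sum.cong) (auto simp: v norm_divide power_divide)
    also have "\<dots> = 1 / \<sigma>\<^sup>2" using z'S by (simp add: complex_sphere_def flip: sum_divide_distrib)
    finally show ?thesis using sig by (simp add: cnorm_def real_sqrt_divide)
  qed
  then have "cell t j = z' j" for j
    using v[of j] sig z'S by (cases "j \<le> n") (auto simp: cell_def normalise_def complex_sphere_def)
  then have "cell t = z'" by (rule ext)
  then have "z = act k (cell t)" by (simp add: z'_def)
  with tc show thesis using that by blast
qed

text \<open>Off the boundary both last coordinates lie strictly between 0 and 1, so comparing phases
  makes k a multiple of m and these coordinates equal. The other coordinates are then known up to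
  the scale of the radial projection.\<close>

lemma cell_inj:
  assumes t: "t \<in> unit_cube (2 * n + 1)" "t' \<in> unit_cube (2 * n + 1)" "t \<notin> cube_boundary (2 * n + 1)"
    and eq: "act k (cell t) = cell t'"
  shows "t' = t \<and> int m dvd k"
proof -
  have t'b: "t' \<notin> cube_boundary (2*n+1)"
    using cell_in_skel_iff t eq act_skel by metis
  define a a' where "a = cnorm n (cellv t)" and "a' = cnorm n (cellv t')"
  have a: "a > 0" "a' > 0" unfolding a_def a'_def using cellv_nonzero t cnorm_pos_iff by blast+
  define \<theta> \<theta>' where "\<theta> = t (2*n)" and "\<theta>' = t' (2*n)"
  define c c' where "c = (1 - cmax (2*n) t) / a" and "c' = (1 - cmax (2*n) t') / a'"
  have bd: "cmax (2*n) s < 1 \<and> 0 < s (2*n) \<and> s (2*n) < 1" if "s \<in> unit_cube (2*n+1)" "s \<notin> cube_boundary (2*n+1)" for s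
    using that unfolding unit_cube_iff cube_boundary_iff cmax_cell by (auto simp: max_def abs_if split: if_splits)
  have th: "0 < \<theta>" "\<theta> < 1" "0 < \<theta>'" "\<theta>' < 1" unfolding \<theta>_def \<theta>'_def using bd[OF t(1,3)] bd[OF t(2) t'b] by auto
  have c: "c > 0" "c' > 0" unfolding c_def c'_def using bd[OF t(1,3)] bd[OF t(2) t'b] a by auto
  have z: "cell t 0 = of_real c * (\<zeta> * cis (2 * pi * (\<theta> / real m)))" "cell t' 0 = of_real c' * (\<zeta> * cis (2 * pi * (\<theta>' / real m)))"
    using cell_0[OF t(1)] cell_0[OF t(2)] by (simp_all add: c_def c'_def a_def a'_def \<theta>_def \<theta>'_def)
  have "cmod (cell t 0) = cmod (cell t' 0)" using eq by (metis cmod_act)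
  then have cc: "c = c'" using c zeta by (simp add: z norm_mult)
  have "act k (cell t) 0 = cell t' 0" using eq by simp
  then have "of_real c * \<zeta> * (cis (2 * pi * (\<theta> / real m)) * cis (2 * pi * of_int k / real m)) = of_real c * \<zeta> * cis (2 * pi * (\<theta>' / real m))"
    by (simp add: act_def z wt_def mult_ac flip: cc)
  then have "cis (2 * pi * (\<theta> / real m)) * cis (2 * pi * of_int k / real m) = cis (2 * pi * (\<theta>' / real m))"
    using c zeta0 by simp
  then have "cis (2 * pi * ((\<theta> + of_int k) / real m)) = cis (2 * pi * (\<theta>' / real m))"
    by (simp add: cis_mult add_divide_distrib distrib_left)
  then have "cis (2 * pi * ((\<theta> + of_int k) / real m)) / cis (2 * pi * (\<theta>' / real m)) = 1" by (simp add: cis_neq_zero)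
  then have "cis (2 * pi * ((\<theta> + of_int k - \<theta>') / real m)) = 1"
    by (simp add: cis_divide diff_divide_distrib right_diff_distrib)
  then obtain l :: int where "(\<theta> + of_int k - \<theta>') / real m = of_int l" unfolding cis_2pi_eq_1_iff by (auto elim: Ints_cases)
  then have l: "\<theta> - \<theta>' = of_int (l * int m - k)" using m0 by (simp add: field_simps)
  \<comment> \<open>The difference of two numbers strictly between 0 and 1 is an integer only if it
    is 0.\<close>
  then have "l * int m - k = 0" using th by (smt (verit) of_int_1_less_iff of_int_less_1_iff of_int_less_iff of_int_minus of_int_1)
  then have k: "k = l * int m" and tt: "\<theta> = \<theta>'" using l by auto
  have dv: "int m dvd k" using k by simp
  have eq': "cell t = cell t'" using eq act_dvd[OF dv] by simp
  have x: "(2 * t j - 1) / a = (2 * t' j - 1) / a'" if j: "j < 2 * n" for j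
  proof -
    have "j div 2 + 1 \<le> n" using j by linarith
    then have "rcoord (cell s) j = (2 * s j - 1) / cnorm n (cellv s)" for s
      using rcoord_cellv[of s j] by (auto simp: rcoord_def cell_def normalise_def split: if_splits)
    then show ?thesis using eq' by (metis a_def a'_def)
  qed
  \<comment> \<open>Added to the equation for (1 - cmax)/a given by c = c', this yields 1/a =
    1/a'.\<close>
  have "cmax (2*n) t / a = cmax (2*n) t' / a'"
  proof -
    have "smax (2*n) (\<lambda>j. (1/a) * (2 * t j - 1)) = smax (2*n) (\<lambda>j. (1/a') * (2 * t' j - 1))"
      by (rule smax_cong) (use x in simp)
    moreover have "smax (2*n) (\<lambda>j. (1/a) * (2 * t j - 1)) = (1/a) * cmax (2*n) t"
      "smax (2*n) (\<lambda>j. (1/a') * (2 * t' j - 1)) = (1/a') * cmax (2*n) t'"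
      unfolding cmax_def by (rule smax_scale, use a in simp)+
    ultimately show ?thesis by simp
  qed
  then have "1 / a = 1 / a'" using cc by (simp add: c_def c'_def diff_divide_distrib)
  then have aa: "a = a'" by simp
  have "t' j = t j" for j
  proof -
    consider "j < 2 * n" | "j = 2 * n" | "j \<ge> 2 * n + 1" by linarith
    then show ?thesis
    proof cases
      case 1 then show ?thesis using x[OF 1] aa a by simp
    next
      case 2 then show ?thesis using tt by (simp add: \<theta>_def \<theta>'_def)
    next
      case 3 then show ?thesis using t by (simp add: unit_cube_def)
    qed
  qed
  then show ?thesis using dv by auto
qed

text \<open>The skeleton and the translates of one closed cell cover the sphere, so compatible data
  on the skeleton and on that cell determine an equivariant map. The parameter s is carried along to
  treat homotopies; for a single map the data are taken constant in s.\<close>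

proposition glue_cell:
  fixes U V :: "_ \<times> real \<Rightarrow> nat \<Rightarrow> complex"
  assumes U: "continuous_on (skel \<times> {0..1}) U" "U ` (skel \<times> {0..1}) \<subseteq> S"
      "\<And>k z s. z \<in> skel \<Longrightarrow> s \<in> {0..1} \<Longrightarrow> U (act k z, s) = act (r * k) (U (z, s))"
    and V: "continuous_on (unit_cube (2 * n + 1) \<times> {0..1}) V" "V ` (unit_cube (2 * n + 1) \<times> {0..1}) \<subseteq> S"
    and UV: "\<And>t s. t \<in> cube_boundary (2 * n + 1) \<Longrightarrow> s \<in> {0..1} \<Longrightarrow> V (t, s) = U (cell t, s)"
  shows "\<exists>W. continuous_on (S \<times> {0..1}) W \<and> W ` (S \<times> {0..1}) \<subseteq> S \<and>
    (\<forall>k. \<forall>z\<in>S. \<forall>s\<in>{0..1}. W (act k z, s) = act (r * k) (W (z, s))) \<and>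
    (\<forall>z\<in>skel. \<forall>s\<in>{0..1}. W (z, s) = U (z, s)) \<and>
    (\<forall>t\<in>unit_cube (2 * n + 1). \<forall>s\<in>{0..1}. W (cell t, s) = V (t, s))"
proof -
  let ?C = "unit_cube (2 * n + 1)"
  define W where "W = (\<lambda>(z, s). if z \<in> skel then U (z, s)
    else (let kt = (SOME kt. snd kt \<in> ?C \<and> z = act (fst kt) (cell (snd kt))) in act (r * fst kt) (V (snd kt, s))))"
  have WZ: "W (z, s) = U (z, s)" if "z \<in> skel" for z s using that by (simp add: W_def)
  \<comment> \<open>Off the skeleton, two representations of a point have the same cube point and
    exponents congruent modulo m; on the skeleton the agreement of U and V takes over.\<close>
  have key: "W (act k (cell t), s) = act (r * k) (V (t, s))" if t: "t \<in> ?C" and s: "s \<in> {0..1}" for k t s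
  proof (cases "t \<in> cube_boundary (2 * n + 1)")
    case True
    then have "cell t \<in> skel" using cell_in_skel_iff[OF t] by simp
    then show ?thesis using U(3) UV[OF True s] s by (simp add: WZ act_skel)
  next
    case False
    then have nz: "act k (cell t) \<notin> skel" using cell_in_skel_iff[OF t] by (simp add: act_skel)
    define kt where "kt = (SOME kt. snd kt \<in> ?C \<and> act k (cell t) = act (fst kt) (cell (snd kt)))"
    have "snd kt \<in> ?C \<and> act k (cell t) = act (fst kt) (cell (snd kt))"
      unfolding kt_def by (rule someI[of _ "(k, t)"]) (use t in simp)
    then have kt: "snd kt \<in> ?C" "act k (cell t) = act (fst kt) (cell (snd kt))" by auto
    have "act (k - fst kt) (cell t) = act (- fst kt) (act k (cell t))" by (simp add: add.commute)
    also have "\<dots> = cell (snd kt)" unfolding kt(2) by simp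
    finally have *: "snd kt = t \<and> int m dvd k - fst kt" using cell_inj[OF t kt(1) False] by blast
    then have "int m dvd r * fst kt - r * k" by (metis dvd_diff_commute dvd_mult right_diff_distrib)
    then have "act (r * fst kt) (V (t, s)) = act (r * k) (V (t, s))" by (rule act_cong)
    moreover have "W (act k (cell t), s) = act (r * fst kt) (V (snd kt, s))"
      using nz unfolding W_def kt_def Let_def by simp
    ultimately show ?thesis using * by simp
  qed
  have cellS: "act k (cell t) \<in> S" if "t \<in> ?C" for k t using cell_in_sphere[OF that] by simp
  define D where "D = (\<lambda>k. (\<lambda>p. (act k (cell (fst p)), snd p)) ` (?C \<times> {0..1::real}))"
  have cp: "continuous_on (?C \<times> {0..1::real}) (\<lambda>p. (act k (cell (fst p)), snd p))" for k
    by (intro continuous_on_Pair continuous_on_act continuous_on_compose2[OF continuous_on_cell continuous_on_fst[OF continuous_on_id]]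
        continuous_on_snd continuous_on_id) auto
  have cC: "compact (?C \<times> {0..1::real})" by (intro compact_Times compact_unit_cube compact_Icc)
  have clD: "closed (D k)" for k unfolding D_def by (intro compact_imp_closed compact_continuous_image cp cC)
  have cW: "continuous_on (D k) W" for k
    unfolding D_def
  proof (rule continuous_on_compact_quotient[OF cC cp])
    have "continuous_on (?C \<times> {0..1::real}) (\<lambda>p. act (r * k) (V p))" by (intro continuous_on_act V)
    then show "continuous_on (?C \<times> {0..1::real}) (\<lambda>p. W (act k (cell (fst p)), snd p))"
      by (rule continuous_on_eq) (use key in auto)
  qed
  have cov: "S \<times> {0..1} = skel \<times> {0..1} \<union> (\<Union>k\<in>{0..<int m}. D k)"
  proof
    show "S \<times> {0..1} \<subseteq> skel \<times> {0..1} \<union> (\<Union>k\<in>{0..<int m}. D k)"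
    proof
      fix p assume "p \<in> S \<times> {0..1::real}"
      then obtain z s where p: "p = (z, s)" and z: "z \<in> S" and s: "s \<in> {0..1::real}" by blast
      show "p \<in> skel \<times> {0..1} \<union> (\<Union>k\<in>{0..<int m}. D k)"
      proof (cases "z \<in> skel")
        case True
        then show ?thesis using p s by simp
      next
        case False
        then obtain k t where kt: "t \<in> ?C" "z = act k (cell t)" using cell_cover[OF z] by metis
        then have "z = act (k mod int m) (cell t)" by (simp add: act_mod)
        then have "(z, s) \<in> D (k mod int m)" unfolding D_def using kt(1) s by force
        moreover have "k mod int m \<in> {0..<int m}" using m2 by simp
        ultimately show ?thesis using p by blast
      qed
    qed
    show "skel \<times> {0..1} \<union> (\<Union>k\<in>{0..<int m}. D k) \<subseteq> S \<times> {0..1}" using skel_subset cellS by (auto simp: D_def)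
  qed
  have "continuous_on (skel \<times> {0..1}) W" using U(1) by (rule continuous_on_eq) (auto simp: WZ)
  moreover have "continuous_on (\<Union>k\<in>{0..<int m}. D k) W" by (intro continuous_on_closed_Union clD cW) auto
  moreover have "closed (\<Union>k\<in>{0..<int m}. D k)" using clD by (intro closed_UN) auto
  moreover have "closed (skel \<times> {0..1::real})" using closed_skel by (intro closed_Times) auto
  ultimately have "continuous_on (S \<times> {0..1}) W" unfolding cov by (intro continuous_on_closed_Un)
  moreover have "W (z, s) \<in> S \<and> W (act k z, s) = act (r * k) (W (z, s))" if z: "z \<in> S" and s: "s \<in> {0..1}" for k z s
  proof (cases "z \<in> skel")
    case True
    then show ?thesis using U(2,3) s by (auto simp: WZ act_skel)
  next
    case False
    then obtain l t where lt: "t \<in> ?C" "z = act l (cell t)" using cell_cover[OF z] by metis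
    have "W (act k z, s) = act (r * (k + l)) (V (t, s))" using key[OF lt(1) s, of "k+l"] lt(2) by simp
    then show ?thesis using key[OF lt(1) s, of l] lt V(2) s by (auto simp: distrib_left)
  qed
  ultimately show ?thesis using WZ key[of _ _ 0] by (intro exI[of _ W]) auto
qed

end

end

section \<open>Lifting maps and homotopies of cubes\<close>

lemma cube_htpyD:
  assumes "(f, g) \<in> cube_htpy i Y y0"
  shows "\<exists>H. continuous_map (top_of_set (unit_cube i \<times> {0..1::real})) Y H \<and>
    (\<forall>t. H (t, 0) = f t \<and> H (t, 1) = g t) \<and> (\<forall>t\<in>cube_boundary i. \<forall>s\<in>{0..1}. H (t, s) = y0)"
proof -
  have "homotopic_with (\<lambda>h. h ` cube_boundary i \<subseteq> {y0}) (top_of_set (unit_cube i)) Y f g"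
    using assms by (simp add: cube_htpy_def pair_htpy_def)
  then obtain h where h: "continuous_map (prod_topology (top_of_set {0..1::real}) (top_of_set (unit_cube i))) Y h"
    "\<forall>x. h (0, x) = f x" "\<forall>x. h (1, x) = g x" "\<forall>t\<in>{0..1}. (\<lambda>x. h (t, x)) ` cube_boundary i \<subseteq> {y0}"
    unfolding homotopic_with_def by blast
  have "continuous_map (top_of_set (unit_cube i \<times> {0..1::real})) (top_of_set ({0..1} \<times> unit_cube i)) (\<lambda>p. (snd p, fst p))"
    by (auto intro!: continuous_on_Pair continuous_on_fst continuous_on_snd continuous_on_id)
  then have "continuous_map (top_of_set (unit_cube i \<times> {0..1::real})) Y (h \<circ> (\<lambda>p. (snd p, fst p)))"
    using continuous_map_compose h(1) unfolding prod_topology_subtopology_eu by blast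
  moreover have "h (s, t) = y0" if "t \<in> cube_boundary i" "s \<in> {0..1}" for t s
    using h(4) that by (meson image_subset_iff singletonD)
  ultimately show ?thesis using h(2,3) by (intro exI[of _ "h \<circ> (\<lambda>p. (snd p, fst p))"]) auto
qed

lemma cube_htpyI:
  assumes H: "continuous_map (top_of_set (unit_cube i \<times> {0..1::real})) Y H"
    and f: "\<And>t. t \<in> unit_cube i \<Longrightarrow> H (t, 0) = f t" and g: "\<And>t. t \<in> unit_cube i \<Longrightarrow> H (t, 1) = g t"
    and b: "\<And>t s. t \<in> cube_boundary i \<Longrightarrow> s \<in> {0..1} \<Longrightarrow> H (t, s) = y0"
  shows "(f, g) \<in> cube_htpy i Y y0"
proof -
  have "continuous_map (top_of_set ({0..1} \<times> unit_cube i)) (top_of_set (unit_cube i \<times> {0..1::real})) (\<lambda>p. (snd p, fst p))"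
    by (auto intro!: continuous_on_Pair continuous_on_fst continuous_on_snd continuous_on_id)
  then have c: "continuous_map (prod_topology (top_of_set {0..1::real}) (top_of_set (unit_cube i))) Y (H \<circ> (\<lambda>p. (snd p, fst p)))"
    using continuous_map_compose[OF _ H] unfolding prod_topology_subtopology_eu by blast
  have "homotopic_with (\<lambda>h. h ` cube_boundary i \<subseteq> {y0}) (top_of_set (unit_cube i)) Y f g"
  proof (subst homotopic_with)
    show "(h ` cube_boundary i \<subseteq> {y0}) = (k ` cube_boundary i \<subseteq> {y0})"
      if "\<And>x. x \<in> topspace (top_of_set (unit_cube i)) \<Longrightarrow> h x = k x" for h k :: "(nat \<Rightarrow> real) \<Rightarrow> 'a"
      using that cube_boundary_subset[of i] by (intro arg_cong[where f = "\<lambda>X. X \<subseteq> {y0}"] image_cong) auto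
    show "\<exists>h. continuous_map (prod_topology (top_of_set {0..1::real}) (top_of_set (unit_cube i))) Y h \<and>
      (\<forall>x\<in>topspace (top_of_set (unit_cube i)). h (0, x) = f x) \<and>
      (\<forall>x\<in>topspace (top_of_set (unit_cube i)). h (1, x) = g x) \<and>
      (\<forall>t\<in>{0..1}. (\<lambda>x. h (t, x)) ` cube_boundary i \<subseteq> {y0})"
      using c f g b by (intro exI[of _ "H \<circ> (\<lambda>p. (snd p, fst p))"]) auto
  qed
  then show ?thesis by (simp add: cube_htpy_def pair_htpy_def)
qed

lemma cube_mapsD: "p \<in> cube_maps i Y y0 \<Longrightarrow> continuous_map (top_of_set (unit_cube i)) Y p"
    "p \<in> cube_maps i Y y0 \<Longrightarrow> t \<in> cube_boundary i \<Longrightarrow> p t = y0"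
  by (auto simp: cube_maps_def pair_maps_def)

lemma zero_in_cube_boundary: "i \<ge> 1 \<Longrightarrow> (\<lambda>_. 0) \<in> cube_boundary i"
  by (auto simp: cube_boundary_def unit_cube_def intro!: exI[of _ 0])

text \<open>On a face t_k = 0 all coordinates can be shrunk to 0 inside the boundary. On a face t_k
  = 1 the others are shrunk first; some second coordinate, available for i >= 2, is then 0 and
  allows t_k to be shrunk as well.\<close>

lemma connected_cube_boundary:
  assumes i: "i \<ge> 2"
  shows "connected (cube_boundary i)"
proof -
  let ?B = "cube_boundary i"
  have scl: "connected_component ?B t (\<lambda>j. if P j then t j else 0)"
    if t: "t \<in> unit_cube i" and k: "k < i" "(P k \<and> t k = 1) \<or> t k = 0" for t P k
  proof -
    define \<gamma> where "\<gamma> = (\<lambda>(s::real) j. if P j then t j else s * t j)"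
    have "continuous_on {0..1} \<gamma>"
    proof (rule continuous_on_coordinatewise_then_product)
      show "continuous_on {0..1} (\<lambda>s. \<gamma> s j)" for j
        unfolding \<gamma>_def by (cases "P j") (auto intro!: continuous_on_mult continuous_on_id continuous_on_const)
    qed
    then have "connected (\<gamma> ` {0..1})" by (intro connected_continuous_image) auto
    moreover have "\<gamma> ` {0..1} \<subseteq> ?B"
    proof clarify
      fix s :: real assume s: "s \<in> {0..1}"
      have "\<gamma> s \<in> unit_cube i" using t s by (auto simp: \<gamma>_def unit_cube_def mult_le_one)
      moreover have "\<gamma> s k = 0 \<or> \<gamma> s k = 1" using k by (auto simp: \<gamma>_def)
      ultimately show "\<gamma> s \<in> ?B" using k(1) unfolding cube_boundary_def by blast
    qed
    moreover have "t \<in> \<gamma> ` {0..1}" by (rule image_eqI[of _ _ 1]) (auto simp: \<gamma>_def)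
    moreover have "(\<lambda>j. if P j then t j else 0) \<in> \<gamma> ` {0..1}" by (rule image_eqI[of _ _ 0]) (auto simp: \<gamma>_def)
    ultimately show ?thesis unfolding connected_component_def by blast
  qed
  have "connected_component ?B t (\<lambda>_. 0)" if t: "t \<in> ?B" for t
  proof -
    obtain k where k: "k < i" "t k = 0 \<or> t k = 1" "t \<in> unit_cube i" using t unfolding cube_boundary_def by blast
    show ?thesis
    proof (cases "t k = 0")
      case True
      then show ?thesis using scl[OF k(3,1), of "\<lambda>_. False"] by simp
    next
      case False
      then have tk: "t k = 1" using k by simp
      define e where "e = (\<lambda>j. if j = k then t j else 0)"
      have 1: "connected_component ?B t e" unfolding e_def by (rule scl[OF k(3,1)]) (use tk in simp)
      obtain l where l: "l < i" "l \<noteq> k"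
      proof (cases "k = 0")
        case True then show ?thesis using that[of 1] i by simp
      next
        case False then show ?thesis using that[of 0] i by simp
      qed
      have "e \<in> unit_cube i" using k(3) by (auto simp: e_def unit_cube_def)
      then have "connected_component ?B e (\<lambda>j. if False then e j else 0)" by (rule scl[OF _ l(1)]) (use l in \<open>simp add: e_def\<close>)
      then show ?thesis using 1 connected_component_trans by fastforce
    qed
  qed
  then show ?thesis
    unfolding connected_iff_connected_component by (metis connected_component_sym connected_component_trans)
qed

context lens
begin

lemma lift_cube:
  assumes \<alpha>: "continuous_map (top_of_set (unit_cube i)) L \<alpha>" and t0: "t0 \<in> unit_cube i" "a \<in> S" "\<alpha> t0 = \<pi> a"
  shows "\<exists>u. continuous_on (unit_cube i) u \<and> u t0 = a \<and> (\<forall>t\<in>unit_cube i. u t \<in> S \<and> \<pi> (u t) = \<alpha> t)"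
proof (rule lift_from_contractible[OF compact_unit_cube continuous_on_scale])
  show "(\<lambda>(t, s) j. s * t j) ` (unit_cube i \<times> {0..1::real}) \<subseteq> unit_cube i" using unit_cube_scale by auto
qed (use assms in auto)

text \<open>The boundary is connected for i >= 2, so a lift with value a at one boundary point is
  constant there. For i = 1 the two ends may go to different points of the orbit.\<close>

lemma lift_cube_rel_boundary:
  assumes \<alpha>: "\<alpha> \<in> cube_maps i L (\<pi> a)" and i: "i \<ge> 2" and a: "a \<in> S"
  shows "\<exists>u. continuous_on (unit_cube i) u \<and> (\<forall>t\<in>cube_boundary i. u t = a) \<and> (\<forall>t\<in>unit_cube i. u t \<in> S \<and> \<pi> (u t) = \<alpha> t)"
proof -
  have z: "(\<lambda>_. 0) \<in> cube_boundary i" using zero_in_cube_boundary i by simp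
  obtain u where u: "continuous_on (unit_cube i) u" "u (\<lambda>_. 0) = a" "\<forall>t\<in>unit_cube i. u t \<in> S \<and> \<pi> (u t) = \<alpha> t"
    using lift_cube[OF cube_mapsD(1)[OF \<alpha>], of "\<lambda>_. 0" a] cube_mapsD(2)[OF \<alpha> z] z a cube_boundary_subset by blast
  have "u t = act 0 a" if t: "t \<in> cube_boundary i" for t
  proof (rule lifts_differ_by_deck[where G = "\<lambda>_. a" and G' = u and k = 0, OF connected_cube_boundary[OF i] _ _ _ _ z _ t])
    show "continuous_on (cube_boundary i) u" by (rule continuous_on_subset[OF u(1) cube_boundary_subset])
    show "\<pi> a = \<pi> (u x)" if "x \<in> cube_boundary i" for x
      using u(3) cube_mapsD(2)[OF \<alpha> that] that cube_boundary_subset by force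
  qed (use u a in auto)
  with u show ?thesis by auto
qed

text \<open>Over a fixed boundary point the lifted homotopy lifts a constant path, hence is
  constant. Its final map lifts g as v does, and the two agree at t0.\<close>

lemma lift_cube_htpy:
  assumes u: "continuous_on (unit_cube i) u" "\<And>t. t \<in> unit_cube i \<Longrightarrow> u t \<in> S"
    and v: "continuous_on (unit_cube i) v" "\<And>t. t \<in> unit_cube i \<Longrightarrow> v t \<in> S"
    and f: "\<And>t. t \<in> unit_cube i \<Longrightarrow> f t = \<pi> (u t)" and g: "\<And>t. t \<in> unit_cube i \<Longrightarrow> g t = \<pi> (v t)"
    and h: "(f, g) \<in> cube_htpy i L y0" and t0: "t0 \<in> cube_boundary i" "u t0 = v t0"
  shows "\<exists>H. continuous_on (unit_cube i \<times> {0..1::real}) H \<and> H ` (unit_cube i \<times> {0..1}) \<subseteq> S \<and>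
    (\<forall>t\<in>unit_cube i. H (t, 0) = u t \<and> H (t, 1) = v t) \<and> (\<forall>t\<in>cube_boundary i. \<forall>s\<in>{0..1}. H (t, s) = u t)"
proof -
  obtain h where h: "continuous_map (top_of_set (unit_cube i \<times> {0..1::real})) L h"
    "\<forall>t. h (t, 0) = f t \<and> h (t, 1) = g t" "\<forall>t\<in>cube_boundary i. \<forall>s\<in>{0..1}. h (t, s) = y0"
    using cube_htpyD[OF h] by blast
  obtain H where H: "continuous_on (unit_cube i \<times> {0..1}) H" "\<forall>t\<in>unit_cube i. H (t, 0) = u t"
    "\<forall>p\<in>unit_cube i \<times> {0..1}. H p \<in> S \<and> \<pi> (H p) = h p"
    using lift_homotopy[OF compact_unit_cube h(1) u] h(2) f by auto
  have bd: "H (t, s) = act 0 (u t)" if t: "t \<in> cube_boundary i" and s: "s \<in> {0..1}" for t s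
  proof (rule lifts_differ_by_deck[where G = "\<lambda>_. u t" and G' = "\<lambda>s. H (t, s)" and k = 0 and K = "{0..1::real}" and ?x0.0 = 0])
    have tc: "t \<in> unit_cube i" using t cube_boundary_subset by blast
    show "continuous_on {0..1} (\<lambda>s. H (t, s))"
      by (rule continuous_on_compose2[OF H(1) continuous_on_Pair[OF continuous_on_const continuous_on_id]]) (use tc in auto)
    show "u t \<in> S" using u(2) tc by blast
    have "\<pi> (u t) = y0" using f[OF tc] h(2) h(3)[rule_format, OF t, of 0] by simp
    then show "\<pi> (u t) = \<pi> (H (t, x))" if "x \<in> {0..1}" for x using H(3) h(3) t tc that by auto
    show "H (t, 0) = act 0 (u t)" using H(2) tc by simp
  qed (use s in auto)
  have t0c: "t0 \<in> unit_cube i" using t0 cube_boundary_subset by blast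
  have "v t = act 0 (H (t, 1))" if t: "t \<in> unit_cube i" for t
  proof (rule lifts_differ_by_deck[where G = "\<lambda>t. H (t, 1)" and G' = v and k = 0, OF connected_unit_cube _ v(1) _ _ t0c _ t])
    show "continuous_on (unit_cube i) (\<lambda>t. H (t, 1))"
      by (rule continuous_on_compose2[OF H(1) continuous_on_Pair[OF continuous_on_id continuous_on_const]]) auto
    show "H (x, 1) \<in> S" if "x \<in> unit_cube i" for x using H(3) that by simp
    show "\<pi> (H (x, 1)) = \<pi> (v x)" if "x \<in> unit_cube i" for x using H(3) h(2) g that by simp
    show "v t0 = act 0 (H (t0, 1))" using bd[OF t0(1), of 1] t0 by simp
  qed
  then show ?thesis using H bd by (intro exI[of _ H]) auto
qed

text \<open>Surjectivity in terms of representatives, so that lifts can be taken without passing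
  through homotopy classes.\<close>

definition pi_surj :: "nat \<Rightarrow> ((nat \<Rightarrow> complex) set \<Rightarrow> (nat \<Rightarrow> complex) set) \<Rightarrow> (nat \<Rightarrow> complex) \<Rightarrow> bool" where
  "pi_surj i f a \<longleftrightarrow> (\<forall>p\<in>cube_maps i L (\<pi> a). \<exists>\<alpha>\<in>cube_maps i L (\<pi> a). (f \<circ> \<alpha>, p) \<in> cube_htpy i L (\<pi> a))"

section \<open>Right inverses of maps that are onto on homotopy groups\<close>

text \<open>The loop covered by an arc from a to \<open>act 1 a\<close> is homotopic to the image of
  some loop, whose lift ends at some \<open>act k a\<close>. The lifted homotopy fixes the end
  points, so \<open>act (r * k) a\<close> is \<open>act 1 a\<close>.\<close>

lemma deck_degree_unit:
  assumes G: "continuous_on S G" "G ` S \<subseteq> S" "\<And>x. x \<in> S \<Longrightarrow> \<pi> (G x) = f (\<pi> x)" "G a = a"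
    "\<And>k x. x \<in> S \<Longrightarrow> G (act k x) = act (r * k) (G x)" and a: "a \<in> S" and surj: "pi_surj 1 f a"
  shows "\<exists>k. int m dvd r * k - 1"
proof -
  define v where "v = (\<lambda>(t::nat \<Rightarrow> real) j. a j * cis (2 * pi * of_int (wt j) * t 0 / real m))"
  have v: "continuous_on (unit_cube 1) v"
  proof (rule continuous_on_coordinatewise_then_product)
    fix j
    have "continuous_on (unit_cube 1) (\<lambda>t::nat \<Rightarrow> real. t 0)" by (rule continuous_on_coord[OF continuous_on_id])
    then show "continuous_on (unit_cube 1) (\<lambda>t. v t j)" unfolding v_def
      using m0 by (intro continuous_on_mult continuous_on_const continuous_on_cis continuous_on_divide) auto
  qed
  have vS: "v t \<in> S" for t using a by (auto simp: v_def complex_sphere_def norm_mult)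
  define z o1 where "z = (\<lambda>_::nat. 0::real)" and "o1 = (\<lambda>j::nat. if j = 0 then 1 else 0::real)"
  have bd: "cube_boundary 1 = {z, o1}"
  proof
    show "cube_boundary 1 \<subseteq> {z, o1}"
    proof
      fix t assume "t \<in> cube_boundary 1"
      then have t: "t 0 = 0 \<or> t 0 = 1" "\<And>j. j \<noteq> 0 \<Longrightarrow> t j = 0" by (auto simp: cube_boundary_def unit_cube_def)
      have "t = z" if "t 0 = 0" using that t(2) unfolding z_def by (intro ext) metis
      moreover have "t = o1" if "t 0 = 1" using that t(2) unfolding o1_def by (intro ext) metis
      ultimately show "t \<in> {z, o1}" using t(1) by blast
    qed
  qed (auto simp: cube_boundary_def unit_cube_def z_def o1_def)
  have zc: "z \<in> unit_cube 1" "o1 \<in> unit_cube 1" by (auto simp: z_def o1_def unit_cube_def)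
  have v0: "v z = a" by (simp add: v_def z_def)
  have v1: "v o1 = act 1 a" by (simp add: v_def o1_def act_def)
  have "(\<lambda>t. \<pi> (v t)) \<in> cube_maps 1 L (\<pi> a)"
    using continuous_map_orbit_compose[OF v] vS bd v0 v1 by (auto simp: cube_maps_def pair_maps_def)
  then obtain \<alpha> where \<alpha>: "\<alpha> \<in> cube_maps 1 L (\<pi> a)" "(f \<circ> \<alpha>, \<lambda>t. \<pi> (v t)) \<in> cube_htpy 1 L (\<pi> a)"
    using surj unfolding pi_surj_def by blast
  obtain u where u: "continuous_on (unit_cube 1) u" "u z = a" "\<forall>t\<in>unit_cube 1. u t \<in> S \<and> \<pi> (u t) = \<alpha> t"
    using lift_cube[OF cube_mapsD(1)[OF \<alpha>(1)] zc(1) a] cube_mapsD(2)[OF \<alpha>(1), of z] bd by auto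
  have "\<pi> a = \<pi> (u o1)" using u(3) cube_mapsD(2)[OF \<alpha>(1), of o1] bd zc by auto
  then obtain k where k: "u o1 = act k a" using orbit_eq_iff by blast
  have Gu: "continuous_on (unit_cube 1) (\<lambda>t. G (u t))" by (rule continuous_on_compose2[OF G(1) u(1)]) (use u in auto)
  have "\<exists>H. continuous_on (unit_cube 1 \<times> {0..1::real}) H \<and> H ` (unit_cube 1 \<times> {0..1}) \<subseteq> S \<and>
    (\<forall>t\<in>unit_cube 1. H (t, 0) = G (u t) \<and> H (t, 1) = v t) \<and> (\<forall>t\<in>cube_boundary 1. \<forall>s\<in>{0..1}. H (t, s) = G (u t))"
    by (rule lift_cube_htpy[OF Gu _ v _ _ _ \<alpha>(2), of z]) (use u G vS v0 bd in auto)
  then have "v o1 = G (u o1)" using bd zc by (metis atLeastAtMost_iff insertI1 insertI2 order_refl zero_le_one)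
  then have "act 1 a = act (r * k) a" using k v1 G(4,5) a by simp
  then have "int m dvd 1 - r * k" using act_inj[OF a] by blast
  then show ?thesis by (metis dvd_diff_commute)
qed

section \<open>Equivariant maps and deformations prescribed on a subset\<close>

lemma low_dim_sphere_0: "low_dim (2 * n + 1) (S \<times> {0::real})"
proof -
  have "low_dim (2 * n + 1) ((\<lambda>x. (x, 0::real)) ` S)"
    by (rule low_dim_lipschitz_image[OF low_dim_sphere, where L = 1]) (simp add: dist_Pair_Pair)
  then show ?thesis by (rule low_dim_subset) auto
qed

text \<open>Distinct points of P lie in distinct orbits, so the value \<open>act (k * l) a\<close>
  at \<open>act l y\<close> is well defined on the orbits through P. The rest is an extension
  problem over the sphere, of dimension 2n + 1. The map serves as a preliminary right inverse with
  room left for a correction.\<close>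

lemma equivariant_map_constant_on:
  assumes P: "closed P" "P \<subseteq> S" "\<And>y y' l. y \<in> P \<Longrightarrow> y' \<in> P \<Longrightarrow> act l y = y' \<Longrightarrow> int m dvd l" and a: "a \<in> S"
  shows "\<exists>g. continuous_on S g \<and> g ` S \<subseteq> S \<and> (\<forall>l. \<forall>z\<in>S. g (act l z) = act (k * l) (g z)) \<and> (\<forall>y\<in>P. g y = a)"
proof -
  define B where "B = (\<Union>l\<in>{0..<int m}. {p::(nat \<Rightarrow> complex) \<times> real. act (-l) (fst p) \<in> P \<and> snd p = 0})"
  define f where "f = (\<lambda>p::(nat \<Rightarrow> complex) \<times> real. act (k * (SOME l. act (-l) (fst p) \<in> P)) a)"
  have f: "f p = act (k * l) a" if "act (-l) (fst p) \<in> P" for p l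
  proof -
    define l' where "l' = (SOME l. act (-l) (fst p) \<in> P)"
    have "act (-l') (fst p) \<in> P" unfolding l'_def using that by (rule someI)
    moreover have "act (l - l') (act (-l) (fst p)) = act (-l') (fst p)" by simp
    ultimately have "int m dvd l - l'" using P(3) that by blast
    then have "int m dvd k * l' - k * l" by (metis dvd_diff_commute dvd_mult right_diff_distrib)
    then have "act (k * l') a = act (k * l) a" by (rule act_cong)
    then show ?thesis by (simp add: f_def flip: l'_def)
  qed
  have Biff: "p \<in> B \<longleftrightarrow> snd p = 0 \<and> (\<exists>l. act (-l) (fst p) \<in> P)" for p
  proof
    assume "snd p = 0 \<and> (\<exists>l. act (-l) (fst p) \<in> P)"
    then obtain l where l: "snd p = 0" "act (-l) (fst p) \<in> P" by blast
    have "act (-(l mod int m)) (fst p) = act (-l) (fst p)"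
      by (rule act_cong) (simp add: mod_eq_dvd_iff[symmetric] mod_minus_eq)
    then show "p \<in> B" unfolding B_def using l m2 by (intro UN_I[of "l mod int m"]) auto
  qed (auto simp: B_def)
  have cp: "closed {p::(nat \<Rightarrow> complex) \<times> real. act (-l) (fst p) \<in> P \<and> snd p = 0}" for l
  proof -
    have "closed ((\<lambda>p::(nat \<Rightarrow> complex) \<times> real. act (-l) (fst p)) -` P)"
      by (intro closed_vimage P(1) continuous_on_act continuous_on_fst continuous_on_id)
    moreover have "closed {p::(nat \<Rightarrow> complex) \<times> real. snd p = 0}"
      by (intro closed_Collect_eq continuous_on_snd continuous_on_id continuous_on_const)
    moreover have "{p::(nat \<Rightarrow> complex) \<times> real. act (-l) (fst p) \<in> P \<and> snd p = 0} = ((\<lambda>p. act (-l) (fst p)) -` P) \<inter> {p. snd p = 0}" by auto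
    ultimately show ?thesis using closed_Int by metis
  qed
  obtain g where g: "continuous_on (S \<times> {0::real}) g" "g ` (S \<times> {0}) \<subseteq> S"
    "\<And>l p. p \<in> S \<times> {0} \<Longrightarrow> g (act1 l p) = act (k * l) (g p)" "\<And>p. p \<in> B \<Longrightarrow> g p = f p"
  proof (rule equivariant_extension[where X = "S \<times> {0::real}" and B = B and f = f and r = k and d = "2 * n + 1"])
    show "compact (S \<times> {0::real})" by (intro compact_Times compact_complex_sphere) simp
    show "closed B" unfolding B_def using cp by (intro closed_UN) auto
    show "continuous_on B f" unfolding B_def
    proof (intro continuous_on_closed_Union cp)
      show "continuous_on {p. act (-l) (fst p) \<in> P \<and> snd p = 0} f" for l
        by (rule continuous_on_eq[OF continuous_on_const[of _ "act (k * l) a"]]) (use f in auto)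
    qed simp
    show "B \<subseteq> S \<times> {0}"
    proof
      fix p assume "p \<in> B"
      then obtain l where "snd p = 0" "act (-l) (fst p) \<in> S" using P(2) unfolding Biff by blast
      then show "p \<in> S \<times> {0}" by (simp add: mem_Times_iff)
    qed
    show "f ` B \<subseteq> S" using a by (auto simp: f_def)
    fix l p assume "p \<in> B"
    then obtain l' where l': "snd p = 0" "act (-l') (fst p) \<in> P" unfolding Biff by blast
    then have l2: "act (-(l + l')) (fst (act1 l p)) \<in> P" by simp
    then show "act1 l p \<in> B" using l'(1) unfolding Biff act1_simps by blast
    show "f (act1 l p) = act (k * l) (f p)" using f[OF l2] f[OF l'(2)] by (simp add: distrib_left)
  qed (use low_dim_sphere_0 in \<open>auto simp: act1_def\<close>)
  show ?thesis
  proof (intro exI[of _ "\<lambda>z. g (z, 0)"] conjI allI ballI)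
    show "continuous_on S (\<lambda>z. g (z, 0))"
      by (rule continuous_on_compose2[OF g(1) continuous_on_Pair[OF continuous_on_id continuous_on_const]]) auto
    show "g (act l z, 0) = act (k * l) (g (z, 0))" if "z \<in> S" for l z
      using g(3)[of "(z,0)" l] that by (simp add: act1_def)
    show "g (y, 0) = a" if y: "y \<in> P" for y
    proof -
      have "\<exists>l. act (-l) (fst (y, 0::real)) \<in> P" by (rule exI[of _ 0]) (use y in simp)
      then have "(y, 0) \<in> B" unfolding Biff by simp
      moreover have "f (y, 0) = act (k * 0) a" by (rule f) (use y in simp)
      ultimately have "(y, 0) \<in> B" "f (y, 0) = act (k * 0) a" by blast+
      then show ?thesis using g(4) by simp
    qed
  qed (use g(2) in auto)
qed


lemma low_dim_skel_prism:
  assumes "cmod \<zeta> = 1"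
  shows "low_dim (2 * n + 1) (skel \<zeta> \<times> {0..1::real})"
  using low_dim_Times_interval[OF low_dim_skel[OF assms]] by simp

text \<open>The skeleton times the interval has dimension 2n + 1, just within the range of the
  extension theorem. Apart from the two end maps the homotopy is prescribed to be stationary on the
  orbit of a, which h fixes pointwise.\<close>

lemma deform_to_identity_over_skel:
  assumes zeta: "cmod \<zeta> = 1" and a: "a \<in> skel \<zeta>" "h a = a"
    and h: "continuous_on S h" "h ` S \<subseteq> S" "\<And>l z. z \<in> S \<Longrightarrow> h (act l z) = act l (h z)"
  shows "\<exists>K. continuous_on (skel \<zeta> \<times> {0..1::real}) K \<and> K ` (skel \<zeta> \<times> {0..1}) \<subseteq> S \<and>
    (\<forall>l. \<forall>z\<in>skel \<zeta>. \<forall>s\<in>{0..1}. K (act l z, s) = act l (K (z, s))) \<and>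
    (\<forall>z\<in>skel \<zeta>. K (z, 0) = h z \<and> K (z, 1) = z) \<and> (\<forall>s\<in>{0..1}. K (a, s) = a)"
proof -
  let ?Z = "skel \<zeta>"
  note ZS = skel_subset[OF zeta] and aS = act_skel[OF zeta]
  define A where "A = (\<Union>l\<in>{0..<int m}. {act l a})"
  have A: "z \<in> A \<longleftrightarrow> (\<exists>l. z = act l a)" for z
  proof
    assume "\<exists>l. z = act l a"
    then obtain l where "z = act (l mod int m) a" by (auto simp: act_mod)
    moreover have "l mod int m \<in> {0..<int m}" using m2 by simp
    ultimately show "z \<in> A" unfolding A_def by blast
  qed (auto simp: A_def)
  have clA: "closed A" unfolding A_def by (intro closed_UN) auto
  have Ainv: "act l z \<in> A" if "z \<in> A" for l z using that unfolding A by (metis act_act)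
  have AZ: "A \<subseteq> ?Z" using a aS by (auto simp: A)
  have hA: "h z = z" if "z \<in> A" for z using that a h(3) ZS by (auto simp: A)
  define B where "B = ?Z \<times> {0} \<union> (?Z \<times> {1} \<union> A \<times> {0..1::real})"
  define f where "f = (\<lambda>p::(nat \<Rightarrow> complex) \<times> real. if snd p = 0 then h (fst p) else fst p)"
  have clZ: "closed ?Z" by (rule closed_skel[OF zeta])
  obtain K where K: "continuous_on (?Z \<times> {0..1::real}) K" "K ` (?Z \<times> {0..1}) \<subseteq> S"
    "\<And>l p. p \<in> ?Z \<times> {0..1} \<Longrightarrow> K (act1 l p) = act (1 * l) (K p)" "\<And>p. p \<in> B \<Longrightarrow> K p = f p"
  proof (rule equivariant_extension[where X = "?Z \<times> {0..1::real}" and B = B and f = f and r = 1 and d = "2 * n + 1"])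
    show "compact (?Z \<times> {0..1::real})" by (intro compact_Times compact_skel[OF zeta] compact_Icc)
    show "closed B" unfolding B_def by (intro closed_Un closed_Times clZ clA) auto
    show "B \<subseteq> ?Z \<times> {0..1}" using AZ by (auto simp: B_def)
    have "continuous_on (?Z \<times> {0::real}) f"
    proof (rule continuous_on_eq)
      show "continuous_on (?Z \<times> {0::real}) (\<lambda>p. h (fst p))"
        by (rule continuous_on_compose2[OF h(1) continuous_on_fst[OF continuous_on_id]]) (use ZS in auto)
    qed (auto simp: f_def)
    moreover have "continuous_on (?Z \<times> {1} \<union> A \<times> {0..1::real}) f"
      by (rule continuous_on_eq[OF continuous_on_fst[OF continuous_on_id]]) (use hA in \<open>auto simp: f_def\<close>)
    moreover have "closed (?Z \<times> {0::real})" "closed (?Z \<times> {1} \<union> A \<times> {0..1::real})"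
      by (intro closed_Un closed_Times clZ clA; simp)+
    ultimately show "continuous_on B f" unfolding B_def using continuous_on_closed_Un by blast
    show "f ` B \<subseteq> S" using h(2) ZS AZ by (fastforce simp: f_def B_def image_subset_iff subset_iff)
    fix l p assume p: "p \<in> B"
    show "act1 l p \<in> B" using p aS Ainv by (auto simp: B_def act1_def)
    have "fst p \<in> S" using p ZS AZ by (auto simp: B_def)
    then show "f (act1 l p) = act (1 * l) (f p)" using h(3) by (simp add: f_def)
  qed (use low_dim_skel_prism[OF zeta] ZS aS in \<open>auto simp: act1_def\<close>)
  have aA: "a \<in> A" unfolding A by (intro exI[of _ 0]) simp
  show ?thesis
  proof (intro exI[of _ K] conjI allI ballI)
    show "K (act l z, s) = act l (K (z, s))" if "z \<in> ?Z" "s \<in> {0..1}" for l z s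
      using K(3)[of "(z,s)" l] that by (simp add: act1_def)
    show "K (z, 0) = h z" "K (z, 1) = z" if "z \<in> ?Z" for z
      using K(4)[of "(z,0)"] K(4)[of "(z,1)"] that by (auto simp: f_def B_def)
    show "K (a, s) = a" if "s \<in> {0..1}" for s
      using K(4)[of "(a,s)"] that aA hA[OF aA] by (auto simp: f_def B_def)
  qed (use K in auto)
qed

text \<open>After deforming over the skeleton, a map that commutes with the action differs from the
  identity only by a map of the inner half of the cell, which is an element of the top homotopy group.\<close>

lemma deform_to_identity_off_inner_cell:
  assumes zeta: "cmod \<zeta> = 1" and a: "a \<in> skel \<zeta>" "h a = a"
    and h: "continuous_on S h" "h ` S \<subseteq> S" "\<And>l z. z \<in> S \<Longrightarrow> h (act l z) = act l (h z)"
  shows "\<exists>W. continuous_on (S \<times> {0..1::real}) W \<and> W ` (S \<times> {0..1}) \<subseteq> S \<and>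
    (\<forall>l. \<forall>z\<in>S. \<forall>s\<in>{0..1}. W (act l z, s) = act (1 * l) (W (z, s))) \<and>
    (\<forall>z\<in>S. W (z, 1) = z) \<and> (\<forall>s\<in>{0..1}. W (a, s) = a) \<and> (\<forall>z\<in>skel \<zeta>. W (z, 0) = h z) \<and>
    (\<forall>t\<in>unit_cube (2 * n + 1). cmax (2 * n + 1) t \<ge> 1/2 \<longrightarrow> W (cell \<zeta> t, 0) = h (cell \<zeta> t))"
proof -
  let ?Z = "skel \<zeta>" and ?c = "cell \<zeta>" and ?N = "2 * n + 1" and ?C = "unit_cube (2 * n + 1)"
  have bdC: "t \<in> cube_boundary ?N \<longleftrightarrow> cmax ?N t = 1" if "t \<in> ?C" for t
    using that by (simp add: cube_boundary_iff unit_cube_iff)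
  have bdZ: "?c t \<in> ?Z" if "t \<in> cube_boundary ?N" for t
    using cell_in_skel_iff[OF zeta] that cube_boundary_subset by blast
  have cS: "?c t \<in> S" if "t \<in> ?C" for t using cell_in_sphere[OF zeta that] .
  obtain K where K: "continuous_on (?Z \<times> {0..1::real}) K" "K ` (?Z \<times> {0..1}) \<subseteq> S"
    "\<And>l z s. z \<in> ?Z \<Longrightarrow> s \<in> {0..1} \<Longrightarrow> K (act l z, s) = act l (K (z, s))"
    "\<And>z. z \<in> ?Z \<Longrightarrow> K (z, 0) = h z" "\<And>z. z \<in> ?Z \<Longrightarrow> K (z, 1) = z" "\<And>s. s \<in> {0..1} \<Longrightarrow> K (a, s) = a"
    using deform_to_identity_over_skel[where h = h, OF zeta a h] by blast
  define T1 where "T1 = cube_boundary ?N \<times> {0..1::real}"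
  define T2 where "T2 = ?C \<times> {1::real}"
  define T3 where "T3 = (?C \<inter> {t. cmax ?N t \<ge> 1/2}) \<times> {0::real}"
  have Teq: "{p \<in> ?C \<times> {0..1::real}. cmax ?N (fst p) = 1 \<or> snd p = 1 \<or> (snd p = 0 \<and> cmax ?N (fst p) \<ge> 1/2)} = T1 \<union> (T2 \<union> T3)"
    using bdC cube_boundary_subset[of ?N] by (auto simp: T1_def T2_def T3_def)
  obtain R where R: "continuous_on (?C \<times> {0..1}) R" "R ` (?C \<times> {0..1}) \<subseteq> T1 \<union> (T2 \<union> T3)"
    "\<And>p. p \<in> T1 \<union> (T2 \<union> T3) \<Longrightarrow> R p = p"
    using cube_retraction[of ?N] unfolding Teq by blast
  \<comment> \<open>Data on the side, the top and the outer half of the bottom of the prism over the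
    cell. Composition with the retraction fills in the rest, so the inner half of the bottom
    receives whatever this produces.\<close>
  define V0 where "V0 = (\<lambda>(t, s). if t \<in> cube_boundary ?N then K (?c t, s) else if s = 1 then ?c t else h (?c t))"
  have cl: "closed T1" "closed T2" "closed T3"
  proof -
    show "closed T1" unfolding T1_def by (intro closed_Times compact_imp_closed[OF compact_cube_boundary]) auto
    show "closed T2" unfolding T2_def by (intro closed_Times compact_imp_closed[OF compact_unit_cube]) auto
    have "closed {t. cmax ?N t \<ge> 1/2}"
      by (intro closed_Collect_le continuous_on_const continuous_on_cmax continuous_on_id)
    then show "closed T3" unfolding T3_def by (intro closed_Times closed_Int compact_imp_closed[OF compact_unit_cube]) auto
  qed
  have cc: "continuous_on X (\<lambda>p::(nat \<Rightarrow> real) \<times> real. ?c (fst p))" if "fst ` X \<subseteq> ?C" for X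
    by (rule continuous_on_compose2[OF continuous_on_cell[OF zeta] continuous_on_fst[OF continuous_on_id] that])
  have V0: "V0 (t, 1) = ?c t" "t \<in> ?C \<Longrightarrow> V0 (t, 0) = h (?c t)" for t
    using K(4,5) bdZ by (auto simp: V0_def)
  have "continuous_on T1 V0"
  proof (rule continuous_on_eq)
    show "continuous_on T1 (\<lambda>p. K (?c (fst p), snd p))"
      by (rule continuous_on_compose2[OF K(1) continuous_on_Pair[OF cc continuous_on_snd[OF continuous_on_id]]])
        (use bdZ cube_boundary_subset in \<open>auto simp: T1_def\<close>)
  qed (auto simp: V0_def T1_def)
  moreover have "continuous_on T2 V0"
    by (rule continuous_on_eq[OF cc]) (use V0 in \<open>auto simp: T2_def\<close>)
  moreover have "continuous_on T3 V0"
  proof (rule continuous_on_eq)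
    show "continuous_on T3 (\<lambda>p. h (?c (fst p)))"
      by (rule continuous_on_compose2[OF h(1) cc]) (use cS in \<open>auto simp: T3_def\<close>)
  qed (use V0 in \<open>auto simp: T3_def\<close>)
  ultimately have cV0: "continuous_on (T1 \<union> (T2 \<union> T3)) V0" using cl by (intro continuous_on_closed_Un closed_Un)
  define V where "V = (\<lambda>p. V0 (R p))"
  have cV: "continuous_on (?C \<times> {0..1}) V" unfolding V_def by (rule continuous_on_compose2[OF cV0 R(1,2)])
  have V0S: "V0 p \<in> S" if "p \<in> T1 \<union> (T2 \<union> T3)" for p
    using that K(2) bdZ cS h(2) by (fastforce simp: V0_def T1_def T2_def T3_def image_subset_iff)
  have VS: "V ` (?C \<times> {0..1}) \<subseteq> S" unfolding V_def using V0S R(2) by blast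
  have VK: "V (t, s) = K (?c t, s)" if "t \<in> cube_boundary ?N" "s \<in> {0..1}" for t s
    using R(3)[of "(t,s)"] that by (simp add: V_def V0_def T1_def)
  have V1: "V (t, 1) = ?c t" if "t \<in> ?C" for t
    using R(3)[of "(t,1)"] that V0 by (simp add: V_def T2_def)
  have Vh: "V (t, 0) = h (?c t)" if "t \<in> ?C" "cmax ?N t \<ge> 1/2" for t
    using R(3)[of "(t,0)"] that V0 by (simp add: V_def T3_def)
  have K1: "\<And>l z s. z \<in> ?Z \<Longrightarrow> s \<in> {0..1} \<Longrightarrow> K (act l z, s) = act (1 * l) (K (z, s))" using K(3) by simp
  obtain W where W: "continuous_on (S \<times> {0..1}) W" "W ` (S \<times> {0..1}) \<subseteq> S"
    "\<forall>k. \<forall>z\<in>S. \<forall>s\<in>{0..1}. W (act k z, s) = act (1 * k) (W (z, s))"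
    "\<forall>z\<in>?Z. \<forall>s\<in>{0..1}. W (z, s) = K (z, s)" "\<forall>t\<in>?C. \<forall>s\<in>{0..1}. W (?c t, s) = V (t, s)"
    using glue_cell[where U = K and V = V and r = 1, OF zeta K(1,2) K1 cV VS VK] by blast
  have W1: "W (z, 1) = z" if z: "z \<in> S" for z
  proof (cases "z \<in> ?Z")
    case True
    then show ?thesis using W(4) K(5) by simp
  next
    case False
    then obtain k t where kt: "t \<in> ?C" "z = act k (?c t)" using cell_cover[OF zeta z] by metis
    have "W (z, 1) = act (1 * k) (W (?c t, 1))" using W(3) kt cS by simp
    also have "\<dots> = z" using W(5) kt V1 by simp
    finally show ?thesis .
  qed
  show ?thesis
    by (intro exI[of _ W] conjI ballI impI) (use W W1 K(4,6) a Vh in auto)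
qed

text \<open>A map g0 with the inverse exponent is made constant on the inner half of the cell, so W
  at time 0 restricts there to a cube whose boundary goes to a. Surjectivity on the top homotopy
  group writes this element as the image of some \<alpha>. Inserting a lift of \<alpha> into g0 in
  place of the constant gives g, and F after g is equivariantly homotopic to W at time 0 and from
  there to the identity.\<close>

proposition right_inverse_up_to_homotopy:
  assumes f: "continuous_map L L f" and a: "a \<in> S" "f (\<pi> a) = \<pi> a"
    and surj: "pi_surj 1 f a" "pi_surj (2 * n + 1) f a"
  shows "\<exists>g. continuous_map L L g \<and> g (\<pi> a) = \<pi> a \<and> homotopic_with (\<lambda>h. h ` {\<pi> a} \<subseteq> {\<pi> a}) L L (f \<circ> g) id"
proof -
  let ?N = "2 * n + 1" and ?C = "unit_cube (2 * n + 1)"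
  obtain F r where F: "continuous_on S F" "F ` S \<subseteq> S" "F a = a" "\<And>x. x \<in> S \<Longrightarrow> \<pi> (F x) = f (\<pi> x)"
    "\<And>k x. x \<in> S \<Longrightarrow> F (act k x) = act (r * k) (F x)"
    using lift_self_map[OF f a(1) a(1) a(2)] by blast
  obtain k where k: "int m dvd r * k - 1"
    using deck_degree_unit[OF F(1,2,4,3,5) a(1) surj(1)] by blast
  \<comment> \<open>The exponents r and k are inverse modulo m, so F after g0 commutes with the
    action.\<close>
  have rk: "act (r * (k * l)) z = act l z" for l z
  proof (rule act_cong)
    have "r * (k * l) - l = (r * k - 1) * l" by (simp add: algebra_simps)
    then show "int m dvd r * (k * l) - l" using k by simp
  qed
  \<comment> \<open>This phase puts a on the skeleton, away from the open cell in which g0 will be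
    changed; for a 0 = 0 any phase does.\<close>
  define \<zeta> where "\<zeta> = (if a 0 = 0 then 1 else a 0 / of_real (cmod (a 0)))"
  have zeta: "cmod \<zeta> = 1" by (simp add: \<zeta>_def norm_divide)
  let ?Z = "skel \<zeta>" and ?c = "cell \<zeta>"
  have "\<zeta> * of_real (cmod (a 0)) = a 0" by (simp add: \<zeta>_def)
  then have aZ: "a \<in> ?Z" using a by (simp add: skel_def[OF zeta])
  have cS: "?c t \<in> S" if "t \<in> ?C" for t using cell_in_sphere[OF zeta that] .
  have cZ: "?c t \<in> ?Z \<longleftrightarrow> t \<in> cube_boundary ?N" if "t \<in> ?C" for t using cell_in_skel_iff[OF zeta that] .
  note ZS = skel_subset[OF zeta]
  \<comment> \<open>The inner half of the cell, disjoint from the cube boundary; g0 is made constant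
    there to leave room for an element of the homotopy group.\<close>
  define Q where "Q = ?C \<inter> {t. cmax ?N t \<le> 1/2}"
  have Qc: "compact Q" unfolding Q_def
    by (intro compact_Int_closed compact_unit_cube closed_Collect_le continuous_on_const continuous_on_cmax continuous_on_id)
  have Qb: "t \<notin> cube_boundary ?N" if "t \<in> Q" for t using that by (auto simp: Q_def cube_boundary_iff)
  define P where "P = insert a (?c ` Q)"
  have Pcl: "closed P" unfolding P_def
    by (intro closed_insert compact_imp_closed compact_continuous_image Qc continuous_on_subset[OF continuous_on_cell[OF zeta]]) (auto simp: Q_def)
  have PS: "P \<subseteq> S" using a cS by (auto simp: P_def Q_def)
  \<comment> \<open>The point a lies on the invariant skeleton and the other points of P in the open
    cell, so a translation inside P falls under \<open>act_free\<close> or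
    \<open>cell_inj\<close>.\<close>
  have Pd: "int m dvd l" if y: "y \<in> P" "y' \<in> P" and e: "act l y = y'" for y y' l
  proof -
    have QZ: "?c t \<notin> ?Z" if "t \<in> Q" for t using cZ Qb that by (auto simp: Q_def)
    have "y \<in> ?Z \<longleftrightarrow> y' \<in> ?Z" using act_skel[OF zeta, of l y] e by simp
    then consider "y = a" "y' = a" | t t' where "t \<in> Q" "t' \<in> Q" "y = ?c t" "y' = ?c t'"
      using y aZ QZ unfolding P_def by auto
    then show ?thesis
    proof cases
      case 1
      then show ?thesis using act_free[OF a(1)] e by simp
    next
      case 2
      then show ?thesis using cell_inj[OF zeta, of t t' l] e Qb by (auto simp: Q_def)
    qed
  qed
  obtain g0 where g0: "continuous_on S g0" "g0 ` S \<subseteq> S" "\<And>l z. z \<in> S \<Longrightarrow> g0 (act l z) = act (k * l) (g0 z)"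
    "\<And>y. y \<in> P \<Longrightarrow> g0 y = a"
  proof -
    have "\<exists>g. continuous_on S g \<and> g ` S \<subseteq> S \<and> (\<forall>l. \<forall>z\<in>S. g (act l z) = act (k * l) (g z)) \<and> (\<forall>y\<in>P. g y = a)"
      by (rule equivariant_map_constant_on) (fact Pcl PS Pd a(1))+
    then show thesis using that by blast
  qed
  have g0a: "g0 a = a" using g0(4) by (simp add: P_def)
  have g0Q: "g0 (?c t) = a" if "t \<in> Q" for t using g0(4) that by (simp add: P_def)
  define h where "h = (\<lambda>z. F (g0 z))"
  have ch: "continuous_on S h" unfolding h_def by (rule continuous_on_compose2[OF F(1) g0(1,2)])
  have hS: "h ` S \<subseteq> S" using F(2) g0(2) by (auto simp: h_def)
  have h: "h (act l z) = act l (h z)" if "z \<in> S" for l z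
  proof -
    have "g0 z \<in> S" using g0(2) that by blast
    then show ?thesis using g0(3)[OF that] F(5) rk by (simp add: h_def)
  qed
  have ha: "h a = a" by (simp add: h_def g0a F(3))
  have hQ: "h (?c t) = a" if "t \<in> Q" for t using g0Q[OF that] F(3) by (simp add: h_def)
  have "\<exists>W. continuous_on (S \<times> {0..1::real}) W \<and> W ` (S \<times> {0..1}) \<subseteq> S \<and>
    (\<forall>l. \<forall>z\<in>S. \<forall>s\<in>{0..1}. W (act l z, s) = act (1 * l) (W (z, s))) \<and>
    (\<forall>z\<in>S. W (z, 1) = z) \<and> (\<forall>s\<in>{0..1}. W (a, s) = a) \<and> (\<forall>z\<in>?Z. W (z, 0) = h z) \<and>
    (\<forall>t\<in>?C. cmax ?N t \<ge> 1/2 \<longrightarrow> W (?c t, 0) = h (?c t))"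
    by (rule deform_to_identity_off_inner_cell) (fact zeta aZ ha ch hS h)+
  then obtain W where W': "continuous_on (S \<times> {0..1::real}) W" "W ` (S \<times> {0..1}) \<subseteq> S"
    "\<forall>l. \<forall>z\<in>S. \<forall>s\<in>{0..1}. W (act l z, s) = act (1 * l) (W (z, s))"
    "\<forall>z\<in>S. W (z, 1) = z" "\<forall>s\<in>{0..1}. W (a, s) = a" "\<forall>z\<in>?Z. W (z, 0) = h z"
    "\<forall>t\<in>?C. cmax ?N t \<ge> 1/2 \<longrightarrow> W (?c t, 0) = h (?c t)"
    by (elim exE conjE) (rule that)
  then have W: "continuous_on (S \<times> {0..1::real}) W" "W ` (S \<times> {0..1}) \<subseteq> S"
    "\<And>l z s. z \<in> S \<Longrightarrow> s \<in> {0..1} \<Longrightarrow> W (act l z, s) = act (1 * l) (W (z, s))"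
    "\<And>z. z \<in> S \<Longrightarrow> W (z, 1) = z" "\<And>s. s \<in> {0..1} \<Longrightarrow> W (a, s) = a" "\<And>z. z \<in> ?Z \<Longrightarrow> W (z, 0) = h z"
    "\<And>t. t \<in> ?C \<Longrightarrow> cmax ?N t \<ge> 1/2 \<Longrightarrow> W (?c t, 0) = h (?c t)"
    by simp_all
  \<comment> \<open>Affine maps between the full cube and its inner half, \<open>sc\<close>
    shrinking and \<open>ex\<close> expanding about the centre.\<close>
  define sc where "sc = (\<lambda>(t::nat \<Rightarrow> real) j. if j < ?N then 1/4 + t j / 2 else 0)"
  define ex where "ex = (\<lambda>(t::nat \<Rightarrow> real) j. if j < ?N then 2 * t j - 1/2 else 0)"
  have cm_sc: "cmax ?N (sc t) = cmax ?N t / 2" for t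
  proof -
    have "cmax ?N (sc t) = smax ?N (\<lambda>j. (1/2) * (2 * t j - 1))" unfolding cmax_def by (rule smax_cong) (simp add: sc_def)
    also have "\<dots> = (1/2) * cmax ?N t" unfolding cmax_def by (rule smax_scale) simp
    finally show ?thesis by simp
  qed
  have cm_ex: "cmax ?N (ex t) = 2 * cmax ?N t" for t
  proof -
    have "cmax ?N (ex t) = smax ?N (\<lambda>j. 2 * (2 * t j - 1))" unfolding cmax_def by (rule smax_cong) (simp add: ex_def)
    also have "\<dots> = 2 * cmax ?N t" unfolding cmax_def by (rule smax_scale) simp
    finally show ?thesis .
  qed
  have csc: "continuous_on X sc" for X unfolding sc_def
  proof (rule continuous_on_coordinatewise_then_product)
    have "continuous_on X (\<lambda>t::nat \<Rightarrow> real. t j)" for j by (rule continuous_on_coord[OF continuous_on_id])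
    then show "continuous_on X (\<lambda>t. if j < ?N then 1/4 + t j / 2 else 0)" for j
      by (cases "j < ?N") (auto intro!: continuous_on_add continuous_on_divide continuous_on_const)
  qed
  have cex: "continuous_on X ex" for X unfolding ex_def
  proof (rule continuous_on_coordinatewise_then_product)
    have "continuous_on X (\<lambda>t::nat \<Rightarrow> real. t j)" for j by (rule continuous_on_coord[OF continuous_on_id])
    then show "continuous_on X (\<lambda>t. if j < ?N then 2 * t j - 1/2 else 0)" for j
      by (cases "j < ?N") (auto intro!: continuous_on_diff continuous_on_mult continuous_on_const)
  qed
  have sc_ex: "sc (ex t) = t" if "t \<in> ?C" for t
    using that by (auto simp: sc_def ex_def unit_cube_def fun_eq_iff diff_divide_distrib)
  have scQ: "sc t \<in> Q" if "t \<in> ?C" for t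
    using that cm_sc[of t] by (auto simp: Q_def unit_cube_iff) (auto simp: sc_def)
  have exC: "ex t \<in> ?C" if "t \<in> Q" for t
    using that cm_ex[of t] by (auto simp: Q_def unit_cube_iff) (auto simp: ex_def)
  have exB: "ex t \<in> cube_boundary ?N" if "t \<in> Q" "cmax ?N t = 1/2" for t
    using cm_ex[of t] that by (auto simp: cube_boundary_iff) (auto simp: ex_def)
  \<comment> \<open>The element of the top homotopy group to be cancelled. Its boundary goes to a
    because at the edge of the inner half W at time 0 still equals h, which is a there.\<close>
  define b where "b = (\<lambda>t. W (?c (sc t), 0))"
  have bS: "b t \<in> S" if "t \<in> ?C" for t
    unfolding b_def using W(2) cS scQ[OF that] by (auto simp: Q_def image_subset_iff)
  have cb: "continuous_on ?C b" unfolding b_def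
    by (rule continuous_on_compose2[OF W(1) continuous_on_Pair[OF continuous_on_compose2[OF continuous_on_cell[OF zeta] csc] continuous_on_const]])
      (use scQ cS in \<open>auto simp: Q_def\<close>)
  have bB: "b t = a" if "t \<in> cube_boundary ?N" for t
  proof -
    have tC: "t \<in> ?C" using that cube_boundary_subset by blast
    have "cmax ?N (sc t) = 1/2" using that cm_sc[of t] by (simp add: cube_boundary_iff)
    then have "b t = h (?c (sc t))" unfolding b_def using W(7) scQ[OF tC] by (simp add: Q_def)
    then show ?thesis using hQ scQ[OF tC] by simp
  qed
  have "(\<lambda>t. \<pi> (b t)) \<in> cube_maps ?N L (\<pi> a)"
    using continuous_map_orbit_compose[OF cb] bS bB by (auto simp: cube_maps_def pair_maps_def)
  then obtain \<alpha> where \<alpha>: "\<alpha> \<in> cube_maps ?N L (\<pi> a)" "(f \<circ> \<alpha>, \<lambda>t. \<pi> (b t)) \<in> cube_htpy ?N L (\<pi> a)"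
    using surj(2) unfolding pi_surj_def by blast
  have N2: "?N \<ge> 2" using n1 by simp
  obtain u where u: "continuous_on ?C u" "\<And>t. t \<in> cube_boundary ?N \<Longrightarrow> u t = a" "\<And>t. t \<in> ?C \<Longrightarrow> u t \<in> S" "\<And>t. t \<in> ?C \<Longrightarrow> \<pi> (u t) = \<alpha> t"
    using lift_cube_rel_boundary[OF \<alpha>(1) N2 a(1)] by blast
  have z0: "(\<lambda>_. 0) \<in> cube_boundary ?N" by (rule zero_in_cube_boundary) simp
  have cFu: "continuous_on ?C (\<lambda>t. F (u t))" by (rule continuous_on_compose2[OF F(1) u(1)]) (use u in auto)
  have "\<exists>H. continuous_on (?C \<times> {0..1::real}) H \<and> H ` (?C \<times> {0..1}) \<subseteq> S \<and>
    (\<forall>t\<in>?C. H (t, 0) = F (u t) \<and> H (t, 1) = b t) \<and> (\<forall>t\<in>cube_boundary ?N. \<forall>s\<in>{0..1}. H (t, s) = F (u t))"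
  proof (rule lift_cube_htpy[OF cFu _ cb _ _ _ \<alpha>(2) z0])
    show "F (u (\<lambda>_. 0)) = b (\<lambda>_. 0)" using u(2)[OF z0] bB[OF z0] F(3) by simp
  qed (use u F bS in auto)
  then obtain H where H: "continuous_on (?C \<times> {0..1::real}) H" "H ` (?C \<times> {0..1}) \<subseteq> S"
    "\<And>t. t \<in> ?C \<Longrightarrow> H (t, 0) = F (u t)" "\<And>t. t \<in> ?C \<Longrightarrow> H (t, 1) = b t"
    "\<And>t s. t \<in> cube_boundary ?N \<Longrightarrow> s \<in> {0..1} \<Longrightarrow> H (t, s) = a"
    using u(2) F(3) by auto
  define Q' where "Q' = ?C \<inter> {t. cmax ?N t \<ge> 1/2}"
  have Q'cl: "closed Q'" unfolding Q'_def
    by (intro closed_Int compact_imp_closed[OF compact_unit_cube] closed_Collect_le continuous_on_const continuous_on_cmax continuous_on_id)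
  have QQ: "Q \<union> Q' = ?C" by (auto simp: Q_def Q'_def)
  \<comment> \<open>A map of the full cube is inserted into the inner half and joined with D on the
    outer half; on the common edge both are a. This is used once for g and once for the
    homotopy.\<close>
  have paste: "continuous_on (?C \<times> {0..1::real}) (\<lambda>p. if fst p \<in> Q then A (ex (fst p), snd p) else D (?c (fst p)))"
    if A: "continuous_on (?C \<times> {0..1::real}) A" "\<And>t s. t \<in> cube_boundary ?N \<Longrightarrow> s \<in> {0..1} \<Longrightarrow> A (t, s) = a"
      and D: "continuous_on S D" "\<And>t. t \<in> Q \<Longrightarrow> D (?c t) = a" for A :: "_ \<Rightarrow> nat \<Rightarrow> complex" and D
  proof -
    have "continuous_on (Q \<times> {0..1::real} \<union> Q' \<times> {0..1}) (\<lambda>p. if fst p \<in> Q then A (ex (fst p), snd p) else D (?c (fst p)))"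
    proof (rule continuous_on_closed_Un)
      show "closed (Q \<times> {0..1::real})" "closed (Q' \<times> {0..1::real})"
        using compact_imp_closed[OF Qc] Q'cl by (auto intro: closed_Times)
      show "continuous_on (Q \<times> {0..1}) (\<lambda>p. if fst p \<in> Q then A (ex (fst p), snd p) else D (?c (fst p)))"
      proof (rule continuous_on_eq)
        show "continuous_on (Q \<times> {0..1}) (\<lambda>p. A (ex (fst p), snd p))"
          by (rule continuous_on_compose2[OF A(1) continuous_on_Pair[OF continuous_on_compose2[OF cex continuous_on_fst[OF continuous_on_id] subset_refl]
               continuous_on_snd[OF continuous_on_id]]]) (use exC in auto)
      qed auto
      show "continuous_on (Q' \<times> {0..1::real}) (\<lambda>p. if fst p \<in> Q then A (ex (fst p), snd p) else D (?c (fst p)))"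
      proof (rule continuous_on_eq)
        show "continuous_on (Q' \<times> {0..1::real}) (\<lambda>p. D (?c (fst p)))"
          by (rule continuous_on_compose2[OF D(1) continuous_on_compose2[OF continuous_on_cell[OF zeta] continuous_on_fst[OF continuous_on_id]]])
            (use cS in \<open>auto simp: Q'_def\<close>)
        fix p assume p: "p \<in> Q' \<times> {0..1::real}"
        show "D (?c (fst p)) = (if fst p \<in> Q then A (ex (fst p), snd p) else D (?c (fst p)))"
        proof (cases "fst p \<in> Q")
          case True
          then have "cmax ?N (fst p) = 1/2" using p by (auto simp: Q_def Q'_def)
          then have "A (ex (fst p), snd p) = a" using A(2) exB[OF True] p by auto
          then show ?thesis using D(2)[OF True] True by simp
        qed simp
      qed
    qed
    moreover have "Q \<times> {0..1::real} \<union> Q' \<times> {0..1} = ?C \<times> {0..1}" using QQ by auto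
    ultimately show ?thesis by simp
  qed
  have bQ: "t \<notin> Q" if "t \<in> cube_boundary ?N" for t using Qb that by blast
  \<comment> \<open>The data do not depend on the time: the gluing serves here to produce the single
    map g.\<close>
  define U1 where "U1 = (\<lambda>p::(nat \<Rightarrow> complex) \<times> real. g0 (fst p))"
  define V1 where "V1 = (\<lambda>p::(nat \<Rightarrow> real) \<times> real. if fst p \<in> Q then u (ex (fst p)) else g0 (?c (fst p)))"
  have cu: "continuous_on (?C \<times> {0..1::real}) (\<lambda>p. u (fst p))"
    by (rule continuous_on_compose2[OF u(1) continuous_on_fst[OF continuous_on_id]]) auto
  obtain G1 where G1: "continuous_on (S \<times> {0..1}) G1" "G1 ` (S \<times> {0..1}) \<subseteq> S"
    "\<forall>l. \<forall>z\<in>S. \<forall>s\<in>{0..1}. G1 (act l z, s) = act (k * l) (G1 (z, s))"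
    "\<forall>z\<in>?Z. \<forall>s\<in>{0..1}. G1 (z, s) = U1 (z, s)" "\<forall>t\<in>?C. \<forall>s\<in>{0..1}. G1 (?c t, s) = V1 (t, s)"
  proof (atomize_elim, rule glue_cell[OF zeta])
    show "continuous_on (?Z \<times> {0..1}) U1" unfolding U1_def
      by (rule continuous_on_compose2[OF g0(1) continuous_on_fst[OF continuous_on_id]]) (use ZS in auto)
    show "U1 ` (?Z \<times> {0..1}) \<subseteq> S" using g0(2) ZS by (auto simp: U1_def image_subset_iff subset_iff)
    show "continuous_on (?C \<times> {0..1}) V1" unfolding V1_def
      using paste[OF cu _ g0(1) g0Q] u(2) by (simp cong: if_cong)
    show "V1 ` (?C \<times> {0..1}) \<subseteq> S" using u(3) exC g0(2) cS by (auto simp: V1_def image_subset_iff)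
    show "U1 (act l z, s) = act (k * l) (U1 (z, s))" if "z \<in> ?Z" for l z and s :: real
      using g0(3) that ZS by (auto simp: U1_def)
  qed (use bQ in \<open>auto simp: U1_def V1_def\<close>)
  \<comment> \<open>The homotopy from F after g to W at time 0: H in the inner half of the cell,
    stationary elsewhere.\<close>
  define U2 where "U2 = (\<lambda>p::(nat \<Rightarrow> complex) \<times> real. h (fst p))"
  define V2 where "V2 = (\<lambda>p. if fst p \<in> Q then H (ex (fst p), snd p) else h (?c (fst p)))"
  obtain G2 where G2: "continuous_on (S \<times> {0..1}) G2" "G2 ` (S \<times> {0..1}) \<subseteq> S"
    "\<forall>l. \<forall>z\<in>S. \<forall>s\<in>{0..1}. G2 (act l z, s) = act (1 * l) (G2 (z, s))"
    "\<forall>z\<in>?Z. \<forall>s\<in>{0..1}. G2 (z, s) = U2 (z, s)" "\<forall>t\<in>?C. \<forall>s\<in>{0..1}. G2 (?c t, s) = V2 (t, s)"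
  proof (atomize_elim, rule glue_cell[OF zeta])
    show "continuous_on (?Z \<times> {0..1}) U2" unfolding U2_def
      by (rule continuous_on_compose2[OF ch continuous_on_fst[OF continuous_on_id]]) (use ZS in auto)
    show "U2 ` (?Z \<times> {0..1}) \<subseteq> S" using hS ZS by (auto simp: U2_def image_subset_iff subset_iff)
    show "continuous_on (?C \<times> {0..1}) V2" unfolding V2_def
      using paste[OF H(1,5) ch hQ] by simp
    show "V2 ` (?C \<times> {0..1}) \<subseteq> S" using H(2) exC hS cS by (fastforce simp: V2_def image_subset_iff)
    show "U2 (act l z, s) = act (1 * l) (U2 (z, s))" if "z \<in> ?Z" for l z and s :: real
      using h that ZS by (auto simp: U2_def)
  qed (use bQ in \<open>auto simp: U2_def V2_def\<close>)
  define g where "g = (\<lambda>z. G1 (z, 0))"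
  have cg: "continuous_on S g" unfolding g_def
    by (rule continuous_on_compose2[OF G1(1) continuous_on_Pair[OF continuous_on_id continuous_on_const]]) auto
  have gS: "g ` S \<subseteq> S" using G1(2) by (auto simp: g_def)
  have geq: "g (act l z) = act (k * l) (g z)" if "z \<in> S" for l z using G1(3) that by (simp add: g_def)
  have ga: "g a = a" using G1(4) aZ g0a by (simp add: g_def U1_def)
  \<comment> \<open>The identities hold on the skeleton and on one cell; equivariance carries them
    to the other cells, where the exponents r and k have to cancel.\<close>
  have G20: "G2 (z, 0) = F (g z)" and G21: "G2 (z, 1) = W (z, 0)" if z: "z \<in> S" for z
  proof (atomize (full), cases "z \<in> ?Z")
    case True
    then show "G2 (z, 0) = F (g z) \<and> G2 (z, 1) = W (z, 0)" using G1(4) G2(4) W(6) by (simp add: g_def U1_def U2_def h_def)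
  next
    case False
    then obtain l t where lt: "t \<in> ?C" "z = act l (?c t)" using cell_cover[OF zeta z] by metis
    note ct = cS[OF lt(1)]
    have e: "G2 (?c t, 0) = F (g (?c t)) \<and> G2 (?c t, 1) = W (?c t, 0)"
    proof (cases "t \<in> Q")
      case True
      then show ?thesis using G1(5) G2(5) lt(1) H(3,4)[OF exC[OF True]] sc_ex[OF lt(1)] by (simp add: g_def V1_def V2_def b_def)
    next
      case False
      then have "cmax ?N t \<ge> 1/2" using lt(1) by (auto simp: Q_def)
      then show ?thesis using False G1(5) G2(5) lt(1) W(7) by (simp add: g_def V1_def V2_def h_def)
    qed
    have "g (?c t) \<in> S" using gS ct by blast
    then have "F (g z) = act (r * (k * l)) (F (g (?c t)))" using F(5) geq[OF ct] lt(2) by simp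
    then have "F (g z) = act l (F (g (?c t)))" using rk by simp
    moreover have "W (z, 0) = act l (W (?c t, 0))" using W(3)[OF ct] lt(2) by simp
    moreover have "G2 (z, 0) = act l (G2 (?c t, 0))" "G2 (z, 1) = act l (G2 (?c t, 1))" using G2(3) ct lt(2) by auto
    ultimately show "G2 (z, 0) = F (g z) \<and> G2 (z, 1) = W (z, 0)" using e by simp
  qed
  define gb where "gb = desc g"
  have gb: "gb (\<pi> z) = \<pi> (g z)" if "z \<in> S" for z
    unfolding gb_def by (rule desc_orbit[OF _ that]) (rule geq)
  have cgb: "continuous_map L L gb" unfolding gb_def by (rule continuous_map_desc[OF geq cg gS])
  define mid where "mid = desc (\<lambda>z. W (z, 0))"
  have mid: "mid (\<pi> z) = \<pi> (W (z, 0))" if "z \<in> S" for z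
    unfolding mid_def by (rule desc_orbit[OF _ that, where r = 1]) (use W(3) in simp)
  have "homotopic_with (\<lambda>h. h ` {\<pi> a} \<subseteq> {\<pi> a}) L L (f \<circ> gb) mid"
  proof (rule homotopic_desc[OF G2(1,2), where r = 1])
    show "(f \<circ> gb) (\<pi> z) = \<pi> (G2 (z, 0))" if "z \<in> S" for z
    proof -
      have "g z \<in> S" using gS that by blast
      then show ?thesis using gb[OF that] G20[OF that] F(4) by simp
    qed
    show "mid (\<pi> z) = \<pi> (G2 (z, 1))" if "z \<in> S" for z using mid[OF that] G21[OF that] by simp
    show "\<pi> (G2 (a, s)) = \<pi> a" if "s \<in> {0..1}" for s using G2(4) aZ that ha by (simp add: U2_def)
  qed (use G2(3) a in auto)
  moreover have "homotopic_with (\<lambda>h. h ` {\<pi> a} \<subseteq> {\<pi> a}) L L mid id"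
    by (rule homotopic_desc[OF W(1,2), where r = 1]) (use W(3,4,5) mid a in auto)
  ultimately have "homotopic_with (\<lambda>h. h ` {\<pi> a} \<subseteq> {\<pi> a}) L L (f \<circ> gb) id"
    by (rule homotopic_with_trans)
  moreover have "gb (\<pi> a) = \<pi> a" using gb[OF a(1)] ga by simp
  ultimately show ?thesis using cgb by blast
qed

end

section \<open>Functoriality of the homotopy groups\<close>

lemma equiv_cube_htpy: "equiv (cube_maps i X x0) (cube_htpy i X x0)"
  unfolding cube_maps_def cube_htpy_def by (rule equiv_pair_htpy)

lemma equiv_based_htpy: "equiv (based_self_maps X x0) (based_self_htpy X x0)"
  unfolding based_self_maps_def based_self_htpy_def by (rule equiv_pair_htpy)

lemma based_self_mapsD: "f \<in> based_self_maps X x0 \<Longrightarrow> continuous_map X X f" "f \<in> based_self_maps X x0 \<Longrightarrow> f x0 = x0"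
  by (auto simp: based_self_maps_def pair_maps_def)

lemma based_self_mapsI: "continuous_map X X f \<Longrightarrow> f x0 = x0 \<Longrightarrow> f \<in> based_self_maps X x0"
  by (auto simp: based_self_maps_def pair_maps_def)

lemma based_htpy_iff: "(f, g) \<in> based_self_htpy X x0 \<longleftrightarrow> homotopic_with (\<lambda>h. h ` {x0} \<subseteq> {x0}) X X f g"
  by (simp add: based_self_htpy_def pair_htpy_def)

lemma based_comp:
  assumes "f \<in> based_self_maps X x0" "g \<in> based_self_maps X x0"
  shows "f \<circ> g \<in> based_self_maps X x0"
  using based_self_mapsD[OF assms(1)] based_self_mapsD[OF assms(2)] by (intro based_self_mapsI continuous_map_compose[of X X]) auto

lemma based_id: "id \<in> based_self_maps X x0"
  by (simp add: based_self_maps_def pair_maps_def continuous_map_id)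

lemma cube_maps_comp:
  assumes "f \<in> based_self_maps X x0" "g \<in> cube_maps i X x0"
  shows "f \<circ> g \<in> cube_maps i X x0"
proof -
  have "continuous_map (top_of_set (unit_cube i)) X (f \<circ> g)"
    by (rule continuous_map_compose[OF cube_mapsD(1)[OF assms(2)] based_self_mapsD(1)[OF assms(1)]])
  then show ?thesis using cube_mapsD(2)[OF assms(2)] based_self_mapsD(2)[OF assms(1)]
    by (auto simp: cube_maps_def pair_maps_def)
qed

lemma cube_htpy_comp:
  assumes f: "(f, f') \<in> based_self_htpy X x0" and g: "(g, g') \<in> cube_htpy i X x0"
  shows "(f \<circ> g, f' \<circ> g') \<in> cube_htpy i X x0"
proof -
  have maps: "f \<in> based_self_maps X x0" "f' \<in> based_self_maps X x0" "g \<in> cube_maps i X x0" "g' \<in> cube_maps i X x0"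
    using f g equiv_based_htpy[of X x0] equiv_cube_htpy[of i X x0] by (auto simp: equiv_def)
  have hg: "homotopic_with (\<lambda>h. h ` cube_boundary i \<subseteq> {x0}) (top_of_set (unit_cube i)) X g g'"
    using g by (simp add: cube_htpy_def pair_htpy_def)
  have hf: "homotopic_with (\<lambda>h. h ` {x0} \<subseteq> {x0}) X X f f'" using f by (simp add: based_htpy_iff)
  have "homotopic_with (\<lambda>h. h ` cube_boundary i \<subseteq> {x0}) (top_of_set (unit_cube i)) X (f \<circ> g) (f \<circ> g')"
    by (rule homotopic_with_compose_continuous_map_left[OF hg]) (use based_self_mapsD[OF maps(1)] in auto)
  moreover have "homotopic_with (\<lambda>h. h ` cube_boundary i \<subseteq> {x0}) (top_of_set (unit_cube i)) X (f \<circ> g') (f' \<circ> g')"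
    by (rule homotopic_with_compose_continuous_map_right[OF hf])
      (use maps(4) in \<open>auto simp: cube_maps_def pair_maps_def\<close>)
  ultimately show ?thesis using homotopic_with_trans unfolding cube_htpy_def pair_htpy_def by blast
qed

lemma based_htpy_comp:
  assumes f: "(f, f') \<in> based_self_htpy X x0" and g: "(g, g') \<in> based_self_htpy X x0"
  shows "(f \<circ> g, f' \<circ> g') \<in> based_self_htpy X x0"
proof -
  have maps: "f \<in> based_self_maps X x0" "f' \<in> based_self_maps X x0" "g \<in> based_self_maps X x0" "g' \<in> based_self_maps X x0"
    using f g equiv_based_htpy[of X x0] by (auto simp: equiv_def)
  have "homotopic_with (\<lambda>h. h ` {x0} \<subseteq> {x0}) X X (f \<circ> g) (f \<circ> g')"
    by (rule homotopic_with_compose_continuous_map_left[OF g[unfolded based_htpy_iff]]) (use based_self_mapsD[OF maps(1)] in auto)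
  moreover have "homotopic_with (\<lambda>h. h ` {x0} \<subseteq> {x0}) X X (f \<circ> g') (f' \<circ> g')"
    by (rule homotopic_with_compose_continuous_map_right[OF f[unfolded based_htpy_iff]]) (use based_self_mapsD[OF maps(4)] in auto)
  ultimately show ?thesis using homotopic_with_trans unfolding based_htpy_iff by blast
qed

text \<open>Products and induced maps are defined through all representatives. Such a set contains
  one representative and stays inside its class, so its saturation is that class.\<close>

lemma class_Image:
  assumes R: "equiv A R" and a: "a \<in> A" and X: "a \<in> X" "\<And>x. x \<in> X \<Longrightarrow> (a, x) \<in> R"
  shows "R `` X = R `` {a}"
proof -
  have "R `` {x} = R `` {a}" if "x \<in> X" for x using equiv_class_eq[OF R X(2)[OF that]] by simp
  then have "(\<Union>x\<in>X. R `` {x}) = R `` {a}" using X(1) by blast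
  then show ?thesis by (auto simp: Image_def)
qed

lemma carrier_homotopy_group: "carrier (homotopy_group i X x0) = cube_maps i X x0 // cube_htpy i X x0"
  by (simp add: homotopy_group_def)

lemma induced_map_class:
  assumes f: "f \<in> based_self_maps X x0" and g: "g \<in> cube_maps i X x0"
  shows "induced_map i X x0 (based_self_htpy X x0 `` {f}) (cube_htpy i X x0 `` {g}) = cube_htpy i X x0 `` {f \<circ> g}"
  unfolding induced_map_def
proof (rule class_Image[OF equiv_cube_htpy cube_maps_comp[OF f g]])
  show "f \<circ> g \<in> {h \<circ> k |h k. h \<in> based_self_htpy X x0 `` {f} \<and> k \<in> cube_htpy i X x0 `` {g}}"
    using equiv_class_self[OF equiv_based_htpy f] equiv_class_self[OF equiv_cube_htpy g] by blast
  show "(f \<circ> g, x) \<in> cube_htpy i X x0"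
    if xin: "x \<in> {h \<circ> k |h k. h \<in> based_self_htpy X x0 `` {f} \<and> k \<in> cube_htpy i X x0 `` {g}}" for x
  proof -
    obtain h k where "x = h \<circ> k" "(f, h) \<in> based_self_htpy X x0" "(g, k) \<in> cube_htpy i X x0" using xin by blast
    then show ?thesis by (simp add: cube_htpy_comp)
  qed
qed

lemma carrierE:
  assumes "A \<in> carrier (homotopy_group i X x0)"
  obtains g where "g \<in> cube_maps i X x0" "A = cube_htpy i X x0 `` {g}"
  using assms unfolding carrier_homotopy_group quotient_def by blast

lemma carrierI: "g \<in> cube_maps i X x0 \<Longrightarrow> cube_htpy i X x0 `` {g} \<in> carrier (homotopy_group i X x0)"
  unfolding carrier_homotopy_group by (rule quotientI)

lemma induced_map_carrier:
  assumes "f \<in> based_self_maps X x0" "A \<in> carrier (homotopy_group i X x0)"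
  shows "induced_map i X x0 (based_self_htpy X x0 `` {f}) A \<in> carrier (homotopy_group i X x0)"
  using assms by (elim carrierE) (simp add: induced_map_class carrierI cube_maps_comp)

lemma induced_map_comp:
  assumes "f \<in> based_self_maps X x0" "g \<in> based_self_maps X x0" "A \<in> carrier (homotopy_group i X x0)"
  shows "induced_map i X x0 (based_self_htpy X x0 `` {f}) (induced_map i X x0 (based_self_htpy X x0 `` {g}) A)
    = induced_map i X x0 (based_self_htpy X x0 `` {f \<circ> g}) A"
  using assms by (elim carrierE) (simp add: induced_map_class cube_maps_comp based_comp comp_assoc)

lemma induced_map_id:
  assumes "f \<in> based_self_maps X x0" "(f, id) \<in> based_self_htpy X x0" "A \<in> carrier (homotopy_group i X x0)"
  shows "induced_map i X x0 (based_self_htpy X x0 `` {f}) A = A"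
proof -
  have "based_self_htpy X x0 `` {f} = based_self_htpy X x0 `` {id}"
    using equiv_class_eq[OF equiv_based_htpy assms(2)] .
  then show ?thesis using assms(3) by (elim carrierE) (simp add: induced_map_class based_id)
qed

section \<open>Concatenation and the group operation\<close>

lemma cube_concat_map:
  assumes i: "i \<ge> 1" and f: "continuous_map (top_of_set (unit_cube i \<times> T)) X f" and g: "continuous_map (top_of_set (unit_cube i \<times> T)) X g"
    and b: "\<And>t s. t \<in> cube_boundary i \<Longrightarrow> s \<in> T \<Longrightarrow> f (t, s) = x0 \<and> g (t, s) = x0"
  shows "continuous_map (top_of_set (unit_cube i \<times> (T::real set))) X (\<lambda>(t, s). cube_concat (\<lambda>t. f (t, s)) (\<lambda>t. g (t, s)) t)"
proof -
  let ?C = "unit_cube i \<times> T"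
  define a where "a = (\<lambda>p::(nat \<Rightarrow> real) \<times> real. ((fst p)(0 := 2 * fst p 0), snd p))"
  define c where "c = (\<lambda>p::(nat \<Rightarrow> real) \<times> real. ((fst p)(0 := 2 * fst p 0 - 1), snd p))"
  have co: "continuous_on Y (\<lambda>p::(nat \<Rightarrow> real) \<times> real. fst p j)" for Y j
    by (rule continuous_on_coord[OF continuous_on_fst[OF continuous_on_id]])
  have ca: "continuous_on Y a" for Y unfolding a_def
  proof (intro continuous_on_Pair continuous_on_snd continuous_on_id continuous_on_coordinatewise_then_product)
    show "continuous_on Y (\<lambda>p. ((fst p)(0 := 2 * fst p 0)) j)" for j
      by (cases "j = 0") (auto intro!: continuous_on_mult continuous_on_const co)
  qed
  have cc: "continuous_on Y c" for Y unfolding c_def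
  proof (intro continuous_on_Pair continuous_on_snd continuous_on_id continuous_on_coordinatewise_then_product)
    show "continuous_on Y (\<lambda>p. ((fst p)(0 := 2 * fst p 0 - 1)) j)" for j
      by (cases "j = 0") (auto intro!: continuous_on_mult continuous_on_diff continuous_on_const co)
  qed
  have "continuous_map (top_of_set ?C) X (\<lambda>p. if fst p 0 \<le> 1/2 then f (a p) else g (c p))"
  proof (rule continuous_map_cases_le)
    show "continuous_map (top_of_set ?C) euclideanreal (\<lambda>p. fst p 0)" using co by simp
    show "continuous_map (top_of_set ?C) euclideanreal (\<lambda>p. 1/2)" by simp
    have "continuous_map (top_of_set (?C \<inter> {p. fst p 0 \<le> 1/2})) X (f \<circ> a)"
      by (rule continuous_map_compose[OF _ f]) (use ca i in \<open>auto simp: a_def unit_cube_def\<close>)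
    then show "continuous_map (subtopology (top_of_set ?C) {p \<in> topspace (top_of_set ?C). fst p 0 \<le> 1/2}) X (\<lambda>p. f (a p))"
      by (simp add: subtopology_subtopology o_def Int_def conj_commute conj_left_commute)
    have "continuous_map (top_of_set (?C \<inter> {p. 1/2 \<le> fst p 0})) X (g \<circ> c)"
      by (rule continuous_map_compose[OF _ g]) (use cc i in \<open>auto simp: c_def unit_cube_def\<close>)
    then show "continuous_map (subtopology (top_of_set ?C) {p \<in> topspace (top_of_set ?C). 1/2 \<le> fst p 0}) X (\<lambda>p. g (c p))"
      by (simp add: subtopology_subtopology o_def Int_def conj_commute conj_left_commute)
    \<comment> \<open>On the seam t_0 = 1/2 the rescaled points lie in the faces t_0 = 1 and t_0 =
      0, where both maps take the value x0.\<close>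
    fix p assume p: "p \<in> topspace (top_of_set ?C)" "fst p 0 = 1/2"
    then have "fst (a p) \<in> cube_boundary i" "fst (c p) \<in> cube_boundary i" "snd (a p) \<in> T" "snd (c p) \<in> T"
      using i by (auto simp: a_def c_def cube_boundary_def unit_cube_def intro!: exI[of _ 0])
    then show "f (a p) = g (c p)" using b by (metis prod.collapse)
  qed
  then show ?thesis by (simp add: a_def c_def cube_concat_def case_prod_unfold cong: if_cong)
qed

lemma cube_concat_boundary:
  assumes i: "i \<ge> 1" and t: "t \<in> cube_boundary i" and f: "\<And>t. t \<in> cube_boundary i \<Longrightarrow> f t = x0" and g: "\<And>t. t \<in> cube_boundary i \<Longrightarrow> g t = x0"
  shows "cube_concat f g t = x0"
proof -
  obtain j where j: "j < i" "t j = 0 \<or> t j = 1" "t \<in> unit_cube i" using t unfolding cube_boundary_def by blast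
  have t0: "0 \<le> t 0" "t 0 \<le> 1" using j(3) i by (auto simp: unit_cube_def)
  show ?thesis
  proof (cases "t 0 \<le> 1/2")
    case True
    have "t(0 := 2 * t 0) \<in> cube_boundary i" unfolding cube_boundary_def
    proof (intro CollectI conjI exI[of _ j])
      show "t(0 := 2 * t 0) \<in> unit_cube i" using j(3) True i by (auto simp: unit_cube_def)
      show "(t(0 := 2 * t 0)) j = 0 \<or> (t(0 := 2 * t 0)) j = 1" using j True by auto
    qed (fact j)
    then show ?thesis using f True by (simp add: cube_concat_def)
  next
    case False
    have "t(0 := 2 * t 0 - 1) \<in> cube_boundary i" unfolding cube_boundary_def
    proof (intro CollectI conjI exI[of _ j])
      show "t(0 := 2 * t 0 - 1) \<in> unit_cube i" using j(3) False i t0 by (auto simp: unit_cube_def)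
      show "(t(0 := 2 * t 0 - 1)) j = 0 \<or> (t(0 := 2 * t 0 - 1)) j = 1" using j False by auto
    qed (fact j)
    then show ?thesis using g False by (simp add: cube_concat_def)
  qed
qed

lemma cube_concat_htpy:
  assumes i: "i \<ge> 1" and f: "(f, f') \<in> cube_htpy i X x0" and g: "(g, g') \<in> cube_htpy i X x0"
  shows "(cube_concat f g, cube_concat f' g') \<in> cube_htpy i X x0"
proof -
  obtain H where H: "continuous_map (top_of_set (unit_cube i \<times> {0..1::real})) X H"
    "\<forall>t. H (t, 0) = f t \<and> H (t, 1) = f' t" "\<forall>t\<in>cube_boundary i. \<forall>s\<in>{0..1}. H (t, s) = x0"
    using cube_htpyD[OF f] by blast
  obtain K where K: "continuous_map (top_of_set (unit_cube i \<times> {0..1::real})) X K"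
    "\<forall>t. K (t, 0) = g t \<and> K (t, 1) = g' t" "\<forall>t\<in>cube_boundary i. \<forall>s\<in>{0..1}. K (t, s) = x0"
    using cube_htpyD[OF g] by blast
  show ?thesis
  proof (rule cube_htpyI)
    show "continuous_map (top_of_set (unit_cube i \<times> {0..1::real})) X (\<lambda>(t, s). cube_concat (\<lambda>t. H (t, s)) (\<lambda>t. K (t, s)) t)"
      by (rule cube_concat_map[OF i H(1) K(1)]) (use H(3) K(3) in blast)
    show "(case (t, s) of (t, s) \<Rightarrow> cube_concat (\<lambda>t. H (t, s)) (\<lambda>t. K (t, s)) t) = x0"
      if "t \<in> cube_boundary i" "s \<in> {0..1}" for t s
      unfolding prod.case by (rule cube_concat_boundary[OF i that(1)]) (use H(3) K(3) that(2) in auto)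
  qed (use H(2) K(2) in \<open>auto simp: cube_concat_def\<close>)
qed

lemma cube_concat_in_cube_maps:
  assumes i: "i \<ge> 1" and f: "f \<in> cube_maps i X x0" and g: "g \<in> cube_maps i X x0"
  shows "cube_concat f g \<in> cube_maps i X x0"
proof -
  have "(f, f) \<in> cube_htpy i X x0" "(g, g) \<in> cube_htpy i X x0"
    using equiv_cube_htpy[of i X x0] f g by (auto simp: equiv_def refl_on_def)
  then have "(cube_concat f g, cube_concat f g) \<in> cube_htpy i X x0" by (rule cube_concat_htpy[OF i])
  then show ?thesis using equiv_cube_htpy[of i X x0] unfolding equiv_def by blast
qed

lemma mult_class:
  assumes i: "i \<ge> 1" and f: "f \<in> cube_maps i X x0" and g: "g \<in> cube_maps i X x0"
  shows "(cube_htpy i X x0 `` {f}) \<otimes>\<^bsub>homotopy_group i X x0\<^esub> (cube_htpy i X x0 `` {g}) = cube_htpy i X x0 `` {cube_concat f g}"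
proof -
  have "cube_htpy i X x0 `` {cube_concat h k |h k. h \<in> cube_htpy i X x0 `` {f} \<and> k \<in> cube_htpy i X x0 `` {g}}
    = cube_htpy i X x0 `` {cube_concat f g}"
  proof (rule class_Image[OF equiv_cube_htpy cube_concat_in_cube_maps[OF i f g]])
    show "cube_concat f g \<in> {cube_concat h k |h k. h \<in> cube_htpy i X x0 `` {f} \<and> k \<in> cube_htpy i X x0 `` {g}}"
      using equiv_class_self[OF equiv_cube_htpy f] equiv_class_self[OF equiv_cube_htpy g] by blast
    show "(cube_concat f g, x) \<in> cube_htpy i X x0"
      if xin: "x \<in> {cube_concat h k |h k. h \<in> cube_htpy i X x0 `` {f} \<and> k \<in> cube_htpy i X x0 `` {g}}" for x
    proof -
      obtain h k where "x = cube_concat h k" "(f, h) \<in> cube_htpy i X x0" "(g, k) \<in> cube_htpy i X x0" using xin by blast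
      then show ?thesis by (simp add: cube_concat_htpy[OF i])
    qed
  qed
  then show ?thesis by (simp add: homotopy_group_def)
qed

lemma comp_cube_concat: "f \<circ> cube_concat g h = cube_concat (f \<circ> g) (f \<circ> h)"
  by (auto simp: cube_concat_def fun_eq_iff)

lemma induced_map_hom:
  assumes i: "i \<ge> 1" and f: "f \<in> based_self_maps X x0"
  shows "induced_map i X x0 (based_self_htpy X x0 `` {f}) \<in> hom (homotopy_group i X x0) (homotopy_group i X x0)"
proof (rule homI)
  fix A B assume A: "A \<in> carrier (homotopy_group i X x0)" and B: "B \<in> carrier (homotopy_group i X x0)"
  obtain g where g: "g \<in> cube_maps i X x0" "A = cube_htpy i X x0 `` {g}" using A by (rule carrierE)
  obtain h where h: "h \<in> cube_maps i X x0" "B = cube_htpy i X x0 `` {h}" using B by (rule carrierE)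
  show "induced_map i X x0 (based_self_htpy X x0 `` {f}) (A \<otimes>\<^bsub>homotopy_group i X x0\<^esub> B) =
    induced_map i X x0 (based_self_htpy X x0 `` {f}) A \<otimes>\<^bsub>homotopy_group i X x0\<^esub> induced_map i X x0 (based_self_htpy X x0 `` {f}) B"
    unfolding g(2) h(2) mult_class[OF i g(1) h(1)] induced_map_class[OF f g(1)] induced_map_class[OF f h(1)]
      induced_map_class[OF f cube_concat_in_cube_maps[OF i g(1) h(1)]] comp_cube_concat
      mult_class[OF i cube_maps_comp[OF f g(1)] cube_maps_comp[OF f h(1)]] ..
qed (rule induced_map_carrier[OF f])

text \<open>Induced maps are homomorphisms for i >= 1, so degree 0 and the higher degrees reduce to
  one condition.\<close>

lemma induces_iso_iff_bij:
  assumes f: "f \<in> based_self_maps X x0"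
  shows "induces_iso i X x0 (based_self_htpy X x0 `` {f}) \<longleftrightarrow>
    bij_betw (induced_map i X x0 (based_self_htpy X x0 `` {f})) (carrier (homotopy_group i X x0)) (carrier (homotopy_group i X x0))"
  unfolding induces_iso_def iso_def using induced_map_hom[OF _ f, of i] by (cases "i = 0") auto

lemma self_map_classE:
  assumes "F \<in> self_map_classes X x0"
  obtains f where "f \<in> based_self_maps X x0" "F = based_self_htpy X x0 `` {f}"
  using assms unfolding self_map_classes_def quotient_def by blast

section \<open>Self-equivalences and the isomorphisms they induce\<close>

lemma self_equivalence_class_iff:
  assumes f: "f \<in> based_self_maps X x0"
  shows "based_self_htpy X x0 `` {f} \<in> self_equivalence_classes X x0 \<longleftrightarrow>
    (\<exists>g \<in> based_self_maps X x0. (g \<circ> f, id) \<in> based_self_htpy X x0 \<and> (f \<circ> g, id) \<in> based_self_htpy X x0)"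
proof
  have "trans (based_self_htpy X x0)" using equiv_based_htpy[of X x0] by (simp add: equiv_def)
  note tr = transD[OF this]
  assume "based_self_htpy X x0 `` {f} \<in> self_equivalence_classes X x0"
  then obtain f' g where f': "(f, f') \<in> based_self_htpy X x0" and g: "g \<in> based_self_maps X x0"
    "(g \<circ> f', id) \<in> based_self_htpy X x0" "(f' \<circ> g, id) \<in> based_self_htpy X x0"
    unfolding self_equivalence_classes_def based_self_equivalence_def by blast
  have "(g, g) \<in> based_self_htpy X x0" using g(1) equiv_based_htpy[of X x0] by (auto simp: equiv_def refl_on_def)
  then have "(g \<circ> f, g \<circ> f') \<in> based_self_htpy X x0" "(f \<circ> g, f' \<circ> g) \<in> based_self_htpy X x0"
    using f' by (auto intro: based_htpy_comp)
  then show "\<exists>g \<in> based_self_maps X x0. (g \<circ> f, id) \<in> based_self_htpy X x0 \<and> (f \<circ> g, id) \<in> based_self_htpy X x0"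
    using g(1) tr[OF _ g(2)] tr[OF _ g(3)] by blast
next
  assume "\<exists>g \<in> based_self_maps X x0. (g \<circ> f, id) \<in> based_self_htpy X x0 \<and> (f \<circ> g, id) \<in> based_self_htpy X x0"
  moreover have "f \<in> based_self_htpy X x0 `` {f}" by (rule equiv_class_self[OF equiv_based_htpy f])
  moreover have "based_self_htpy X x0 `` {f} \<in> self_map_classes X x0"
    unfolding self_map_classes_def by (rule quotientI[OF f])
  ultimately show "based_self_htpy X x0 `` {f} \<in> self_equivalence_classes X x0"
    unfolding self_equivalence_classes_def based_self_equivalence_def using f by blast
qed

text \<open>A homotopy inverse induces the inverse bijection in every degree, which settles all k at
  once, including infinity.\<close>

lemma self_equivalence_subset_A_sharp: "self_equivalence_classes X x0 \<subseteq> A_sharp k X x0"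
proof
  fix F assume F: "F \<in> self_equivalence_classes X x0"
  then have F': "F \<in> self_map_classes X x0" by (simp add: self_equivalence_classes_def)
  then obtain f where f: "f \<in> based_self_maps X x0" "F = based_self_htpy X x0 `` {f}" by (rule self_map_classE)
  obtain g where g: "g \<in> based_self_maps X x0" "(g \<circ> f, id) \<in> based_self_htpy X x0" "(f \<circ> g, id) \<in> based_self_htpy X x0"
    using F self_equivalence_class_iff[OF f(1)] unfolding f(2) by blast
  have "induces_iso i X x0 F" for i
    unfolding f(2) induces_iso_iff_bij[OF f(1)]
  proof (rule bij_betw_byWitness[where f' = "induced_map i X x0 (based_self_htpy X x0 `` {g})"])
    show "\<forall>A\<in>carrier (homotopy_group i X x0). induced_map i X x0 (based_self_htpy X x0 `` {g}) (induced_map i X x0 (based_self_htpy X x0 `` {f}) A) = A"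
      using induced_map_comp[OF g(1) f(1)] induced_map_id[OF based_comp[OF g(1) f(1)] g(2)] by simp
    show "\<forall>A\<in>carrier (homotopy_group i X x0). induced_map i X x0 (based_self_htpy X x0 `` {f}) (induced_map i X x0 (based_self_htpy X x0 `` {g}) A) = A"
      using induced_map_comp[OF f(1) g(1)] induced_map_id[OF based_comp[OF f(1) g(1)] g(3)] by simp
    show "induced_map i X x0 (based_self_htpy X x0 `` {f}) ` carrier (homotopy_group i X x0) \<subseteq> carrier (homotopy_group i X x0)"
      by (rule image_subsetI) (rule induced_map_carrier[OF f(1)])
    show "induced_map i X x0 (based_self_htpy X x0 `` {g}) ` carrier (homotopy_group i X x0) \<subseteq> carrier (homotopy_group i X x0)"
      by (rule image_subsetI) (rule induced_map_carrier[OF g(1)])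
  qed
  then show "F \<in> A_sharp k X x0" using F' by (simp add: A_sharp_def)
qed

context lens
begin

lemma pi_surjI:
  assumes f: "f \<in> based_self_maps L (\<pi> a)"
    and s: "carrier (homotopy_group i L (\<pi> a)) \<subseteq> induced_map i L (\<pi> a) (based_self_htpy L (\<pi> a) `` {f}) ` carrier (homotopy_group i L (\<pi> a))"
  shows "pi_surj i f a"
  unfolding pi_surj_def
proof
  fix p assume p: "p \<in> cube_maps i L (\<pi> a)"
  obtain A where A: "A \<in> carrier (homotopy_group i L (\<pi> a))"
    "cube_htpy i L (\<pi> a) `` {p} = induced_map i L (\<pi> a) (based_self_htpy L (\<pi> a) `` {f}) A"
    using s carrierI[OF p] by blast
  obtain \<alpha> where \<alpha>: "\<alpha> \<in> cube_maps i L (\<pi> a)" "A = cube_htpy i L (\<pi> a) `` {\<alpha>}" using A(1) by (rule carrierE)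
  have "cube_htpy i L (\<pi> a) `` {f \<circ> \<alpha>} = cube_htpy i L (\<pi> a) `` {p}"
    using A(2) induced_map_class[OF f \<alpha>(1)] \<alpha>(2) by simp
  then have "(f \<circ> \<alpha>, p) \<in> cube_htpy i L (\<pi> a)" using eq_equiv_class[OF _ equiv_cube_htpy p] by blast
  then show "\<exists>\<alpha>\<in>cube_maps i L (\<pi> a). (f \<circ> \<alpha>, p) \<in> cube_htpy i L (\<pi> a)" using \<alpha>(1) by blast
qed

text \<open>The right inverse again induces isomorphisms, so it has a right inverse, too.\<close>

proposition A_sharp_subset_self_equivalences:
  assumes a: "a \<in> S"
  shows "A_sharp (enat (2 * n + 1)) L (\<pi> a) \<subseteq> self_equivalence_classes L (\<pi> a)"
proof
  let ?H = "based_self_htpy L (\<pi> a)" and ?M = "based_self_maps L (\<pi> a)"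
  have ts: "trans ?H" "sym ?H" using equiv_based_htpy[of L "\<pi> a"] by (simp_all add: equiv_def)
  note tr = transD[OF ts(1)] and sy = symD[OF ts(2)]
  have rinv: "\<exists>g\<in>?M. (f \<circ> g, id) \<in> ?H" if f: "f \<in> ?M" "pi_surj 1 f a" "pi_surj (2 * n + 1) f a" for f
    using right_inverse_up_to_homotopy[OF based_self_mapsD(1)[OF f(1)] a based_self_mapsD(2)[OF f(1)] f(2,3)]
    by (auto simp: based_htpy_iff intro: based_self_mapsI)
  fix F assume F: "F \<in> A_sharp (enat (2 * n + 1)) L (\<pi> a)"
  then have "F \<in> self_map_classes L (\<pi> a)" by (simp add: A_sharp_def)
  then obtain f where f: "f \<in> ?M" "F = ?H `` {f}" by (rule self_map_classE)
  have bij: "bij_betw (induced_map i L (\<pi> a) (?H `` {f})) (carrier (homotopy_group i L (\<pi> a))) (carrier (homotopy_group i L (\<pi> a)))"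
    if "i \<le> 2 * n + 1" for i
    using F that induces_iso_iff_bij[OF f(1)] unfolding f(2) A_sharp_def by simp
  have sf: "pi_surj i f a" if "i \<le> 2 * n + 1" for i
    by (rule pi_surjI[OF f(1)]) (use bij[OF that] in \<open>auto simp: bij_betw_def\<close>)
  obtain g where g: "g \<in> ?M" "(f \<circ> g, id) \<in> ?H" using rinv[OF f(1)] sf[of 1] sf[of "2*n+1"] by auto
  \<comment> \<open>f induces a bijection and f after g induces the identity, so g induces the
    inverse bijection.\<close>
  have sg: "pi_surj i g a" if i: "i \<le> 2 * n + 1" for i
  proof (rule pi_surjI[OF g(1)], rule subsetI)
    fix A assume A: "A \<in> carrier (homotopy_group i L (\<pi> a))"
    let ?f = "induced_map i L (\<pi> a) (?H `` {f})" and ?g = "induced_map i L (\<pi> a) (?H `` {g})"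
    have fA: "?f A \<in> carrier (homotopy_group i L (\<pi> a))" by (rule induced_map_carrier[OF f(1) A])
    have gfA: "?g (?f A) \<in> carrier (homotopy_group i L (\<pi> a))" by (rule induced_map_carrier[OF g(1) fA])
    have "?f (?g (?f A)) = ?f A"
      using induced_map_comp[OF f(1) g(1) fA] induced_map_id[OF based_comp[OF f(1) g(1)] g(2) fA] by simp
    then have "?g (?f A) = A" using bij[OF i] A gfA unfolding bij_betw_def inj_on_def by blast
    then show "A \<in> ?g ` carrier (homotopy_group i L (\<pi> a))" using fA by (metis imageI)
  qed
  obtain h where h: "h \<in> ?M" "(g \<circ> h, id) \<in> ?H" using rinv[OF g(1)] sg[of 1] sg[of "2*n+1"] by auto
  have refl: "(k, k) \<in> ?H" if "k \<in> ?M" for k using that equiv_based_htpy[of L "\<pi> a"] by (auto simp: equiv_def refl_on_def)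
  \<comment> \<open>One-sided inverses agree: f is homotopic to f g h, hence to h, so g f is
    homotopic to g h and thus to the identity.\<close>
  have "(f \<circ> (g \<circ> h), f \<circ> id) \<in> ?H" by (rule based_htpy_comp[OF refl[OF f(1)] h(2)])
  then have 1: "(f, f \<circ> g \<circ> h) \<in> ?H" by (simp add: comp_assoc sy)
  have "((f \<circ> g) \<circ> h, id \<circ> h) \<in> ?H" by (rule based_htpy_comp[OF g(2) refl[OF h(1)]])
  then have "(f \<circ> g \<circ> h, h) \<in> ?H" by simp
  with 1 have "(f, h) \<in> ?H" by (rule tr)
  then have "(g \<circ> f, g \<circ> h) \<in> ?H" by (rule based_htpy_comp[OF refl[OF g(1)]])
  then have "(g \<circ> f, id) \<in> ?H" using h(2) by (rule tr)
  then show "F \<in> self_equivalence_classes L (\<pi> a)"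
    unfolding f(2) self_equivalence_class_iff[OF f(1)] using g by blast
qed

end

section \<open>Additivity of the map induced in homology\<close>

lemma homologous_rel_set_mult:
  assumes "singular_relcycle p X S a" "singular_relcycle p X S b"
  shows "homologous_rel_set p X S a \<otimes>\<^bsub>relative_homology_group (int p) X S\<^esub> homologous_rel_set p X S b
    = homologous_rel_set p X S (a + b)"
proof -
  let ?G = "relcycle_group p X S" and ?B = "singular_relboundary_set p X S"
  have "(\<lambda>a. ?B #>\<^bsub>?G\<^esub> a) \<in> hom ?G (?G Mod ?B)"
    by (rule normal.r_coset_hom_Mod[OF normal_subgroup_singular_relboundary_relcycle])
  then have "(?B #>\<^bsub>?G\<^esub> (a \<otimes>\<^bsub>?G\<^esub> b)) = (?B #>\<^bsub>?G\<^esub> a) \<otimes>\<^bsub>?G Mod ?B\<^esub> (?B #>\<^bsub>?G\<^esub> b)"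
    using assms by (intro hom_mult) auto
  then show ?thesis
    unfolding right_coset_singular_relboundary by (simp add: relative_homology_group_def)
qed

text \<open>A cycle is homologous to a sum of a chain in \<open>U\<close> and a chain in \<open>V\<close>; in odd dimensions
  every chain in a point bounds, so the pieces sent to \<open>y\<close> do not contribute.\<close>

proposition hom_induced_additive:
  assumes p: "odd p" and c: "continuous_map X Y f" "continuous_map X Y a" "continuous_map X Y b"
    and UV: "openin X U" "openin X V" "topspace X \<subseteq> U \<union> V" and y: "y \<in> topspace Y"
    and U: "\<And>x. x \<in> U \<Longrightarrow> f x = a x \<and> b x = y" and V: "\<And>x. x \<in> V \<Longrightarrow> f x = b x \<and> a x = y"
    and \<xi>: "\<xi> \<in> carrier (homology_group (int p) X)"
  shows "hom_induced (int p) X {} Y {} f \<xi> =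
    hom_induced (int p) X {} Y {} a \<xi> \<otimes>\<^bsub>homology_group (int p) Y\<^esub> hom_induced (int p) X {} Y {} b \<xi>"
proof -
  obtain z0 where z0: "singular_relcycle p X {} z0" "\<xi> = homologous_rel_set p X {} z0"
    using \<xi> unfolding carrier_relative_homology_group by blast
  have "\<And>W. W \<in> {U, V} \<Longrightarrow> openin X W" "topspace X \<subseteq> \<Union>{U, V}" using UV by auto
  \<comment> \<open>Subdivision replaces the cycle by a homologous one each of whose simplices lies
    in U or in V.\<close>
  then obtain z where z: "singular_relcycle p X {} z" "homologous_rel p X {} z0 z"
    "\<And>s. s \<in> Poly_Mapping.keys z \<Longrightarrow> \<exists>W\<in>{U, V}. s \<in> standard_simplex p \<rightarrow> W"
    using small_homologous_rel_relcycle_exists[of "{U, V}" X p "{}" z0] z0(1) by metis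
  have \<xi>z: "\<xi> = homologous_rel_set p X {} z"
    using z(2) z0(2) by (simp add: homologous_rel_set_eq)
  have zc: "singular_chain p X z" using z(1) by (simp add: singular_relcycle)
  have keys: "Poly_Mapping.keys z \<subseteq> singular_simplex_set p (subtopology X U) \<union> singular_simplex_set p (subtopology X V)"
  proof
    fix s assume s: "s \<in> Poly_Mapping.keys z"
    then have "singular_simplex p X s" using zc unfolding singular_chain_def by blast
    then show "s \<in> singular_simplex_set p (subtopology X U) \<union> singular_simplex_set p (subtopology X V)"
      using z(3)[OF s] by (auto simp: singular_simplex_subtopology)
  qed
  obtain u w where uw: "singular_chain p (subtopology X U) u" "singular_chain p (subtopology X V) w" "z = u + w"
    using frag_split[OF keys] unfolding singular_chain_def by metis
  have cm: "chain_map p f u = chain_map p a u" "chain_map p f w = chain_map p b w"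
    by (rule chain_map_eq[OF uw(1)], use U in simp) (rule chain_map_eq[OF uw(2)], use V in simp)
  have pt: "singular_relboundary p Y {} (chain_map p g c')"
    if g: "continuous_map X Y g" and c': "singular_chain p (subtopology X W) c'" and gW: "\<And>x. x \<in> W \<Longrightarrow> g x = y" for g c' W
  proof -
    have "continuous_map (subtopology X W) (subtopology Y {y}) g"
      using g gW by (auto simp: continuous_map_in_subtopology continuous_map_from_subtopology)
    then have "singular_chain p (subtopology Y {y}) (chain_map p g c')" using c' by (rule singular_chain_chain_map[rotated])
    then have "singular_relboundary p (subtopology Y {y}) {} (chain_map p g c')"
      using singular_boundary_singleton[of "subtopology Y {y}" y p] p y by simp
    then show ?thesis using singular_boundary_mono by (metis subtopology_UNIV subtopology_subtopology singular_boundary singular_chain_subtopology)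
  qed
  have b1: "singular_relboundary p Y {} (chain_map p a w)" by (rule pt[OF c(2) uw(2)]) (use V in simp)
  have b2: "singular_relboundary p Y {} (chain_map p b u)" by (rule pt[OF c(3) uw(1)]) (use U in simp)
  \<comment> \<open>f agrees with a on u and with b on w, so the difference consists of the two
    pieces sent to the point y.\<close>
  have "chain_map p a z + chain_map p b z - chain_map p f z = chain_map p a w + chain_map p b u"
    using cm by (simp add: uw(3) chain_map_add)
  then have h: "homologous_rel p Y {} (chain_map p a z + chain_map p b z) (chain_map p f z)"
    unfolding homologous_rel_def using singular_relboundary_add[OF b1 b2] by simp
  have ind: "hom_induced (int p) X {} Y {} g \<xi> = homologous_rel_set p Y {} (chain_map p g z)" if "continuous_map X Y g" for g
    unfolding \<xi>z by (rule hom_induced_chain_map[OF that _ z(1)]) simp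
  have cyc: "singular_relcycle p Y {} (chain_map p g z)" if "continuous_map X Y g" for g
    by (rule singular_relcycle_chain_map[OF z(1) that]) simp
  show ?thesis
    unfolding ind[OF c(1)] ind[OF c(2)] ind[OF c(3)] homologous_rel_set_mult[OF cyc[OF c(2)] cyc[OF c(3)]]
    using h by (simp add: homologous_rel_set_eq homologous_rel_sym)
qed

section \<open>The top homology of the sphere\<close>

lemma homeomorphic_complex_sphere_nsphere:
  "top_of_set (complex_sphere n) homeomorphic_space nsphere (2 * n + 1)"
proof -
  define f where "f = (\<lambda>(z::nat \<Rightarrow> complex) i. if even i then Re (z (i div 2)) else Im (z (i div 2)))"
  define g where "g = (\<lambda>(x::nat \<Rightarrow> real) j. Complex (x (2 * j)) (x (2 * j + 1)))"
  have sum: "(\<Sum>i\<le>2*k+1. (f z i)\<^sup>2) = (\<Sum>j\<le>k. (cmod (z j))\<^sup>2)" for k z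
    by (induction k) (auto simp: f_def cmod_power2)
  have fg: "f (g x) = x" for x
    by (rule ext) (auto simp: f_def g_def elim!: evenE oddE)
  have gf: "g (f z) = z" for z by (rule ext) (simp add: f_def g_def)
  have N: "nsphere (2 * n + 1) = top_of_set {x. (\<Sum>i\<le>2*n+1. x i ^ 2) = 1 \<and> (\<forall>i>2*n+1. x i = 0)}"
    unfolding nsphere by (simp add: euclidean_product_topology)
  have iff: "f z \<in> {x. (\<Sum>i\<le>2*n+1. x i ^ 2) = 1 \<and> (\<forall>i>2*n+1. x i = 0)} \<longleftrightarrow> z \<in> complex_sphere n" for z
  proof -
    have "(\<forall>i>2*n+1. f z i = 0) \<longleftrightarrow> (\<forall>j>n. z j = 0)"
    proof
      assume h: "\<forall>i>2*n+1. f z i = 0"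
      show "\<forall>j>n. z j = 0"
      proof (intro allI impI)
        fix j assume "j > n"
        then have "f z (2 * j) = 0" "f z (2 * j + 1) = 0" using h by auto
        then show "z j = 0" by (simp add: f_def complex_eq_iff)
      qed
    next
      assume h: "\<forall>j>n. z j = 0"
      show "\<forall>i>2*n+1. f z i = 0"
      proof (intro allI impI)
        fix i assume "i > 2 * n + 1"
        then have "i div 2 > n" by linarith
        then show "f z i = 0" using h by (simp add: f_def)
      qed
    qed
    then show ?thesis unfolding mem_Collect_eq sum complex_sphere_def by simp
  qed
  have cf: "continuous_on UNIV f"
  proof (rule continuous_on_coordinatewise_then_product)
    have c: "continuous_on UNIV (\<lambda>z::nat \<Rightarrow> complex. z j)" for j by (rule continuous_on_coord[OF continuous_on_id])
    show "continuous_on UNIV (\<lambda>z. f z i)" for i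
      unfolding f_def by (cases "even i") (auto intro!: continuous_on_Re continuous_on_Im c)
  qed
  have cg: "continuous_on UNIV g"
  proof (rule continuous_on_coordinatewise_then_product)
    have c: "continuous_on UNIV (\<lambda>z::nat \<Rightarrow> real. z j)" for j by (rule continuous_on_coord[OF continuous_on_id])
    show "continuous_on UNIV (\<lambda>z. g z i)" for i
      unfolding g_def Complex_eq by (intro continuous_on_add continuous_on_mult continuous_on_of_real continuous_on_const c)
  qed
  have "homeomorphic_maps (top_of_set (complex_sphere n)) (nsphere (2 * n + 1)) f g"
    unfolding homeomorphic_maps_def N
  proof (intro conjI)
    show "continuous_map (top_of_set (complex_sphere n)) (top_of_set {x. (\<Sum>i\<le>2*n+1. x i ^ 2) = 1 \<and> (\<forall>i>2*n+1. x i = 0)}) f"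
      using continuous_on_subset[OF cf] iff by auto
    show "continuous_map (top_of_set {x. (\<Sum>i\<le>2*n+1. x i ^ 2) = 1 \<and> (\<forall>i>2*n+1. x i = 0)}) (top_of_set (complex_sphere n)) g"
    proof -
      have "g x \<in> complex_sphere n" if "x \<in> {x. (\<Sum>i\<le>2*n+1. x i ^ 2) = 1 \<and> (\<forall>i>2*n+1. x i = 0)}" for x
        using iff[of "g x"] that unfolding fg by blast
      then show ?thesis using continuous_on_subset[OF cg] by auto
    qed
  qed (use fg gf in auto)
  then show ?thesis unfolding homeomorphic_space_def by blast
qed

lemma homology_complex_sphere:
  "homology_group (int (2 * n + 1)) (top_of_set (complex_sphere n)) \<cong> integer_group"
proof -
  have "homology_group (int (2 * n + 1)) (top_of_set (complex_sphere n)) \<cong> homology_group (int (2 * n + 1)) (nsphere (2 * n + 1))"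
    by (rule homeomorphic_space_imp_isomorphic_homology_groups[OF homeomorphic_complex_sphere_nsphere])
  moreover have "homology_group (int (2 * n + 1)) (nsphere (2 * n + 1)) \<cong> integer_group"
    using reduced_homology_group_nsphere(1)[of "2 * n + 1"] un_reduced_homology_group[of "int (2 * n + 1)" "nsphere (2 * n + 1)"] by simp
  ultimately show ?thesis by (rule iso_trans)
qed

text \<open>An element x corresponding to the integer 1 would be the d-th power of its image under
  g, so d would divide 1.\<close>

lemma no_root_of_generator:
  assumes iso: "G \<cong> integer_group" and G: "Group.group G" and d: "d \<ge> 2" and g: "g \<in> hom G G"
    and eq: "\<And>x. x \<in> carrier G \<Longrightarrow> g (x [^]\<^bsub>G\<^esub> (d::nat)) = x"
  shows False
proof -
  obtain \<phi> where \<phi>: "\<phi> \<in> iso G integer_group" using iso unfolding is_iso_def by blast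
  then have hom: "\<phi> \<in> hom G integer_group" and surj: "\<phi> ` carrier G = carrier integer_group"
    by (auto simp: iso_def bij_betw_def)
  have "1 \<in> carrier integer_group" by simp
  then obtain x where x: "x \<in> carrier G" "\<phi> x = 1" using surj by (metis imageE)
  have gx: "g x \<in> carrier G" using g x(1) by (simp add: hom_in_carrier)
  have "x = g (x [^]\<^bsub>G\<^esub> d)" using eq[OF x(1)] by simp
  also have "\<dots> = g x [^]\<^bsub>G\<^esub> d" using hom_nat_pow[OF g x(1) G G] by simp
  finally have "\<phi> x = \<phi> (g x [^]\<^bsub>G\<^esub> d)" by simp
  also have "\<dots> = \<phi> (g x) [^]\<^bsub>integer_group\<^esub> d" using hom_nat_pow[OF hom gx G group_integer_group] by simp
  also have "\<dots> = int d * \<phi> (g x)" by simp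
  finally have "int d dvd 1" using x(2) by (metis dvd_triv_left)
  then show False using d by simp
qed


section \<open>An equivariant self-map of degree \<open>1 + m\<close>\<close>

lemma homotopic_sphereI:
  assumes H: "continuous_on (T \<times> {0..1::real}) H" "H ` (T \<times> {0..1}) \<subseteq> T"
    and f: "\<And>z. z \<in> T \<Longrightarrow> H (z, 0) = f z" and g: "\<And>z. z \<in> T \<Longrightarrow> H (z, 1) = g z"
  shows "homotopic_with (\<lambda>_. True) (top_of_set T) (top_of_set T) f g"
proof (subst homotopic_with)
  have "continuous_on ({0..1::real} \<times> T) (\<lambda>p. H (snd p, fst p))"
    by (rule continuous_on_compose2[OF H(1) continuous_on_Pair[OF continuous_on_snd[OF continuous_on_id] continuous_on_fst[OF continuous_on_id]]]) auto
  then have "continuous_map (prod_topology (top_of_set {0..1::real}) (top_of_set T)) (top_of_set T) (\<lambda>p. H (snd p, fst p))"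
    unfolding prod_topology_subtopology_eu using H(2) by auto
  then show "\<exists>h. continuous_map (prod_topology (top_of_set {0..1::real}) (top_of_set T)) (top_of_set T) h \<and>
    (\<forall>x\<in>topspace (top_of_set T). h (0, x) = f x) \<and> (\<forall>x\<in>topspace (top_of_set T). h (1, x) = g x) \<and> (\<forall>t\<in>{0..1::real}. True)"
    using f g by (intro exI[of _ "\<lambda>p. H (snd p, fst p)"]) auto
qed simp

context lens
begin

abbreviation deck_reps :: "int set" where "deck_reps \<equiv> {0..<int m}"

lemma sum_deck_shift:
  assumes "\<And>k. h (k mod int m) = h k"
  shows "(\<Sum>k\<in>deck_reps. h (k - l)) = (\<Sum>k\<in>deck_reps. h k)"
proof -
  have 1: "((a mod int m) + b) mod int m = (a + b) mod int m" "((a mod int m) - b) mod int m = (a - b) mod int m" for a b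
    by (simp_all add: mod_simps)
  show ?thesis
    by (rule sum.reindex_bij_witness[of _ "\<lambda>k. (k + l) mod int m" "\<lambda>k. (k - l) mod int m"])
      (use m2 1 in \<open>auto simp: assms\<close>)
qed

lemma cnorm_act [simp]: "cnorm n (act l w) = cnorm n w"
  by (simp add: cnorm_def)

lemma normalise_act: "normalise n (act l w) = act l (normalise n w)"
  by (rule ext) (simp add: normalise_def, simp add: act_def)

text \<open>Deck transformations lie in the connected torus of coordinate rotations. Hence a deck
  transformation at the end of a lifted homotopy does not disturb the argument in homology.\<close>

lemma homotopic_act_id: "homotopic_with (\<lambda>_. True) (top_of_set S) (top_of_set S) (act k) id"
proof (rule homotopic_sphereI)
  define H where "H = (\<lambda>p::(nat \<Rightarrow> complex) \<times> real. \<lambda>j. fst p j * cis (2 * pi * (of_int (wt j * k) * (1 - snd p)) / real m))"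
  show "continuous_on (S \<times> {0..1}) H" unfolding H_def
  proof (rule continuous_on_coordinatewise_then_product)
    have "continuous_on (S \<times> {0..1}) (\<lambda>p::(nat \<Rightarrow> complex) \<times> real. fst p j)" for j
      by (rule continuous_on_coord[OF continuous_on_fst[OF continuous_on_id]])
    then show "continuous_on (S \<times> {0..1}) (\<lambda>p. fst p j * cis (2 * pi * (of_int (wt j * k) * (1 - snd p)) / real m))" for j
      using m0 by (intro continuous_on_mult continuous_on_cis continuous_on_divide continuous_on_const continuous_on_diff
        continuous_on_snd continuous_on_id) auto
  qed
  show "H ` (S \<times> {0..1}) \<subseteq> S" by (auto simp: H_def complex_sphere_def norm_mult)
qed (auto simp: act_def)

text \<open>Multiplication by unit complex numbers joins -1 to 1. This is why an elementary bump,
  which is a deformed antipodal map, counts as 1 and not as -1.\<close>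

lemma homotopic_antipode_id: "homotopic_with (\<lambda>_. True) (top_of_set S) (top_of_set S) (\<lambda>z j. - z j) id"
proof (rule homotopic_sphereI)
  define H where "H = (\<lambda>p::(nat \<Rightarrow> complex) \<times> real. \<lambda>j. fst p j * cis (pi * (1 - snd p)))"
  show "continuous_on (S \<times> {0..1}) H" unfolding H_def
  proof (rule continuous_on_coordinatewise_then_product)
    have "continuous_on (S \<times> {0..1}) (\<lambda>p::(nat \<Rightarrow> complex) \<times> real. fst p j)" for j
      by (rule continuous_on_coord[OF continuous_on_fst[OF continuous_on_id]])
    then show "continuous_on (S \<times> {0..1}) (\<lambda>p. fst p j * cis (pi * (1 - snd p)))" for j
      by (intro continuous_on_mult continuous_on_cis continuous_on_const continuous_on_diff continuous_on_snd continuous_on_id)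
  qed
  show "H ` (S \<times> {0..1}) \<subseteq> S" by (auto simp: H_def complex_sphere_def norm_mult)
qed auto

section \<open>Inserting bumps around one orbit of centres\<close>

context
  fixes p :: "nat \<Rightarrow> complex" and \<epsilon> :: real
  assumes pS: "p \<in> S" and eps: "\<epsilon> > 0"
    and sep: "\<And>z k l. z \<in> S \<Longrightarrow> dist z (act k p) < 3 * \<epsilon> \<Longrightarrow> dist z (act l p) < 3 * \<epsilon> \<Longrightarrow> int m dvd k - l"
    and anti: "\<And>z. z \<in> S \<Longrightarrow> dist (\<lambda>j. - z j) z \<ge> 3 * \<epsilon>"
begin

text \<open>At most one centre lies within 3\<epsilon> of z, so for admissible weights this is a
  combination of z and that centre. Summing over all residues keeps the formula continuous and
  symmetric without a case distinction.\<close>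

definition bumpv :: "(int \<Rightarrow> real) \<Rightarrow> (int \<Rightarrow> real) \<Rightarrow> (nat \<Rightarrow> complex) \<Rightarrow> nat \<Rightarrow> complex" where
  "bumpv A B z = (\<lambda>j. of_real (1 - (\<Sum>k\<in>deck_reps. A k)) * z j + (\<Sum>k\<in>deck_reps. of_real (B k) * act k p j))"

text \<open>A combination of unit vectors z and c vanishes only if both coefficients are 0, if c =
  -z, or if z = c and the coefficients add up to 0. The first and the last case are excluded here,
  the middle one by the nearness of z to c.\<close>

definition admissible :: "(int \<Rightarrow> real) \<Rightarrow> (int \<Rightarrow> real) \<Rightarrow> (nat \<Rightarrow> complex) \<Rightarrow> bool" where
  "admissible A B z \<longleftrightarrow> (\<forall>k\<in>deck_reps. (dist z (act k p) \<ge> 3 * \<epsilon> \<longrightarrow> A k = 0 \<and> B k = 0) \<and>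
     (A k \<noteq> 1 \<or> B k \<noteq> 0) \<and> (z = act k p \<longrightarrow> 1 - A k + B k \<noteq> 0))"

lemma deck_unique:
  assumes "z \<in> S" "k \<in> deck_reps" "l \<in> deck_reps" "dist z (act k p) < 3 * \<epsilon>" "dist z (act l p) < 3 * \<epsilon>"
  shows "l = k"
proof -
  have "int m dvd k - l" using sep assms by blast
  then have "k mod int m = l mod int m" by (simp add: mod_eq_dvd_iff)
  then show ?thesis using assms by simp
qed

lemma bumpv_single:
  assumes z: "z \<in> S" and ad: "admissible A B z" and k: "k \<in> deck_reps" "dist z (act k p) < 3 * \<epsilon>"
  shows "bumpv A B z = (\<lambda>j. of_real (1 - A k) * z j + of_real (B k) * act k p j)"
proof -
  have 0: "A l = 0 \<and> B l = 0" if "l \<in> deck_reps - {k}" for l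
    using that ad deck_unique[OF z k(1) _ k(2), of l] unfolding admissible_def by (metis DiffD1 DiffD2 not_le singletonI)
  have "(\<Sum>l\<in>deck_reps. A l) = A k"
    using sum.mono_neutral_right[of deck_reps "{k}" A] 0 k(1) by simp
  moreover have "(\<Sum>l\<in>deck_reps. of_real (B l) * act l p j) = of_real (B k) * act k p j" for j
    using sum.mono_neutral_right[of deck_reps "{k}" "\<lambda>l. of_real (B l) * act l p j"] 0 k(1) by simp
  ultimately show ?thesis by (simp add: bumpv_def)
qed

lemma bumpv_none:
  assumes ad: "admissible A B z" and far: "\<And>k. k \<in> deck_reps \<Longrightarrow> dist z (act k p) \<ge> 3 * \<epsilon>"
  shows "bumpv A B z = z"
proof -
  have "A k = 0" "B k = 0" if "k \<in> deck_reps" for k using ad far[OF that] that unfolding admissible_def by auto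
  then show ?thesis by (simp add: bumpv_def)
qed

lemma bumpv_nonzero:
  assumes z: "z \<in> S" and ad: "admissible A B z"
  shows "\<exists>j\<le>n. bumpv A B z j \<noteq> 0"
proof (cases "\<exists>k\<in>deck_reps. dist z (act k p) < 3 * \<epsilon>")
  case False
  then have "bumpv A B z = z" using bumpv_none[OF ad] by (meson not_le)
  then show ?thesis using sphere_nonzero[OF z] by simp
next
  case True
  then obtain k where k: "k \<in> deck_reps" "dist z (act k p) < 3 * \<epsilon>" by blast
  define c where "c = act k p"
  define a b where "a = 1 - A k" and "b = B k"
  have cS: "c \<in> S" using pS by (simp add: c_def)
  have v: "bumpv A B z = (\<lambda>j. of_real a * z j + of_real b * c j)"
    using bumpv_single[OF z ad k] by (simp add: a_def b_def c_def)
  have ab: "a \<noteq> 0 \<or> b \<noteq> 0" "z = c \<Longrightarrow> a + b \<noteq> 0"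
    using ad k(1) unfolding admissible_def a_def b_def c_def by auto
  show ?thesis
  proof (rule ccontr)
    assume "\<not> ?thesis"
    then have 0: "of_real a * z j = - (of_real b * c j)" for j
    proof (cases "j \<le> n")
      case True
      then show ?thesis using \<open>\<not> (\<exists>j\<le>n. bumpv A B z j \<noteq> 0)\<close> unfolding v by (simp add: eq_neg_iff_add_eq_0)
    next
      case False
      then show ?thesis using z cS by (simp add: complex_sphere_def)
    qed
    have "a\<^sup>2 * (cmod (z j))\<^sup>2 = b\<^sup>2 * (cmod (c j))\<^sup>2" for j
    proof -
      have "cmod (of_real a * z j) = cmod (of_real b * c j)" using 0[of j] by (metis norm_minus_cancel)
      then have "(\<bar>a\<bar> * cmod (z j))\<^sup>2 = (\<bar>b\<bar> * cmod (c j))\<^sup>2" by (simp add: norm_mult)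
      then show ?thesis by (simp add: power_mult_distrib)
    qed
    then have "(\<Sum>j\<le>n. a\<^sup>2 * (cmod (z j))\<^sup>2) = (\<Sum>j\<le>n. b\<^sup>2 * (cmod (c j))\<^sup>2)" by simp
    then have "a\<^sup>2 = b\<^sup>2" using z cS by (simp add: complex_sphere_def flip: sum_distrib_left)
    then have "a = b \<or> a = - b" by (simp add: power2_eq_iff)
    then show False
    proof
      assume e: "a = b"
      then have a0: "a \<noteq> 0" using ab by auto
      have "c j = - z j" for j
      proof -
        have "of_real b * (c j + z j) = 0" using 0[of j] e by (simp add: distrib_left)
        then show ?thesis using a0 e by (simp add: eq_neg_iff_add_eq_0)
      qed
      then have "c = (\<lambda>j. - z j)" by (rule ext)
      then have "dist z (act k p) \<ge> 3 * \<epsilon>" using anti[OF z] by (simp add: c_def dist_commute)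
      then show False using k(2) by simp
    next
      assume e: "a = - b"
      then have a0: "b \<noteq> 0" using ab by auto
      have "z j = c j" for j using 0[of j] e a0 by simp
      then have "z = c" by (rule ext)
      then show False using ab(2) e by simp
    qed
  qed
qed

lemma continuous_on_bump:
  assumes \<zeta>: "continuous_on X \<zeta>" "\<zeta> ` X \<subseteq> S" and AB: "\<And>k. continuous_on X (A k)" "\<And>k. continuous_on X (B k)"
    and ad: "\<And>x. x \<in> X \<Longrightarrow> admissible (\<lambda>k. A k x) (\<lambda>k. B k x) (\<zeta> x)"
  shows "continuous_on X (\<lambda>x. normalise n (bumpv (\<lambda>k. A k x) (\<lambda>k. B k x) (\<zeta> x)))"
proof (rule continuous_on_normalise)
  show "continuous_on X (\<lambda>x. bumpv (\<lambda>k. A k x) (\<lambda>k. B k x) (\<zeta> x) j)" for j unfolding bumpv_def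
    by (intro continuous_on_add continuous_on_mult continuous_on_of_real continuous_on_diff continuous_on_sum continuous_on_const
        AB continuous_on_coord[OF \<zeta>(1)])
  show "\<exists>j\<le>n. bumpv (\<lambda>k. A k x) (\<lambda>k. B k x) (\<zeta> x) j \<noteq> 0" if "x \<in> X" for x
    using bumpv_nonzero ad that \<zeta>(2) by blast
qed

text \<open>With r the distance of z from a centre c, a bump is (1 - E - C) z + (E - C) c before
  normalisation. It equals z for r >= 3\<epsilon>, moves to c as r falls to 2\<epsilon>, stays at c
  down to r = \<epsilon>, and then runs from c to -c at the centre, covering the sphere once. The
  annulus on which it is constant is the overlap of open sets that additivity needs.\<close>

definition Ef :: "real \<Rightarrow> real" where "Ef r = max 0 (min 1 (3 - r / \<epsilon>))"
definition Cf :: "real \<Rightarrow> real" where "Cf r = max 0 (1 - r / \<epsilon>)"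

lemma Ef_far: "r \<ge> 3 * \<epsilon> \<Longrightarrow> Ef r = 0" using eps by (simp add: Ef_def field_simps)
lemma Ef_near: "r \<le> 2 * \<epsilon> \<Longrightarrow> Ef r = 1"
proof -
  assume "r \<le> 2 * \<epsilon>"
  then have "r / \<epsilon> \<le> 2" using eps by (simp add: field_simps)
  then show ?thesis by (simp add: Ef_def)
qed
lemma Cf_far: "r \<ge> \<epsilon> \<Longrightarrow> Cf r = 0" using eps by (simp add: Cf_def field_simps)

lemma continuous_on_EfCf:
  assumes "continuous_on X f"
  shows "continuous_on X (\<lambda>x. Ef (f x))" "continuous_on X (\<lambda>x. Cf (f x))"
  unfolding Ef_def Cf_def using eps
  by (intro continuous_on_max continuous_on_min continuous_on_diff continuous_on_divide continuous_on_const assms; simp)+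

lemma EfCf_ok:
  assumes "r \<ge> 0"
  shows "Ef r + Cf r \<noteq> 1 \<or> Ef r - Cf r \<noteq> 0" "1 - (Ef 0 + Cf 0) + (Ef 0 - Cf 0) \<noteq> 0"
proof -
  show "Ef r + Cf r \<noteq> 1 \<or> Ef r - Cf r \<noteq> 0"
  proof (cases "r < \<epsilon>")
    case True
    then have "Ef r = 1" using Ef_near[of r] eps by simp
    then show ?thesis by auto
  next
    case False
    then have "Cf r = 0" using Cf_far by simp
    then show ?thesis by auto
  qed
  show "1 - (Ef 0 + Cf 0) + (Ef 0 - Cf 0) \<noteq> 0" by (simp add: Ef_def Cf_def)
qed

text \<open>For \<open>s = 0\<close> the first \<open>i\<close> bumps are inserted; at \<open>s = 1\<close> the ball around the next centre
  is in addition collapsed to that centre.\<close>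

definition wa :: "int \<Rightarrow> real \<Rightarrow> (nat \<Rightarrow> complex) \<Rightarrow> int \<Rightarrow> real" where
  "wa i s z k = (if k < i then Ef (dist z (act k p)) + Cf (dist z (act k p)) else if k = i then s * Ef (dist z (act k p)) else 0)"

definition wb :: "int \<Rightarrow> real \<Rightarrow> (nat \<Rightarrow> complex) \<Rightarrow> int \<Rightarrow> real" where
  "wb i s z k = (if k < i then Ef (dist z (act k p)) - Cf (dist z (act k p)) else if k = i then s * Ef (dist z (act k p)) else 0)"

definition bump :: "int \<Rightarrow> real \<Rightarrow> (nat \<Rightarrow> complex) \<Rightarrow> nat \<Rightarrow> complex" where
  "bump i s z = normalise n (bumpv (wa i s z) (wb i s z) z)"

lemma admissible_w: "admissible (wa i s z) (wb i s z) z"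
  unfolding admissible_def
proof (intro ballI conjI impI)
  fix k
  show "wa i s z k \<noteq> 1 \<or> wb i s z k \<noteq> 0" using EfCf_ok(1)[of "dist z (act k p)"] by (auto simp: wa_def wb_def)
  show "1 - wa i s z k + wb i s z k \<noteq> 0" if "z = act k p" using EfCf_ok(2) that by (auto simp: wa_def wb_def)
  assume "3 * \<epsilon> \<le> dist z (act k p)"
  then show "wa i s z k = 0" "wb i s z k = 0" using Ef_far Cf_far[of "dist z (act k p)"] eps by (auto simp: wa_def wb_def)
qed

lemma continuous_on_bump_map:
  "continuous_on (S \<times> {0..1}) (\<lambda>x. bump i (snd x) (fst x))"
  unfolding bump_def
proof (rule continuous_on_bump[where A = "\<lambda>k x. wa i (snd x) (fst x) k" and B = "\<lambda>k x. wb i (snd x) (fst x) k"])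
  have d: "continuous_on (S \<times> {0..1}) (\<lambda>x::(nat \<Rightarrow> complex) \<times> real. dist (fst x) (act k p))" for k
    by (intro continuous_on_dist continuous_on_fst continuous_on_id continuous_on_const)
  have sE: "continuous_on (S \<times> {0..1}) (\<lambda>x::(nat \<Rightarrow> complex) \<times> real. snd x * Ef (dist (fst x) (act k p)))" for k
    by (intro continuous_on_mult continuous_on_snd continuous_on_id continuous_on_EfCf d)
  show "continuous_on (S \<times> {0..1}) (\<lambda>x::(nat \<Rightarrow> complex) \<times> real. wa i (snd x) (fst x) k)" for k
    unfolding wa_def using sE[of k] continuous_on_EfCf[OF d[of k]]
    by (cases "k < i"; cases "k = i") (auto intro!: continuous_on_add)
  show "continuous_on (S \<times> {0..1}) (\<lambda>x::(nat \<Rightarrow> complex) \<times> real. wb i (snd x) (fst x) k)" for k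
    unfolding wb_def using sE[of k] continuous_on_EfCf[OF d[of k]]
    by (cases "k < i"; cases "k = i") (auto intro!: continuous_on_diff)
qed (use admissible_w in \<open>auto intro: continuous_on_fst continuous_on_id\<close>)

lemma bump_in_sphere: "z \<in> S \<Longrightarrow> bump i s z \<in> S"
  unfolding bump_def by (intro normalise_in_sphere bumpv_nonzero admissible_w)

lemma continuous_on_bump_s:
  assumes "s \<in> {0..1}"
  shows "continuous_on S (bump i s)"
proof -
  have "continuous_on S (\<lambda>z. bump i (snd (z, s)) (fst (z, s)))"
    by (rule continuous_on_compose2[OF continuous_on_bump_map continuous_on_Pair[OF continuous_on_id continuous_on_const]]) (use assms in auto)
  then show ?thesis by simp
qed

lemma bump_0: "z \<in> S \<Longrightarrow> bump 0 0 z = z"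
proof -
  assume z: "z \<in> S"
  have "(\<Sum>k\<in>deck_reps. wa 0 0 z k) = 0" by (rule sum.neutral) (auto simp: wa_def)
  moreover have "(\<Sum>k\<in>deck_reps. of_real (wb 0 0 z k) * act k p j) = 0" for j by (rule sum.neutral) (auto simp: wb_def)
  ultimately have "bumpv (wa 0 0 z) (wb 0 0 z) z = z" by (simp add: bumpv_def)
  then show ?thesis using normalise_sphere[OF z] by (simp add: bump_def)
qed

lemma bump_far:
  assumes "z \<in> S" "\<And>k. k \<in> deck_reps \<Longrightarrow> dist z (act k p) \<ge> 3 * \<epsilon>"
  shows "bump i s z = z"
  unfolding bump_def using bumpv_none[OF admissible_w assms(2)] normalise_sphere[OF assms(1)] by simp

text \<open>Beyond distance \<epsilon> from c the new map is \<open>bump i 1\<close>, within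
  distance 2\<epsilon> it is b, and each of the two is constantly c on the region of the other.
  Additivity splits the new map into these; \<open>bump i 1\<close> is homotopic to
  \<open>bump i 0\<close>, and b to the antipodal map and hence to the identity.\<close>

lemma bump_step_homology:
  assumes i: "i \<in> deck_reps" and \<xi>: "\<xi> \<in> carrier (homology_group (int (2 * n + 1)) (top_of_set S))"
  shows "hom_induced (int (2 * n + 1)) (top_of_set S) {} (top_of_set S) {} (bump (i + 1) 0) \<xi> =
    hom_induced (int (2 * n + 1)) (top_of_set S) {} (top_of_set S) {} (bump i 0) \<xi>
      \<otimes>\<^bsub>homology_group (int (2 * n + 1)) (top_of_set S)\<^esub> \<xi>"
proof -
  let ?T = "top_of_set S" and ?N = "2 * n + 1"
  define c where "c = act i p"
  have cS: "c \<in> S" using pS by (simp add: c_def)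
  \<comment> \<open>D runs in time from the antipodal map to b. The vectors -z and c are antipodal
    only for z = c, and there D is 0, so the combination never vanishes.\<close>
  define D where "D = (\<lambda>x::(nat \<Rightarrow> complex) \<times> real. snd x * (1 - Cf (dist (fst x) c)))"
  define Bv where "Bv = (\<lambda>x::(nat \<Rightarrow> complex) \<times> real. \<lambda>j. of_real (1 - D x) * (- fst x j) + of_real (D x) * c j)"
  define b where "b = (\<lambda>z. normalise n (Bv (z, 1)))"
  have C01: "0 \<le> Cf r" "r \<ge> 0 \<Longrightarrow> Cf r \<le> 1" for r using eps by (auto simp: Cf_def)
  have D01: "D x \<in> {0..1}" if "x \<in> S \<times> {0..1}" for x
    using that C01[of "dist (fst x) c"] by (auto simp: D_def mult_le_one)
  have nz: "\<exists>j\<le>n. Bv x j \<noteq> 0" if x: "x \<in> S \<times> {0..1}" for x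
  proof (cases "fst x = c")
    case True
    then have "Bv x = (\<lambda>j. - c j)" by (simp add: Bv_def D_def Cf_def)
    then show ?thesis using sphere_nonzero[OF cS] by simp
  next
    case False
    have "(\<lambda>j. - fst x j) \<in> S" using x by (auto simp: complex_sphere_def)
    moreover have "\<not> (\<forall>j. c j = - (- fst x j))" using False by (metis minus_minus ext)
    ultimately show ?thesis unfolding Bv_def using D01[OF x] cS by (intro sphere_segment_nonzero) auto
  qed
  have cB: "continuous_on (S \<times> {0..1}) (\<lambda>x. normalise n (Bv x))"
  proof (rule continuous_on_normalise)
    have cf: "continuous_on (S \<times> {0..1}) (\<lambda>x::(nat \<Rightarrow> complex) \<times> real. fst x j)" for j
      by (rule continuous_on_coord[OF continuous_on_fst[OF continuous_on_id]])
    have "continuous_on (S \<times> {0..1}) D" unfolding D_def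
      by (intro continuous_on_mult continuous_on_diff continuous_on_const continuous_on_snd continuous_on_id continuous_on_EfCf
          continuous_on_dist continuous_on_fst)
    then show "continuous_on (S \<times> {0..1}) (\<lambda>x. Bv x j)" for j unfolding Bv_def
      by (intro continuous_on_add continuous_on_mult continuous_on_of_real continuous_on_diff continuous_on_const continuous_on_minus cf)
  qed (use nz in auto)
  have BS: "normalise n (Bv x) \<in> S" if "x \<in> S \<times> {0..1}" for x using nz[OF that] by (rule normalise_in_sphere)
  have b_anti: "homotopic_with (\<lambda>_. True) ?T ?T (\<lambda>z j. - z j) b"
  proof (rule homotopic_sphereI[OF cB])
    show "normalise n (Bv (z, 0)) = (\<lambda>j. - z j)" if "z \<in> S" for z
    proof -
      have "(\<lambda>j. - z j) \<in> S" using that by (simp add: complex_sphere_def)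
      then show ?thesis using normalise_sphere by (simp add: Bv_def D_def)
    qed
  qed (use BS in \<open>auto simp: b_def\<close>)
  have hb: "hom_induced (int ?N) ?T {} ?T {} b \<xi> = \<xi>"
  proof -
    have "homotopic_with (\<lambda>_. True) ?T ?T b id"
      using homotopic_with_trans[OF homotopic_with_symD[OF b_anti] homotopic_antipode_id] .
    then have "hom_induced (int ?N) ?T {} ?T {} b = hom_induced (int ?N) ?T {} ?T {} id" by (rule homology_homotopy_empty)
    then show ?thesis using \<xi> by (simp add: hom_induced_id)
  qed
  have "homotopic_with (\<lambda>_. True) ?T ?T (bump i 0) (bump i 1)"
    by (rule homotopic_sphereI[OF continuous_on_bump_map[of i]]) (auto simp: bump_in_sphere)
  then have ha: "hom_induced (int ?N) ?T {} ?T {} (bump i 0) = hom_induced (int ?N) ?T {} ?T {} (bump i 1)"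
    by (rule homology_homotopy_empty)
  have cm: "continuous_map ?T ?T (bump l s)" if "s \<in> {0..1}" for l s
    using continuous_on_bump_s[OF that] bump_in_sphere by auto
  have cbm: "continuous_map ?T ?T b"
    using homotopic_with_imp_continuous_maps[OF b_anti] by blast
  have Ubound: "openin ?T {z \<in> S. \<epsilon> < dist z c}" "openin ?T {z \<in> S. dist z c < 2 * \<epsilon>}"
  proof -
    have "open {z. \<epsilon> < dist z c}" "open {z. dist z c < 2 * \<epsilon>}"
      by (intro open_Collect_less continuous_on_dist continuous_on_id continuous_on_const)+
    moreover have "{z \<in> S. \<epsilon> < dist z c} = S \<inter> {z. \<epsilon> < dist z c}" "{z \<in> S. dist z c < 2 * \<epsilon>} = S \<inter> {z. dist z c < 2 * \<epsilon>}" by auto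
    ultimately show "openin ?T {z \<in> S. \<epsilon> < dist z c}" "openin ?T {z \<in> S. dist z c < 2 * \<epsilon>}"
      by (simp_all add: openin_open_Int)
  qed
  have cn: "normalise n c = c" by (rule normalise_sphere[OF cS])
  have U: "bump (i + 1) 0 z = bump i 1 z \<and> b z = c" if z: "z \<in> {z \<in> S. \<epsilon> < dist z c}" for z
  proof
    have C0: "Cf (dist z c) = 0" using z Cf_far by simp
    have "wa (i + 1) 0 z k = wa i 1 z k" "wb (i + 1) 0 z k = wb i 1 z k" for k
      using C0 by (auto simp: wa_def wb_def c_def)
    then have "wa (i + 1) 0 z = wa i 1 z" "wb (i + 1) 0 z = wb i 1 z" by auto
    then show "bump (i + 1) 0 z = bump i 1 z" by (simp add: bump_def)
    have "Bv (z, 1) = c" using C0 by (simp add: Bv_def D_def)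
    then show "b z = c" using cn by (simp add: b_def)
  qed
  have V: "bump (i + 1) 0 z = b z \<and> bump i 1 z = c" if z: "z \<in> {z \<in> S. dist z c < 2 * \<epsilon>}" for z
  proof
    have zS: "z \<in> S" and near: "dist z (act i p) < 3 * \<epsilon>" using z eps by (auto simp: c_def)
    have E1: "Ef (dist z c) = 1" using z Ef_near by simp
    have "bumpv (wa (i + 1) 0 z) (wb (i + 1) 0 z) z = Bv (z, 1)"
      unfolding bumpv_single[OF zS admissible_w i near] using E1 by (simp add: wa_def wb_def Bv_def D_def c_def)
    then show "bump (i + 1) 0 z = b z" by (simp add: bump_def b_def)
    have "bumpv (wa i 1 z) (wb i 1 z) z = c"
      unfolding bumpv_single[OF zS admissible_w i near] using E1 by (simp add: wa_def wb_def c_def)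
    then show "bump i 1 z = c" using cn by (simp add: bump_def)
  qed
  have "hom_induced (int ?N) ?T {} ?T {} (bump (i + 1) 0) \<xi> =
    hom_induced (int ?N) ?T {} ?T {} (bump i 1) \<xi> \<otimes>\<^bsub>homology_group (int ?N) ?T\<^esub> hom_induced (int ?N) ?T {} ?T {} b \<xi>"
    by (rule hom_induced_additive[OF _ cm cm cbm Ubound _ _ U V \<xi>]) (use cS eps in auto)
  then show ?thesis unfolding hb ha .
qed

text \<open>Without bumps the map is the identity, and each of the m insertions multiplies by one
  further factor \<xi>.\<close>

lemma bump_homology:
  assumes \<xi>: "\<xi> \<in> carrier (homology_group (int (2 * n + 1)) (top_of_set S))"
  shows "hom_induced (int (2 * n + 1)) (top_of_set S) {} (top_of_set S) {} (bump (int m) 0) \<xi> =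
    \<xi> [^]\<^bsub>homology_group (int (2 * n + 1)) (top_of_set S)\<^esub> Suc m"
proof -
  let ?T = "top_of_set S" and ?N = "2 * n + 1" and ?G = "homology_group (int (2 * n + 1)) (top_of_set S)"
  interpret G: group ?G by simp
  have "hom_induced (int ?N) ?T {} ?T {} (bump (int k) 0) \<xi> = \<xi> [^]\<^bsub>?G\<^esub> Suc k" if "k \<le> m" for k
    using that
  proof (induction k)
    case 0
    have "hom_induced (int ?N) ?T {} ?T {} (bump (int 0) 0) = hom_induced (int ?N) ?T {} ?T {} id"
      by (rule hom_induced_eq) (simp add: bump_0)
    then show ?case using \<xi> G.l_one[OF \<xi>] by (simp add: hom_induced_id)
  next
    case (Suc k)
    have e: "int (Suc k) = int k + 1" by simp
    have "hom_induced (int ?N) ?T {} ?T {} (bump (int k + 1) 0) \<xi> = \<xi> [^]\<^bsub>?G\<^esub> Suc k \<otimes>\<^bsub>?G\<^esub> \<xi>"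
      using bump_step_homology[of "int k", OF _ \<xi>] Suc by simp
    then show ?case unfolding e by (simp only: nat_pow_Suc)
  qed
  then show ?thesis by simp
qed

text \<open>The weights depend only on the distances to the centres, and the isometric action
  permutes the centres. For i = m every residue carries a full bump, so the sums do not change under
  a shift of the residues.\<close>

lemma bump_equivariant:
  assumes z: "z \<in> S"
  shows "bump (int m) 0 (act l z) = act l (bump (int m) 0 z)"
proof -
  define \<alpha> where "\<alpha> = (\<lambda>k. Ef (dist z (act k p)) + Cf (dist z (act k p)))"
  define \<beta> where "\<beta> = (\<lambda>k. Ef (dist z (act k p)) - Cf (dist z (act k p)))"
  have d: "dist (act l z) (act k p) = dist z (act (k - l) p)" for k
    by (simp add: dist_act_shift algebra_simps)
  have wal: "wa (int m) 0 (act l z) k = \<alpha> (k - l)" "wb (int m) 0 (act l z) k = \<beta> (k - l)"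
    "wa (int m) 0 z k = \<alpha> k" "wb (int m) 0 z k = \<beta> k" if "k \<in> deck_reps" for k
    using that by (auto simp: wa_def wb_def \<alpha>_def \<beta>_def d)
  have s1: "(\<Sum>k\<in>deck_reps. wa (int m) 0 (act l z) k) = (\<Sum>k\<in>deck_reps. wa (int m) 0 z k)"
  proof -
    have "(\<Sum>k\<in>deck_reps. \<alpha> (k - l)) = (\<Sum>k\<in>deck_reps. \<alpha> k)"
      by (rule sum_deck_shift) (simp add: \<alpha>_def act_mod)
    then show ?thesis using wal by simp
  qed
  have s2: "(\<Sum>k\<in>deck_reps. of_real (wb (int m) 0 (act l z) k) * act k p j) =
    (\<Sum>k\<in>deck_reps. of_real (wb (int m) 0 z k) * act k p j) * cis (2 * pi * of_int (wt j * l) / real m)" for j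
  proof -
    define h where "h = (\<lambda>k. of_real (\<beta> k) * act l (act k p) j)"
    have "(\<Sum>k\<in>deck_reps. of_real (wb (int m) 0 (act l z) k) * act k p j) = (\<Sum>k\<in>deck_reps. h (k - l))"
      using wal by (intro sum.cong) (auto simp: h_def)
    also have "\<dots> = (\<Sum>k\<in>deck_reps. h k)"
    proof (rule sum_deck_shift)
      fix k
      have "act l (act (k mod int m) p) = act l (act k p)" by (simp only: act_mod)
      then show "h (k mod int m) = h k" by (simp add: h_def \<beta>_def act_mod del: act_act)
    qed
    also have "\<dots> = (\<Sum>k\<in>deck_reps. (of_real (wb (int m) 0 z k) * act k p j) * cis (2 * pi * of_int (wt j * l) / real m))"
      using wal by (intro sum.cong) (auto simp: h_def act_def[of l] mult.assoc simp del: act_act)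
    finally show ?thesis by (simp add: sum_distrib_right)
  qed
  have "bumpv (wa (int m) 0 (act l z)) (wb (int m) 0 (act l z)) (act l z) = act l (bumpv (wa (int m) 0 z) (wb (int m) 0 z) z)"
    unfolding bumpv_def s1 s2 by (rule ext) (simp add: act_def[of l] distrib_right)
  then show ?thesis by (simp add: bump_def normalise_act)
qed

end


text \<open>A rotation of \<open>a\<close> by half the angle of a generator is never in the orbit of \<open>a\<close>, by parity.\<close>

lemma exists_bump_centre:
  assumes a: "a \<in> S"
  shows "\<exists>p \<epsilon>. p \<in> S \<and> \<epsilon> > 0 \<and>
    (\<forall>z\<in>S. \<forall>k l. dist z (act k p) < 3 * \<epsilon> \<longrightarrow> dist z (act l p) < 3 * \<epsilon> \<longrightarrow> int m dvd k - l) \<and>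
    (\<forall>z\<in>S. dist (\<lambda>j. - z j) z \<ge> 3 * \<epsilon>) \<and> (\<forall>k. dist a (act k p) \<ge> 3 * \<epsilon>)"
proof -
  define p where "p = (\<lambda>j. a j * cis (pi / real m))"
  have pS: "p \<in> S" using a by (auto simp: p_def complex_sphere_def norm_mult)
  have ne: "act k p \<noteq> a" for k
  proof
    assume e: "act k p = a"
    obtain j where j: "j \<le> n" "a j \<noteq> 0" using sphere_nonzero[OF a] by blast
    have "a j * (cis (pi / real m) * cis (2 * pi * of_int (wt j * k) / real m)) = a j * 1"
      using fun_cong[OF e, of j] by (simp add: p_def act_def mult.assoc)
    then have "cis (pi / real m + 2 * pi * of_int (wt j * k) / real m) = 1" using j(2) by (simp add: cis_mult)
    moreover have "pi / real m + 2 * pi * of_int (wt j * k) / real m = 2 * pi * (of_int (1 + 2 * (wt j * k)) / (2 * real m))"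
      using m0 by (simp add: field_simps)
    ultimately have "of_int (1 + 2 * (wt j * k)) / (2 * real m) \<in> \<int>" using cis_2pi_eq_1_iff by metis
    then obtain i :: int where "of_int (1 + 2 * (wt j * k)) / (2 * real m) = of_int i" by (auto elim: Ints_cases)
    then have "real_of_int (1 + 2 * (wt j * k)) = real_of_int (2 * (i * int m))" using m0 by (simp add: field_simps)
    then have "1 + 2 * (wt j * k) = 2 * (i * int m)" by (simp only: of_int_eq_iff)
    then show False by presburger
  qed
  obtain \<delta> where \<delta>: "\<delta> > 0" "\<And>z k. z \<in> S \<Longrightarrow> dist z (act k z) < \<delta> \<Longrightarrow> int m dvd k"
    using act_separated by metis
  define A where "A = (\<lambda>k. act k p) ` deck_reps"
  have A: "finite A" "A \<noteq> {}" using m2 by (auto simp: A_def)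
  have Aact: "act k p \<in> A" for k
  proof -
    have "act k p = act (k mod int m) p" by (simp add: act_mod)
    moreover have "k mod int m \<in> deck_reps" using m2 by simp
    ultimately show ?thesis unfolding A_def by blast
  qed
  define d where "d = Min (dist a ` A)"
  have d: "d > 0" "\<And>k. d \<le> dist a (act k p)"
    unfolding d_def using A Aact ne by (auto simp: Min_gr_iff A_def)
  have cneg: "continuous_on S (\<lambda>z::nat \<Rightarrow> complex. (\<lambda>j. - z j))"
    by (rule continuous_on_coordinatewise_then_product) (intro continuous_on_minus continuous_on_coord[OF continuous_on_id])
  have "continuous_on S (\<lambda>z. dist (\<lambda>j. - z j) z)" by (intro continuous_on_dist cneg continuous_on_id)
  moreover have "S \<noteq> {}" using a by blast
  ultimately have "\<exists>z0\<in>S. \<forall>z\<in>S. dist (\<lambda>j. - z0 j) z0 \<le> dist (\<lambda>j. - z j) z"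
    by (intro continuous_attains_inf compact_complex_sphere)
  then obtain z0 where z0: "z0 \<in> S" "\<And>z. z \<in> S \<Longrightarrow> dist (\<lambda>j. - z0 j) z0 \<le> dist (\<lambda>j. - z j) z" by blast
  define \<mu> where "\<mu> = dist (\<lambda>j. - z0 j) z0"
  have \<mu>: "\<mu> > 0"
  proof -
    obtain j where "z0 j \<noteq> 0" using sphere_nonzero[OF z0(1)] by blast
    then have "- z0 j \<noteq> z0 j" by (simp add: neg_eq_iff_add_eq_0)
    then have "(\<lambda>j. - z0 j) \<noteq> z0" by (metis (full_types))
    then show ?thesis unfolding \<mu>_def by simp
  qed
  \<comment> \<open>6 = 3 + 3: two translates of p within 3\<epsilon> of z are less than 6\<epsilon>
    <= \<delta> apart.\<close>
  define \<epsilon> where "\<epsilon> = min (min \<delta> d) \<mu> / 6"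
  have eps: "\<epsilon> > 0" "6 * \<epsilon> \<le> \<delta>" "6 * \<epsilon> \<le> d" "6 * \<epsilon> \<le> \<mu>" using \<delta>(1) d(1) \<mu> by (auto simp: \<epsilon>_def)
  show ?thesis
  proof (intro exI[of _ p] exI[of _ \<epsilon>] conjI ballI allI impI)
    fix z k l assume "z \<in> S" "dist z (act k p) < 3 * \<epsilon>" "dist z (act l p) < 3 * \<epsilon>"
    then have "dist (act l p) (act (k - l) (act l p)) < \<delta>"
      using dist_triangle3[of "act l p" "act k p" z] eps(2) by simp
    then show "int m dvd k - l" by (rule \<delta>(2)[rotated]) (use pS in simp)
  next
    show "3 * \<epsilon> \<le> dist (\<lambda>j. - z j) z" if "z \<in> S" for z using z0(2)[OF that] eps by (simp add: \<mu>_def)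
    show "3 * \<epsilon> \<le> dist a (act k p)" for k using d(2)[of k] eps by simp
  qed (use pS eps in auto)
qed

text \<open>The bumps sit around an orbit that keeps its distance from a, so F fixes a and, by
  equivariance, its whole orbit. The degree is expressed as a power in the top homology
  group.\<close>

proposition exists_equivariant_map_of_degree_Suc_m:
  assumes a: "a \<in> S"
  obtains F where "continuous_on S F" "F ` S \<subseteq> S" "\<And>l z. z \<in> S \<Longrightarrow> F (act l z) = act l (F z)" "\<And>l. F (act l a) = act l a"
    "\<And>\<xi>. \<xi> \<in> carrier (homology_group (int (2 * n + 1)) (top_of_set S)) \<Longrightarrow>
      hom_induced (int (2 * n + 1)) (top_of_set S) {} (top_of_set S) {} F \<xi> =
        \<xi> [^]\<^bsub>homology_group (int (2 * n + 1)) (top_of_set S)\<^esub> Suc m"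
proof -
  obtain p \<epsilon> where p': "p \<in> S" "\<epsilon> > 0"
    "\<forall>z\<in>S. \<forall>k l. dist z (act k p) < 3 * \<epsilon> \<longrightarrow> dist z (act l p) < 3 * \<epsilon> \<longrightarrow> int m dvd k - l"
    "\<forall>z\<in>S. dist (\<lambda>j. - z j) z \<ge> 3 * \<epsilon>" "\<forall>k. dist a (act k p) \<ge> 3 * \<epsilon>"
    using exists_bump_centre[OF a] by (elim exE conjE) (rule that)
  then have p: "p \<in> S" "\<epsilon> > 0"
    "\<And>z k l. z \<in> S \<Longrightarrow> dist z (act k p) < 3 * \<epsilon> \<Longrightarrow> dist z (act l p) < 3 * \<epsilon> \<Longrightarrow> int m dvd k - l"
    "\<And>z. z \<in> S \<Longrightarrow> dist (\<lambda>j. - z j) z \<ge> 3 * \<epsilon>"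
    "\<And>k. dist a (act k p) \<ge> 3 * \<epsilon>"
    by blast+
  define F where "F = bump p \<epsilon> (int m) 0"
  have Fa: "F a = a"
    unfolding F_def by (rule bump_far; (fact p(1,2,3,4) a | rule p(5)))
  show thesis
  proof (rule that[of F])
    show "continuous_on S F" unfolding F_def by (rule continuous_on_bump_s; (fact p(1,2,3,4) | simp))
    have "F z \<in> S" if "z \<in> S" for z unfolding F_def by (rule bump_in_sphere) (fact p(1,2,3,4) that)+
    then show "F ` S \<subseteq> S" by blast
    show F_eq: "F (act l z) = act l (F z)" if "z \<in> S" for l z unfolding F_def by (rule bump_equivariant) (fact p(1,2,3,4) that)+
    show "F (act l a) = act l a" for l using F_eq[OF a] Fa by simp
    show "hom_induced (int (2 * n + 1)) (top_of_set S) {} (top_of_set S) {} F \<xi> =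
        \<xi> [^]\<^bsub>homology_group (int (2 * n + 1)) (top_of_set S)\<^esub> Suc m"
      if "\<xi> \<in> carrier (homology_group (int (2 * n + 1)) (top_of_set S))" for \<xi>
      unfolding F_def by (rule bump_homology) (fact p(1,2,3,4) that)+
  qed
qed

section \<open>The self-closeness number\<close>

text \<open>A lift u of the cube takes the boundary into the orbit of a, possibly to several of its
  points when i = 1; as F fixes the orbit pointwise, F u and u agree on the boundary. The prism over
  the cube has dimension i + 1 <= 2n + 1, so a homotopy between them extends, and it is then
  projected to the lens space.\<close>

lemma equivariant_map_trivial_on_lower_homotopy:
  assumes F: "continuous_on S F" "F ` S \<subseteq> S" "\<And>l z. z \<in> S \<Longrightarrow> F (act l z) = act l (F z)" "\<And>l. F (act l a) = act l a"
    and a: "a \<in> S" and i: "i \<le> 2 * n" and g: "g \<in> cube_maps i L (\<pi> a)"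
  shows "(desc F \<circ> g, g) \<in> cube_htpy i L (\<pi> a)"
proof -
  let ?C = "unit_cube i" and ?B = "cube_boundary i"
  have z: "(\<lambda>_. 0) \<in> ?C" by (simp add: unit_cube_def)
  have gL: "g t \<in> \<pi> ` S" if "t \<in> ?C" for t
    using continuous_map_image_subset_topspace[OF cube_mapsD(1)[OF g]] that by auto
  then obtain b where b: "b \<in> S" "g (\<lambda>_. 0) = \<pi> b" using z by blast
  obtain u where u: "continuous_on ?C u" "\<And>t. t \<in> ?C \<Longrightarrow> u t \<in> S" "\<And>t. t \<in> ?C \<Longrightarrow> \<pi> (u t) = g t"
    using lift_cube[OF cube_mapsD(1)[OF g] z b] by blast
  have BC: "?B \<subseteq> ?C" by (rule cube_boundary_subset)
  have uB: "F (u t) = u t" if t: "t \<in> ?B" for t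
  proof -
    have "\<pi> a = \<pi> (u t)" using u(3)[of t] cube_mapsD(2)[OF g t] t BC by auto
    then obtain l where "u t = act l a" using orbit_eq_iff by blast
    then show ?thesis using F(4) by simp
  qed
  define A where "A = ?C \<times> {0} \<union> (?C \<times> {1} \<union> ?B \<times> {0..1::real})"
  define f where "f = (\<lambda>p::(nat \<Rightarrow> real) \<times> real. if snd p = 0 then F (u (fst p)) else u (fst p))"
  have cl: "closed (?C \<times> {0::real})" "closed (?C \<times> {1} \<union> ?B \<times> {0..1::real})"
    using compact_imp_closed[OF compact_unit_cube] compact_imp_closed[OF compact_cube_boundary]
    by (auto intro!: closed_Un closed_Times)
  have cu: "continuous_on X (\<lambda>p::(nat \<Rightarrow> real) \<times> real. u (fst p))" if "fst ` X \<subseteq> ?C" for X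
    by (rule continuous_on_compose2[OF u(1) continuous_on_fst[OF continuous_on_id] that])
  have "continuous_on (?C \<times> {0::real}) f"
  proof (rule continuous_on_eq)
    show "continuous_on (?C \<times> {0::real}) (\<lambda>p. F (u (fst p)))"
      by (rule continuous_on_compose2[OF F(1) cu]) (use u in auto)
  qed (auto simp: f_def)
  moreover have "continuous_on (?C \<times> {1} \<union> ?B \<times> {0..1::real}) f"
    by (rule continuous_on_eq[OF cu]) (use uB BC in \<open>auto simp: f_def\<close>)
  ultimately have cf: "continuous_on A f" unfolding A_def using continuous_on_closed_Un[OF cl] by blast
  have fS: "f ` A \<subseteq> S"
  proof
    fix y assume "y \<in> f ` A"
    then obtain p where p: "p \<in> A" "y = f p" by blast
    then have "u (fst p) \<in> S" using u(2) BC by (auto simp: A_def)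
    then show "y \<in> S" using p(2) F(2) by (auto simp: f_def)
  qed
  obtain H where H: "continuous_on (?C \<times> {0..1::real}) H" "H ` (?C \<times> {0..1}) \<subseteq> S" "\<And>p. p \<in> A \<Longrightarrow> H p = f p"
  proof (rule extend_map_into_sphere[OF _ low_dim_Times_interval[OF low_dim_unit_cube] _ _ _ cf fS])
    show "compact (?C \<times> {0..1::real})" by (intro compact_Times compact_unit_cube compact_Icc)
    show "Suc i \<le> 2 * n + 1" using i by simp
    show "closed A" unfolding A_def using cl by blast
    show "A \<subseteq> ?C \<times> {0..1}" using BC by (auto simp: A_def)
  qed auto
  show ?thesis
  proof (rule cube_htpyI[OF continuous_map_orbit_compose[OF H(1,2)]])
    show "\<pi> (H (t, 0)) = (desc F \<circ> g) t" if t: "t \<in> ?C" for t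
    proof -
      have "H (t, 0) = F (u t)" using H(3)[of "(t, 0)"] t by (simp add: A_def f_def)
      moreover have "desc F (\<pi> (u t)) = \<pi> (F (u t))" by (rule desc_orbit[OF _ u(2)[OF t], where r = 1]) (use F(3) in simp)
      ultimately show ?thesis using u(3)[OF t] by simp
    qed
    show "\<pi> (H (t, 1)) = g t" if t: "t \<in> ?C" for t
      using H(3)[of "(t, 1)"] u(3)[OF t] t by (simp add: A_def f_def)
    show "\<pi> (H (t, s)) = \<pi> a" if t: "t \<in> ?B" and s: "s \<in> {0..1}" for t s
    proof -
      have "H (t, s) = u t" using H(3)[of "(t, s)"] uB[OF t] t s by (simp add: A_def f_def)
      then show ?thesis using u(3)[of t] cube_mapsD(2)[OF g t] t BC by auto
    qed
  qed
qed

text \<open>The homotopy downstairs lifts to one starting at G after F. Its end covers the identity,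
  hence is a deck transformation, and this is homotopic to the identity.\<close>

lemma left_invertible_lift:
  assumes F: "continuous_on S F" "F ` S \<subseteq> S" "\<And>l z. z \<in> S \<Longrightarrow> F (act l z) = act l (F z)" "F a = a"
    and a: "a \<in> S" and g: "g \<in> based_self_maps L (\<pi> a)" "(g \<circ> desc F, id) \<in> based_self_htpy L (\<pi> a)"
  shows "\<exists>G. continuous_on S G \<and> G ` S \<subseteq> S \<and> homotopic_with (\<lambda>_. True) (top_of_set S) (top_of_set S) (G \<circ> F) id"
proof -
  obtain G where G: "continuous_on S G" "G ` S \<subseteq> S" "\<And>x. x \<in> S \<Longrightarrow> \<pi> (G x) = g (\<pi> x)"
    using lift_self_map[OF based_self_mapsD(1)[OF g(1)] a a] based_self_mapsD(2)[OF g(1)] by blast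
  obtain h where h: "continuous_map (prod_topology (top_of_set {0..1::real}) L) L h"
    "\<forall>x. h (0, x) = (g \<circ> desc F) x" "\<forall>x. h (1, x) = id x"
    using g(2) unfolding based_htpy_iff homotopic_with_def by blast
  have "continuous_map (top_of_set (S \<times> {0..1::real})) (prod_topology (top_of_set {0..1::real}) L) (\<lambda>p. (snd p, \<pi> (fst p)))"
    unfolding continuous_map_pairwise o_def fst_conv snd_conv
  proof
    show "continuous_map (top_of_set (S \<times> {0..1::real})) (top_of_set {0..1}) (\<lambda>x. snd x)"
      by (auto intro: continuous_on_snd continuous_on_id)
    show "continuous_map (top_of_set (S \<times> {0..1::real})) L (\<lambda>x. \<pi> (fst x))"
      by (rule continuous_map_orbit_compose) (auto intro: continuous_on_fst continuous_on_id)
  qed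
  then have ch: "continuous_map (top_of_set (S \<times> {0..1::real})) L (\<lambda>p. h (snd p, \<pi> (fst p)))"
    using continuous_map_compose[OF _ h(1)] by (simp add: o_def)
  have cGF: "continuous_on S (\<lambda>z. G (F z))" by (rule continuous_on_compose2[OF G(1) F(1,2)])
  have FS: "F z \<in> S" if "z \<in> S" for z using F(2) that by blast
  have GF: "G (F z) \<in> S" if "z \<in> S" for z using G(2) FS[OF that] by blast
  have dF: "desc F (\<pi> z) = \<pi> (F z)" if "z \<in> S" for z by (rule desc_orbit[OF _ that, where r = 1]) (use F(3) in simp)
  have "\<exists>H. continuous_on (S \<times> {0..1}) H \<and> (\<forall>z\<in>S. H (z, 0) = G (F z)) \<and>
    (\<forall>p\<in>S \<times> {0..1}. H p \<in> S \<and> \<pi> (H p) = h (snd p, \<pi> (fst p)))"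
  proof (rule lift_homotopy[OF compact_complex_sphere ch cGF GF])
    show "\<pi> (G (F z)) = h (snd (z, 0), \<pi> (fst (z, 0)))" if "z \<in> S" for z
      using h(2) dF[OF that] G(3)[OF FS[OF that]] by simp
  qed
  then obtain H where H: "continuous_on (S \<times> {0..1}) H" "\<And>z. z \<in> S \<Longrightarrow> H (z, 0) = G (F z)"
    "\<And>p. p \<in> S \<times> {0..1} \<Longrightarrow> H p \<in> S" "\<And>p. p \<in> S \<times> {0..1} \<Longrightarrow> \<pi> (H p) = h (snd p, \<pi> (fst p))" by blast
  have end': "\<pi> (H (z, 1)) = \<pi> z" if "z \<in> S" for z using H(4)[of "(z, 1)"] h(3) that by simp
  obtain k where k: "H (a, 1) = act k a" using end'[OF a] orbit_eq_iff by metis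
  have H1: "H (z, 1) = act k z" if z: "z \<in> S" for z
  proof (rule lifts_differ_by_deck[where G = "\<lambda>z. z" and G' = "\<lambda>z. H (z, 1)", OF connected_complex_sphere continuous_on_id _ _ _ a k z])
    show "continuous_on S (\<lambda>z. H (z, 1))"
      by (rule continuous_on_compose2[OF H(1) continuous_on_Pair[OF continuous_on_id continuous_on_const]]) auto
  qed (use end' in auto)
  have "homotopic_with (\<lambda>_. True) (top_of_set S) (top_of_set S) (G \<circ> F) (act k)"
    by (rule homotopic_sphereI[OF H(1)]) (use H H1 in auto)
  then have "homotopic_with (\<lambda>_. True) (top_of_set S) (top_of_set S) (G \<circ> F) id"
    using homotopic_act_id homotopic_with_trans by blast
  then show ?thesis using G by blast
qed

text \<open>A left inverse downstairs would lift to a map G whose effect on the top homology group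
  of the sphere sends the (m+1)-st power of every \<xi> back to \<xi>, which is impossible in an
  infinite cyclic group.\<close>

proposition A_sharp_below_top:
  assumes a: "a \<in> S" and k: "k \<le> 2 * n"
  shows "A_sharp (enat k) L (\<pi> a) \<noteq> self_equivalence_classes L (\<pi> a)"
proof -
  let ?M = "based_self_maps L (\<pi> a)" and ?H = "based_self_htpy L (\<pi> a)" and ?T = "top_of_set S" and ?N = "int (2 * n + 1)"
  obtain F where F: "continuous_on S F" "F ` S \<subseteq> S" "\<And>l z. z \<in> S \<Longrightarrow> F (act l z) = act l (F z)" "\<And>l. F (act l a) = act l a"
    "\<And>\<xi>. \<xi> \<in> carrier (homology_group ?N ?T) \<Longrightarrow> hom_induced ?N ?T {} ?T {} F \<xi> = \<xi> [^]\<^bsub>homology_group ?N ?T\<^esub> Suc m"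
    using exists_equivariant_map_of_degree_Suc_m[OF a] by blast
  have Fa: "F a = a" using F(4)[of 0] by simp
  have F1: "\<And>l z. z \<in> S \<Longrightarrow> F (act l z) = act (1 * l) (F z)" using F(3) by simp
  have f: "desc F \<in> ?M"
  proof (rule based_self_mapsI)
    show "continuous_map L L (desc F)" by (rule continuous_map_desc[where r = 1]) (fact F1 F(1,2))+
    have "desc F (\<pi> a) = \<pi> (F a)" by (rule desc_orbit[where r = 1]) (fact F1 a)+
    then show "desc F (\<pi> a) = \<pi> a" using Fa by simp
  qed
  have "induces_iso i L (\<pi> a) (?H `` {desc F})" if i: "i \<le> k" for i
    unfolding induces_iso_iff_bij[OF f]
  proof (subst bij_betw_cong)
    show "induced_map i L (\<pi> a) (?H `` {desc F}) A = id A" if A: "A \<in> carrier (homotopy_group i L (\<pi> a))" for A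
    proof -
      obtain g where g: "g \<in> cube_maps i L (\<pi> a)" "A = cube_htpy i L (\<pi> a) `` {g}" using A by (rule carrierE)
      have "(desc F \<circ> g, g) \<in> cube_htpy i L (\<pi> a)"
        by (rule equivariant_map_trivial_on_lower_homotopy[OF F(1,2,3,4) a _ g(1)]) (use i k in auto)
      then show ?thesis using induced_map_class[OF f g(1)] equiv_class_eq[OF equiv_cube_htpy] g(2) by simp
    qed
  qed (rule bij_betw_id)
  then have "?H `` {desc F} \<in> A_sharp (enat k) L (\<pi> a)"
    unfolding A_sharp_def self_map_classes_def using quotientI[OF f, of ?H] by simp
  moreover have "?H `` {desc F} \<notin> self_equivalence_classes L (\<pi> a)"
  proof
    assume "?H `` {desc F} \<in> self_equivalence_classes L (\<pi> a)"
    then obtain g where g: "g \<in> ?M" "(g \<circ> desc F, id) \<in> ?H" unfolding self_equivalence_class_iff[OF f] by blast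
    obtain G where G: "continuous_on S G" "G ` S \<subseteq> S" "homotopic_with (\<lambda>_. True) ?T ?T (G \<circ> F) id"
      using left_invertible_lift[OF F(1,2,3) Fa a g] by blast
    have cF: "continuous_map ?T ?T F" and cG: "continuous_map ?T ?T G" using F(1,2) G(1,2) by auto
    have "hom_induced ?N ?T {} ?T {} (G \<circ> F) = hom_induced ?N ?T {} ?T {} id" by (rule homology_homotopy_empty[OF G(3)])
    then have comp: "hom_induced ?N ?T {} ?T {} G (hom_induced ?N ?T {} ?T {} F \<xi>) = \<xi>"
      if "\<xi> \<in> carrier (homology_group ?N ?T)" for \<xi>
      using that hom_induced_compose_empty[OF cF cG, of ?N] by (metis comp_apply hom_induced_id)
    show False
    proof (rule no_root_of_generator[OF homology_complex_sphere])
      show "hom_induced ?N ?T {} ?T {} G (\<xi> [^]\<^bsub>homology_group ?N ?T\<^esub> Suc m) = \<xi>"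
        if "\<xi> \<in> carrier (homology_group ?N ?T)" for \<xi>
        using comp[OF that] F(5)[OF that] by simp
    qed (use m2 hom_induced_empty_hom in auto)
  qed
  ultimately show ?thesis by blast
qed

end

theorem theorem14:
  fixes m n :: nat and q :: "nat \<Rightarrow> int" and x0 :: "(nat \<Rightarrow> complex) set"
  assumes "m \<ge> 2" and "n \<ge> 1"
    and "\<And>j. j \<in> {1..n} \<Longrightarrow> coprime (q j) (int m)"
    and "x0 \<in> topspace (lens_space n m q)"
  shows "self_closeness_number (lens_space n m q) x0 = enat (2 * n + 1)"
proof -
  interpret lens m n q using assms by unfold_locales
  obtain a where a: "a \<in> S" "x0 = \<pi> a" using assms(4) by auto
  show ?thesis
    unfolding self_closeness_number_def a(2)
  proof (rule Least_equality)
    show "A_sharp (enat (2 * n + 1)) L (\<pi> a) = self_equivalence_classes L (\<pi> a)"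
      by (rule equalityI[OF A_sharp_subset_self_equivalences[OF a(1)] self_equivalence_subset_A_sharp])
  next
    fix k assume k: "A_sharp k L (\<pi> a) = self_equivalence_classes L (\<pi> a)"
    show "enat (2 * n + 1) \<le> k"
    \<comment> \<open>For finite k the preceding result excludes k <= 2n; the infinite case is
      immediate.\<close>
    proof (cases k)
      case (enat i)
      then show ?thesis using A_sharp_below_top[OF a(1), of i] k by (cases "i \<le> 2 * n") auto
    qed simp
  qed
qed

end
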